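(* Let $U$ be a countable field and let $\mathcal Q$ be an infinite set of rational primes not containing the prime equal to the characteristic of $U$. Let $\mathcal R=\{R_q(T): q \in \mathcal Q\} \subset U(T)$ be such that, for every $q\in\mathcal Q$: all the zeros and poles of $R_q$ are in $U$; at least one pole or zero of $R_q(T)$ is of degree (multiplicity) not divisible by $q$; and for any $x \in U$ (which is not a pole of $R_q$) there exists $y \in U$ such that $y^q=R_q(x)$. Let $\mathcal P=\{P_i(T): i \in \mathbb{Z}_{>0}\} \subset U[T]$ be such that for any $i$ the polynomial $P_i(T)$ is irreducible over $U$ and $P_i$ does not factor in any extension of degree $q \in \mathcal Q$. Let $\mathcal Z=\{Z_i(T): i \in \mathbb{Z}_{>0}\} \subset U[T]$ be such that for any $i$ the polynomial $Z_i(T)$ has a root in $U$. Let $\mathfrak T_{U,\mathcal R,\mathcal P,\mathcal Z}$ be the first-order theory of fields, in the language with a constant symbol for every element of $U$, consisting of the atomic diagram of $U$ and the following statements: (1) for every $q \in \mathcal Q$: $\forall x\, \exists y:\ y^q=R_q(x)$ (for $x$ not a pole of $R_q$); (2) for every $i$: $P_i(T)$ is irreducible; (3) for every $i$: $Z_i(T)$ has a root. Then there exists a model $G \models \mathfrak T_{U,\mathcal R,\mathcal P,\mathcal Z}$ of any transcendence degree over $U$.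
   Context: The language is the language of rings expanded by a constant symbol for each element of $U$. "Theory of fields" means that the field axioms are part of the theory. The atomic diagram of $U$ is the set of all atomic and negated atomic sentences of this language that are true in $U$; thus a model is a field extension of $U$. Statements (2) and (3) are families of first-order sentences, one for each $i$, asserting that the polynomial is irreducible over, respectively has a root in, the model. *)

theory Defs
  imports "HOL-Algebra.Finite_Extensions" "HOL-Algebra.Generated_Fields"
    "HOL-Library.Countable_Set" "HOL-Computational_Algebra.Primes"
begin

text \<open>First-order logic over the language of rings with additional constant symbols from
  \<^typ>\<open>'c\<close>. Variables are named by natural numbers; equality is the only relation.\<close>

datatype 'c trm =
    Var nat | Const 'c | Zero | One | Minus "'c trm" | Add "'c trm" "'c trm" | Mul "'c trm" "'c trm"

datatype 'c fm = Eq "'c trm" "'c trm" | Neg "'c fm" | And "'c fm" "'c fm" | Exists nat "'c fm"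

definition Or :: "'c fm \<Rightarrow> 'c fm \<Rightarrow> 'c fm"
  where "Or \<phi> \<psi> = Neg (And (Neg \<phi>) (Neg \<psi>))"

definition Forall :: "nat \<Rightarrow> 'c fm \<Rightarrow> 'c fm"
  where "Forall x \<phi> = Neg (Exists x (Neg \<phi>))"

definition Falsity :: "'c fm"
  where "Falsity = Neg (Eq Zero Zero)"

definition Conj :: "'c fm list \<Rightarrow> 'c fm"
  where "Conj \<phi>s = foldr And \<phi>s (Neg Falsity)"

definition Exs :: "nat list \<Rightarrow> 'c fm \<Rightarrow> 'c fm"
  where "Exs xs \<phi> = foldr Exists xs \<phi>"

definition Sum :: "'c trm list \<Rightarrow> 'c trm"
  where "Sum ts = foldr Add ts Zero"

primrec Pow :: "'c trm \<Rightarrow> nat \<Rightarrow> 'c trm" where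
  "Pow t 0 = One"
| "Pow t (Suc n) = Mul (Pow t n) t"

text \<open>Polynomials are, as in \<^theory>\<open>HOL-Algebra.Polynomials\<close>, coefficient lists with
  the leading coefficient first.\<close>

primrec poly_trm :: "'c list \<Rightarrow> 'c trm \<Rightarrow> 'c trm" where
  "poly_trm [] t = Zero"
| "poly_trm (c # p) t = Add (Mul (Const c) (Pow t (length p))) (poly_trm p t)"

primrec trm_vars :: "'c trm \<Rightarrow> nat set" where
  "trm_vars (Var n) = {n}"
| "trm_vars (Const c) = {}"
| "trm_vars Zero = {}"
| "trm_vars One = {}"
| "trm_vars (Minus t) = trm_vars t"
| "trm_vars (Add s t) = trm_vars s \<union> trm_vars t"
| "trm_vars (Mul s t) = trm_vars s \<union> trm_vars t"

primrec free_vars :: "'c fm \<Rightarrow> nat set" where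
  "free_vars (Eq s t) = trm_vars s \<union> trm_vars t"
| "free_vars (Neg \<phi>) = free_vars \<phi>"
| "free_vars (And \<phi> \<psi>) = free_vars \<phi> \<union> free_vars \<psi>"
| "free_vars (Exists x \<phi>) = free_vars \<phi> - {x}"

text \<open>Structures extend the ring records of HOL-Algebra, so that a model can be used
  directly as a field in the sense of that library.\<close>

record ('c, 'a) ring_structure = "'a ring" +
  neg :: "'a \<Rightarrow> 'a"
  cst :: "'c \<Rightarrow> 'a"

text \<open>\<open>C\<close> is the set of constant symbols of the language.\<close>

definition is_structure :: "'c set \<Rightarrow> ('c, 'a) ring_structure \<Rightarrow> bool" where
  "is_structure C G \<longleftrightarrow>
     \<zero>\<^bsub>G\<^esub> \<in> carrier G \<and> \<one>\<^bsub>G\<^esub> \<in> carrier G \<and>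
     (\<forall>a \<in> carrier G. neg G a \<in> carrier G) \<and>
     (\<forall>a \<in> carrier G. \<forall>b \<in> carrier G. a \<oplus>\<^bsub>G\<^esub> b \<in> carrier G \<and> a \<otimes>\<^bsub>G\<^esub> b \<in> carrier G) \<and>
     (\<forall>c \<in> C. cst G c \<in> carrier G)"

primrec val :: "('c, 'a) ring_structure \<Rightarrow> (nat \<Rightarrow> 'a) \<Rightarrow> 'c trm \<Rightarrow> 'a" where
  "val G e (Var n) = e n"
| "val G e (Const c) = cst G c"
| "val G e Zero = \<zero>\<^bsub>G\<^esub>"
| "val G e One = \<one>\<^bsub>G\<^esub>"
| "val G e (Minus t) = neg G (val G e t)"
| "val G e (Add s t) = val G e s \<oplus>\<^bsub>G\<^esub> val G e t"
| "val G e (Mul s t) = val G e s \<otimes>\<^bsub>G\<^esub> val G e t"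

primrec sat :: "('c, 'a) ring_structure \<Rightarrow> (nat \<Rightarrow> 'a) \<Rightarrow> 'c fm \<Rightarrow> bool" where
  "sat G e (Eq s t) \<longleftrightarrow> val G e s = val G e t"
| "sat G e (Neg \<phi>) \<longleftrightarrow> \<not> sat G e \<phi>"
| "sat G e (And \<phi> \<psi>) \<longleftrightarrow> sat G e \<phi> \<and> sat G e \<psi>"
| "sat G e (Exists x \<phi>) \<longleftrightarrow> (\<exists>a \<in> carrier G. sat G (e(x := a)) \<phi>)"

definition true_in :: "('c, 'a) ring_structure \<Rightarrow> 'c fm \<Rightarrow> bool"
  where "true_in G \<phi> \<longleftrightarrow> (\<forall>e. range e \<subseteq> carrier G \<longrightarrow> sat G e \<phi>)"

definition is_model :: "'c set \<Rightarrow> ('c, 'a) ring_structure \<Rightarrow> 'c fm set \<Rightarrow> bool"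
  where "is_model C G T \<longleftrightarrow> is_structure C G \<and> (\<forall>\<phi> \<in> T. true_in G \<phi>)"

definition field_axioms_fm :: "'c fm set" where
  "field_axioms_fm =
    (let x = Var 0; y = Var 1; z = Var 2 in
     { Forall 0 (Forall 1 (Forall 2 (Eq (Add (Add x y) z) (Add x (Add y z))))),
       Forall 0 (Forall 1 (Eq (Add x y) (Add y x))),
       Forall 0 (Eq (Add x Zero) x),
       Forall 0 (Eq (Add x (Minus x)) Zero),
       Forall 0 (Forall 1 (Forall 2 (Eq (Mul (Mul x y) z) (Mul x (Mul y z))))),
       Forall 0 (Forall 1 (Eq (Mul x y) (Mul y x))),
       Forall 0 (Eq (Mul x One) x),
       Forall 0 (Forall 1 (Forall 2 (Eq (Mul x (Add y z)) (Add (Mul x y) (Mul x z))))),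
       Neg (Eq Zero One),
       Forall 0 (Or (Eq x Zero) (Exists 1 (Eq (Mul x y) One))) })"

definition self_structure :: "'u ring \<Rightarrow> ('u, 'u) ring_structure" where
  "self_structure U =
     \<lparr> carrier = carrier U, mult = mult U, one = one U, zero = zero U, add = add U,
       neg = a_inv U, cst = (\<lambda>c. c) \<rparr>"

definition atomic_diagram :: "'u ring \<Rightarrow> 'u fm set" where
  "atomic_diagram U =
     {\<phi>. (\<exists>s t. \<phi> = Eq s t \<or> \<phi> = Neg (Eq s t)) \<and>
         free_vars \<phi> = {} \<and> set_fm \<phi> \<subseteq> carrier U \<and> true_in (self_structure U) \<phi>}"

text \<open>A rational function is a fraction \<open>(f, g)\<close> in lowest terms. Hence its zeros and poles
  are the roots of \<open>f\<close> and \<open>g\<close>, with the same multiplicities.\<close>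

definition rational_function :: "'u ring \<Rightarrow> 'u list \<times> 'u list \<Rightarrow> bool" where
  "rational_function U = (\<lambda>(f, g).
     f \<in> carrier (poly_ring U) \<and> g \<in> carrier (poly_ring U) \<and> g \<noteq> [] \<and>
     (\<forall>d \<in> carrier (poly_ring U). d pdivides\<^bsub>U\<^esub> f \<and> d pdivides\<^bsub>U\<^esub> g
        \<longrightarrow> d \<in> Units (poly_ring U)))"

definition is_zero_of :: "'u ring \<Rightarrow> 'u list \<times> 'u list \<Rightarrow> 'u \<Rightarrow> bool"
  where "is_zero_of U r = ring.is_root U (fst r)"

definition is_pole_of :: "'u ring \<Rightarrow> 'u list \<times> 'u list \<Rightarrow> 'u \<Rightarrow> bool"
  where "is_pole_of U r = ring.is_root U (snd r)"

text \<open>All zeros and poles, in whatever extension of \<open>U\<close>, lie in \<open>U\<close>: numerator and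
  denominator have as many roots in \<open>U\<close>, counted with multiplicity, as their degree.\<close>

definition zeros_poles_in :: "'u ring \<Rightarrow> 'u list \<times> 'u list \<Rightarrow> bool"
  where "zeros_poles_in U r \<longleftrightarrow> ring.splitted U (fst r) \<and> ring.splitted U (snd r)"

definition rat_eval :: "'u ring \<Rightarrow> 'u list \<times> 'u list \<Rightarrow> 'u \<Rightarrow> 'u"
  where "rat_eval U r x = ring.eval U (fst r) x \<otimes>\<^bsub>U\<^esub> inv\<^bsub>U\<^esub> (ring.eval U (snd r) x)"

text \<open>\<open>\<forall>x. g(x) \<noteq> 0 \<longrightarrow> (\<exists>y. y\<^sup>q = f(x) / g(x))\<close>, with the denominator cleared because
  the language of rings has no division.\<close>

definition power_sentence :: "nat \<Rightarrow> 'c list \<times> 'c list \<Rightarrow> 'c fm" where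
  "power_sentence q = (\<lambda>(f, g).
     Forall 0 (Or (Eq (poly_trm g (Var 0)) Zero)
               (Exists 1 (Eq (Mul (Pow (Var 1) q) (poly_trm g (Var 0))) (poly_trm f (Var 0))))))"

text \<open>For \<open>p\<close> of degree \<open>n\<close>: there are no \<open>0 < k < n\<close> and polynomials
  \<open>x\<^sub>0 + \<dots> + x\<^sub>k T\<^sup>k\<close> and \<open>y\<^sub>0 + \<dots> + y\<^sub>n\<^sub>-\<^sub>k T\<^sup>n\<^sup>-\<^sup>k\<close> whose product is \<open>p\<close>. The variables
  \<open>0, \<dots>, k\<close> stand for the \<open>x\<^sub>i\<close> and \<open>k + 1, \<dots>, n + 1\<close> for the \<open>y\<^sub>i\<close>.
  As the leading coefficient of \<open>p\<close> is nonzero, the factors have degree exactly \<open>k\<close> and \<open>n - k\<close>.\<close>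

definition product_coeff :: "nat \<Rightarrow> nat \<Rightarrow> nat \<Rightarrow> 'c trm" where
  "product_coeff n k j =
     Sum [Mul (Var i) (Var (k + 1 + (j - i))). i \<leftarrow> [0..<j + 1], i \<le> k, j - i \<le> n - k]"

definition irreducible_sentence :: "'c list \<Rightarrow> 'c fm" where
  "irreducible_sentence p = (let n = degree p in
     if n = 0 then Falsity
     else Conj [Neg (Exs [0..<n + 2]
                  (Conj [Eq (product_coeff n k j) (Const (p ! (n - j))). j \<leftarrow> [0..<n + 1]])).
                k \<leftarrow> [1..<n]])"

definition root_sentence :: "'c list \<Rightarrow> 'c fm"
  where "root_sentence p = Exists 0 (Eq (poly_trm p (Var 0)) Zero)"

text \<open>The families \<open>P\<close> and \<open>Z\<close> are indexed by the positive integers; the value of the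
  functions at 0 is ignored.\<close>

definition theory_of ::
  "'u ring \<Rightarrow> nat set \<Rightarrow> (nat \<Rightarrow> 'u list \<times> 'u list) \<Rightarrow> (nat \<Rightarrow> 'u list) \<Rightarrow> (nat \<Rightarrow> 'u list) \<Rightarrow> 'u fm set"
  where
  "theory_of U Q R P Z =
     field_axioms_fm \<union> atomic_diagram U \<union>
     {power_sentence q (R q) | q. q \<in> Q} \<union>
     {irreducible_sentence (P i) | i. i > 0} \<union>
     {root_sentence (Z i) | i. i > 0}"

definition ring_char :: "('a, 'b) ring_scheme \<Rightarrow> nat" where
  "ring_char U = (if \<exists>n::nat. n > 0 \<and> [n] \<cdot>\<^bsub>U\<^esub> \<one>\<^bsub>U\<^esub> = \<zero>\<^bsub>U\<^esub>
                  then LEAST n::nat. n > 0 \<and> [n] \<cdot>\<^bsub>U\<^esub> \<one>\<^bsub>U\<^esub> = \<zero>\<^bsub>U\<^esub> else 0)"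

definition extension_of_degree ::
  "nat \<Rightarrow> ('u, 'm) ring_scheme \<Rightarrow> ('l, 'n) ring_scheme \<Rightarrow> ('u \<Rightarrow> 'l) \<Rightarrow> bool" where
  "extension_of_degree q U L h \<longleftrightarrow>
     field L \<and> h \<in> ring_hom U L \<and> ring.dimension L q (h ` carrier U) (carrier L)"

text \<open>An extension of degree \<open>q\<close> is in bijection with the lists of length \<open>q\<close> over \<open>U\<close>, so every
  such extension has an isomorphic copy among the fields on the type \<^typ>\<open>'u list\<close>.\<close>

definition irreducible_in_extensions :: "nat \<Rightarrow> 'u ring \<Rightarrow> 'u list \<Rightarrow> bool" where
  "irreducible_in_extensions q U p \<longleftrightarrow>
     (\<forall>(L :: 'u list ring) h. extension_of_degree q U L h
        \<longrightarrow> pirreducible\<^bsub>L\<^esub> (carrier L) (map h p))"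

definition transcendence_basis :: "('a, 'b) ring_scheme \<Rightarrow> 'a set \<Rightarrow> 'a set \<Rightarrow> bool" where
  "transcendence_basis G K B \<longleftrightarrow>
     B \<subseteq> carrier G \<and>
     (\<forall>b \<in> B. ring.transcendental G (generate_field G (K \<union> (B - {b}))) b) \<and>
     (\<forall>a \<in> carrier G. ring.algebraic G (generate_field G (K \<union> B)) a)"

text \<open>\<open>\<kappa>\<close> is a cardinal number, represented as in the library of cardinals by a well-order.\<close>

definition has_transcendence_degree :: "('a, 'b) ring_scheme \<Rightarrow> 'a set \<Rightarrow> 'k rel \<Rightarrow> bool" where
  "has_transcendence_degree G K \<kappa> \<longleftrightarrow> (\<exists>B. transcendence_basis G K B \<and> (card_of B, \<kappa>) \<in> ordIso)"

end

theory Submission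
  imports Defs "HOL-Algebra.Algebraic_Closure"
begin

text \<open>It suffices to find one infinite extension field \<open>F\<close> of \<open>U\<close>, of whatever transcendence degree, in
  which the sentences of the theory hold. Indeed, an ultrapower \<open>M\<close> of \<open>F\<close> satisfies the same sentences
  by Los's theorem, and it can be made as large as desired (\<open>ex_large_elementary_extension\<close>). A
  maximal algebraically independent set of \<open>M\<close> over the countable field \<open>U\<close> is then large as well; this
  rests on the exchange property (\<open>exchange\<close>) and on a count of the elements algebraic over a given
  subfield (\<open>ex_algebraically_independent_of_card\<close>). Choose an independent set \<open>B\<close> of cardinality
  \<open>\<kappa>\<close>, and let \<open>G\<close> be the relative algebraic closure of \<open>U(B)\<close> in \<open>M\<close>. A \<open>q\<close>-th root in \<open>M\<close> of an element of
  \<open>G\<close> is algebraic over \<open>G\<close>, hence in \<open>G\<close>; irreducibility of \<open>P\<^sub>i\<close> is a universal sentence and passes from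
  \<open>M\<close> to \<open>G\<close>; and \<open>Z\<^sub>i\<close> has a root in \<open>U\<close> already. So \<open>G\<close> is a model of transcendence degree \<open>\<kappa>\<close>, and
  it is small enough to be copied to the required type (\<open>model_of_transcendence_degree\<close>).

  If \<open>U\<close> is infinite, then \<open>F = U\<close> serves: the theory was made of sentences that hold in \<open>U\<close>.

  If \<open>U\<close> is finite, with \<open>u\<close> elements, let \<open>F\<close> be the union, inside an algebraic closure, of the fields of
  order \<open>u\<^sup>n\<close>, where \<open>n\<close> has all its prime factors in \<open>Q\<close>. It is infinite, and for \<open>q \<in> Q\<close> every element is
  a \<open>q\<close>-th power, since a \<open>q\<close>-th root that is missing from a finite field which contains the \<open>q\<close>-th roots
  of unity generates the extension of degree \<open>q\<close> (\<open>smooth_closure_ex_root\<close>). An irreducible polynomial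
  over \<open>U\<close> whose degree is a multiple of \<open>q\<close> factors over the extension of degree \<open>q\<close>. The hypothesis on
  \<open>P\<^sub>i\<close> thus implies that no \<open>q \<in> Q\<close> divides its degree, which is therefore coprime to the degrees of all
  the finite extensions of \<open>U\<close> in \<open>F\<close>, so that \<open>P\<^sub>i\<close> stays irreducible over \<open>F\<close>
  (\<open>pirreducible_smooth_closure\<close>).\<close>

section \<open>First-order structures and the field axioms\<close>

lemma val_closed:
  assumes "is_structure C G" "range e \<subseteq> carrier G" "set_trm t \<subseteq> C"
  shows "val G e t \<in> carrier G"
  using assms(3) assms(1,2) by (induction t) (auto simp: is_structure_def)

lemma val_cong: "\<forall>x \<in> trm_vars t. e x = e' x \<Longrightarrow> val G e t = val G e' t"
  by (induction t) auto

lemma sat_cong: "\<forall>x \<in> free_vars \<phi>. e x = e' x \<Longrightarrow> sat G e \<phi> = sat G e' \<phi>"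
proof (induction \<phi> arbitrary: e e')
  case (Eq s t)
  then show ?case using val_cong[of s e e' G] val_cong[of t e e' G] by auto
next
  case (Exists x \<phi>)
  have "sat G (e(x := a)) \<phi> = sat G (e'(x := a)) \<phi>" for a
    by (rule Exists.IH) (use Exists.prems in auto)
  then show ?case by simp
next
  case (And \<phi> \<psi>)
  then have "\<forall>x \<in> free_vars \<phi>. e x = e' x" "\<forall>x \<in> free_vars \<psi>. e x = e' x" by auto
  from And.IH(1)[OF this(1)] And.IH(2)[OF this(2)] show ?case by simp
qed auto

lemma sat_Forall [simp]: "sat G e (Forall x \<phi>) \<longleftrightarrow> (\<forall>a \<in> carrier G. sat G (e(x := a)) \<phi>)"
  by (simp add: Forall_def)

lemma sat_Or [simp]: "sat G e (Or \<phi> \<psi>) \<longleftrightarrow> sat G e \<phi> \<or> sat G e \<psi>"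
  by (simp add: Or_def)

lemma sat_Falsity [simp]: "\<not> sat G e Falsity"
  by (simp add: Falsity_def)

lemma sat_Conj [simp]: "sat G e (Conj \<phi>s) \<longleftrightarrow> (\<forall>\<phi> \<in> set \<phi>s. sat G e \<phi>)"
  by (induction \<phi>s) (auto simp: Conj_def)

lemma field_of_field_axioms:
  assumes S: "is_structure C G" and ax: "\<forall>\<phi> \<in> field_axioms_fm. true_in G \<phi>"
  shows "field G" and "\<And>a. a \<in> carrier G \<Longrightarrow> neg G a = \<ominus>\<^bsub>G\<^esub> a"
proof -
  define e where "e = (\<lambda>_::nat. \<zero>\<^bsub>G\<^esub>)"
  have "range e \<subseteq> carrier G" using S by (auto simp: is_structure_def e_def)
  then have "\<forall>\<phi> \<in> field_axioms_fm. sat G e \<phi>" using ax by (auto simp: true_in_def)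
  then have f: "\<forall>x\<in>carrier G. \<forall>y\<in>carrier G. \<forall>z\<in>carrier G. (x \<oplus>\<^bsub>G\<^esub> y) \<oplus>\<^bsub>G\<^esub> z = x \<oplus>\<^bsub>G\<^esub> (y \<oplus>\<^bsub>G\<^esub> z)"
    "\<forall>x\<in>carrier G. \<forall>y\<in>carrier G. x \<oplus>\<^bsub>G\<^esub> y = y \<oplus>\<^bsub>G\<^esub> x"
    "\<forall>x\<in>carrier G. x \<oplus>\<^bsub>G\<^esub> \<zero>\<^bsub>G\<^esub> = x"
    "\<forall>x\<in>carrier G. x \<oplus>\<^bsub>G\<^esub> neg G x = \<zero>\<^bsub>G\<^esub>"
    "\<forall>x\<in>carrier G. \<forall>y\<in>carrier G. \<forall>z\<in>carrier G. (x \<otimes>\<^bsub>G\<^esub> y) \<otimes>\<^bsub>G\<^esub> z = x \<otimes>\<^bsub>G\<^esub> (y \<otimes>\<^bsub>G\<^esub> z)"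
    "\<forall>x\<in>carrier G. \<forall>y\<in>carrier G. x \<otimes>\<^bsub>G\<^esub> y = y \<otimes>\<^bsub>G\<^esub> x"
    "\<forall>x\<in>carrier G. x \<otimes>\<^bsub>G\<^esub> \<one>\<^bsub>G\<^esub> = x"
    "\<forall>x\<in>carrier G. \<forall>y\<in>carrier G. \<forall>z\<in>carrier G. x \<otimes>\<^bsub>G\<^esub> (y \<oplus>\<^bsub>G\<^esub> z) = (x \<otimes>\<^bsub>G\<^esub> y) \<oplus>\<^bsub>G\<^esub> (x \<otimes>\<^bsub>G\<^esub> z)"
    "\<zero>\<^bsub>G\<^esub> \<noteq> \<one>\<^bsub>G\<^esub>"
    "\<forall>x\<in>carrier G. x = \<zero>\<^bsub>G\<^esub> \<or> (\<exists>y\<in>carrier G. x \<otimes>\<^bsub>G\<^esub> y = \<one>\<^bsub>G\<^esub>)"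
    by (simp_all add: field_axioms_fm_def Let_def)
  have c: "\<zero>\<^bsub>G\<^esub> \<in> carrier G" "\<one>\<^bsub>G\<^esub> \<in> carrier G" "\<And>a. a \<in> carrier G \<Longrightarrow> neg G a \<in> carrier G"
    "\<And>a b. a \<in> carrier G \<Longrightarrow> b \<in> carrier G \<Longrightarrow> a \<oplus>\<^bsub>G\<^esub> b \<in> carrier G"
    "\<And>a b. a \<in> carrier G \<Longrightarrow> b \<in> carrier G \<Longrightarrow> a \<otimes>\<^bsub>G\<^esub> b \<in> carrier G"
    using S by (auto simp: is_structure_def)
  have "cring G"
  proof (rule cringI)
    show "abelian_group G"
    proof (rule abelian_groupI)
      fix x assume x: "x \<in> carrier G"
      show "\<exists>y\<in>carrier G. y \<oplus>\<^bsub>G\<^esub> x = \<zero>\<^bsub>G\<^esub>"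
        using f(2,4) c(3) x by metis
      show "\<zero>\<^bsub>G\<^esub> \<oplus>\<^bsub>G\<^esub> x = x" using f(2,3) c(1) x by metis
    qed (use f c in auto)
    show "comm_monoid G"
    proof (rule comm_monoidI)
      fix x assume x: "x \<in> carrier G"
      show "\<one>\<^bsub>G\<^esub> \<otimes>\<^bsub>G\<^esub> x = x" using f(6,7) c(2) x by metis
    next
      fix x y assume "x \<in> carrier G" "y \<in> carrier G"
      then show "x \<otimes>\<^bsub>G\<^esub> y = y \<otimes>\<^bsub>G\<^esub> x" using f(6) by blast
    qed (use f c in auto)
    show "(x \<oplus>\<^bsub>G\<^esub> y) \<otimes>\<^bsub>G\<^esub> z = x \<otimes>\<^bsub>G\<^esub> z \<oplus>\<^bsub>G\<^esub> y \<otimes>\<^bsub>G\<^esub> z"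
      if "x \<in> carrier G" "y \<in> carrier G" "z \<in> carrier G" for x y z
      using that f(6,8) c by metis
  qed
  then interpret cring G .
  show "field G"
  proof (rule cring_fieldI2)
    show "\<zero>\<^bsub>G\<^esub> \<noteq> \<one>\<^bsub>G\<^esub>" by (rule f(9))
    show "\<exists>b\<in>carrier G. a \<otimes>\<^bsub>G\<^esub> b = \<one>\<^bsub>G\<^esub>" if "a \<in> carrier G" "a \<noteq> \<zero>\<^bsub>G\<^esub>" for a
      using f(10) that by blast
  qed
  show "neg G a = \<ominus>\<^bsub>G\<^esub> a" if "a \<in> carrier G" for a
    using f(4) c(3) that by (metis add.inv_equality a_comm)
qed

text \<open>\<open>F\<close> is the ring underlying the structure \<open>G\<close>. The record type of \<open>F\<close> is left open, so that
  facts about a field given as a plain ring record, as well as about \<open>G\<close> itself, apply.\<close>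

definition underlying_ring :: "('c, 'a) ring_structure \<Rightarrow> ('a, 'm) ring_scheme \<Rightarrow> bool" where
  "underlying_ring G F \<longleftrightarrow> carrier G = carrier F \<and> zero G = zero F \<and> one G = one F \<and>
     add G = add F \<and> mult G = mult F"

lemma field_axioms_of_field:
  assumes "field F" and G: "underlying_ring G F"
    and neg: "\<And>a. a \<in> carrier F \<Longrightarrow> neg G a = \<ominus>\<^bsub>F\<^esub> a" and \<phi>: "\<phi> \<in> field_axioms_fm"
  shows "true_in G \<phi>"
proof -
  interpret F: field F by fact
  have 1: "\<forall>x\<in>carrier F. x = \<zero>\<^bsub>F\<^esub> \<or> (\<exists>y\<in>carrier F. x \<otimes>\<^bsub>F\<^esub> y = \<one>\<^bsub>F\<^esub>)"
    using F.field_Units F.Units_r_inv_ex by (metis (no_types) DiffI singletonD)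
  show ?thesis
    using \<phi> 1 neg G
    by (auto simp: field_axioms_fm_def Let_def true_in_def underlying_ring_def
          F.a_assoc F.m_assoc F.r_distr F.r_neg intro: F.a_comm F.m_comm)
qed

text \<open>Injective maps between structures that respect the operations and the constants of \<open>C\<close>.\<close>

definition structure_embedding ::
  "'c set \<Rightarrow> ('c, 'a) ring_structure \<Rightarrow> ('c, 'b) ring_structure \<Rightarrow> ('a \<Rightarrow> 'b) \<Rightarrow> bool" where
  "structure_embedding C G M h \<longleftrightarrow>
     inj_on h (carrier G) \<and> h ` carrier G \<subseteq> carrier M \<and>
     h \<zero>\<^bsub>G\<^esub> = \<zero>\<^bsub>M\<^esub> \<and> h \<one>\<^bsub>G\<^esub> = \<one>\<^bsub>M\<^esub> \<and>
     (\<forall>a \<in> carrier G. h (neg G a) = neg M (h a)) \<and>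
     (\<forall>a \<in> carrier G. \<forall>b \<in> carrier G.
        h (a \<oplus>\<^bsub>G\<^esub> b) = h a \<oplus>\<^bsub>M\<^esub> h b \<and> h (a \<otimes>\<^bsub>G\<^esub> b) = h a \<otimes>\<^bsub>M\<^esub> h b) \<and>
     (\<forall>c \<in> C. h (cst G c) = cst M c)"

text \<open>Formulas without quantifiers. Their truth is preserved by embeddings in both directions.\<close>

primrec quantifier_free :: "'c fm \<Rightarrow> bool" where
  "quantifier_free (Eq s t) \<longleftrightarrow> True"
| "quantifier_free (Neg \<phi>) \<longleftrightarrow> quantifier_free \<phi>"
| "quantifier_free (And \<phi> \<psi>) \<longleftrightarrow> quantifier_free \<phi> \<and> quantifier_free \<psi>"
| "quantifier_free (Exists x \<phi>) \<longleftrightarrow> False"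

lemma val_embedding:
  assumes "structure_embedding C G M h" "is_structure C G" "range e \<subseteq> carrier G" "set_trm t \<subseteq> C"
  shows "val M (h \<circ> e) t = h (val G e t)"
  using assms(4)
proof (induction t)
  case (Minus t)
  then show ?case using val_closed[OF assms(2,3), of t] assms(1) by (auto simp: structure_embedding_def)
next
  case (Add s t)
  then show ?case using val_closed[OF assms(2,3), of t] val_closed[OF assms(2,3), of s] assms(1)
    by (auto simp: structure_embedding_def)
next
  case (Mul s t)
  then show ?case using val_closed[OF assms(2,3), of t] val_closed[OF assms(2,3), of s] assms(1)
    by (auto simp: structure_embedding_def)
qed (use assms(1) in \<open>auto simp: structure_embedding_def\<close>)

lemma sat_embedding:
  assumes "structure_embedding C G M h" "is_structure C G" "range e \<subseteq> carrier G"
    and "quantifier_free \<phi>" "set_fm \<phi> \<subseteq> C"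
  shows "sat M (h \<circ> e) \<phi> \<longleftrightarrow> sat G e \<phi>"
  using assms(4,5)
proof (induction \<phi>)
  case (Eq s t)
  have "inj_on h (carrier G)" using assms(1) by (simp add: structure_embedding_def)
  moreover have "set_trm s \<subseteq> C" "set_trm t \<subseteq> C" using Eq by auto
  ultimately show ?case
    unfolding sat.simps val_embedding[OF assms(1-3) \<open>set_trm s \<subseteq> C\<close>] val_embedding[OF assms(1-3) \<open>set_trm t \<subseteq> C\<close>]
    using val_closed[OF assms(2,3)] by (simp add: inj_on_eq_iff)
qed auto

lemma true_in_embedding_closed:
  assumes "structure_embedding C G M h" "is_structure C G"
    and "quantifier_free \<phi>" "set_fm \<phi> \<subseteq> C" "free_vars \<phi> = {}"
  shows "true_in M \<phi> \<longleftrightarrow> true_in G \<phi>"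
proof -
  define e where "e = (\<lambda>_::nat. \<zero>\<^bsub>G\<^esub>)"
  have e: "range e \<subseteq> carrier G" using assms(2) by (auto simp: is_structure_def e_def)
  have he: "range (h \<circ> e) \<subseteq> carrier M" using e assms(1) by (auto simp: structure_embedding_def)
  have "true_in M \<phi> \<longleftrightarrow> sat M (h \<circ> e) \<phi>"
    using he sat_cong[of \<phi> _ "h \<circ> e" M] assms(5) unfolding true_in_def by blast
  also have "\<dots> \<longleftrightarrow> sat G e \<phi>" by (rule sat_embedding[OF assms(1,2) e assms(3,4)])
  also have "\<dots> \<longleftrightarrow> true_in G \<phi>"
    using e sat_cong[of \<phi> _ e G] assms(5) unfolding true_in_def by blast
  finally show ?thesis .
qed

section \<open>Ultrapowers\<close>

text \<open>An ultrafilter on the index type, given as the family of its sets.\<close>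

definition ultrafilter :: "'i set set \<Rightarrow> bool" where
  "ultrafilter D \<longleftrightarrow> {} \<notin> D \<and> (\<forall>A \<in> D. \<forall>B \<in> D. A \<inter> B \<in> D) \<and>
     (\<forall>A \<in> D. \<forall>B. A \<subseteq> B \<longrightarrow> B \<in> D) \<and> (\<forall>A. A \<in> D \<or> - A \<in> D)"

text \<open>By Zorn's lemma, a family with the finite intersection property is contained in a maximal one,
  and a maximal one is an ultrafilter.\<close>

lemma ex_ultrafilter:
  assumes fip: "\<And>\<F>. finite \<F> \<Longrightarrow> \<F> \<subseteq> S \<Longrightarrow> \<Inter>\<F> \<noteq> {}"
  obtains D where "ultrafilter D" "S \<subseteq> D"
proof -
  define \<A> where "\<A> = {D. S \<subseteq> D \<and> (\<forall>\<F>. finite \<F> \<longrightarrow> \<F> \<subseteq> D \<longrightarrow> \<Inter>\<F> \<noteq> {})}"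
  have "\<exists>D\<in>\<A>. \<forall>E\<in>\<A>. D \<subseteq> E \<longrightarrow> E = D"
  proof (rule subset_Zorn_nonempty)
    show "\<A> \<noteq> {}" using fip unfolding \<A>_def by blast
    fix \<C> assume \<C>: "\<C> \<noteq> {}" "subset.chain \<A> \<C>"
    have "\<Inter>\<F> \<noteq> {}" if \<F>: "finite \<F>" "\<F> \<subseteq> \<Union>\<C>" for \<F>
    proof -
      obtain D where "D \<in> \<C>" "\<F> \<subseteq> D"
        using finite_subset_Union_chain[OF \<F> \<C>] by blast
      then show ?thesis using \<C>(2) \<F>(1) unfolding subset.chain_def \<A>_def by blast
    qed
    then show "\<Union>\<C> \<in> \<A>" using \<C> unfolding subset.chain_def \<A>_def by blast
  qed
  then obtain D where D: "D \<in> \<A>" and max: "\<And>E. E \<in> \<A> \<Longrightarrow> D \<subseteq> E \<Longrightarrow> E = D" by blast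
  have SD: "S \<subseteq> D" and fipD: "\<And>\<F>. finite \<F> \<Longrightarrow> \<F> \<subseteq> D \<Longrightarrow> \<Inter>\<F> \<noteq> {}"
    using D unfolding \<A>_def by auto
  have mem: "A \<in> D" if A: "\<And>\<F>. finite \<F> \<Longrightarrow> \<F> \<subseteq> D \<Longrightarrow> A \<inter> \<Inter>\<F> \<noteq> {}" for A
  proof -
    have "\<Inter>\<F> \<noteq> {}" if \<F>: "finite \<F>" "\<F> \<subseteq> insert A D" for \<F>
    proof -
      have "finite (\<F> - {A})" "\<F> - {A} \<subseteq> D" using \<F> by auto
      from A[OF this] show ?thesis by blast
    qed
    then have "insert A D \<in> \<A>" using SD unfolding \<A>_def by blast
    then show ?thesis using max by blast
  qed
  have "ultrafilter D"
    unfolding ultrafilter_def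
  proof (intro conjI ballI allI impI)
    show "{} \<notin> D" using fipD[of "{{}}"] by auto
    show "A \<inter> B \<in> D" if "A \<in> D" "B \<in> D" for A B
    proof (rule mem)
      fix \<F> assume "finite \<F>" "\<F> \<subseteq> D"
      then show "A \<inter> B \<inter> \<Inter>\<F> \<noteq> {}" using fipD[of "insert A (insert B \<F>)"] that by (auto simp: Int_assoc)
    qed
    show "B \<in> D" if "A \<in> D" "A \<subseteq> B" for A B
    proof (rule mem)
      fix \<F> assume "finite \<F>" "\<F> \<subseteq> D"
      then have "\<Inter>(insert A \<F>) \<noteq> {}" using that by (intro fipD) auto
      then show "B \<inter> \<Inter>\<F> \<noteq> {}" using that by auto
    qed
    show "A \<in> D \<or> - A \<in> D" for A
    proof (rule ccontr)
      assume "\<not> (A \<in> D \<or> - A \<in> D)"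
      then obtain \<F> \<G> where "finite \<F>" "\<F> \<subseteq> D" "A \<inter> \<Inter>\<F> = {}" "finite \<G>" "\<G> \<subseteq> D" "- A \<inter> \<Inter>\<G> = {}"
        using mem[of A] mem[of "- A"] by blast
      moreover have "\<Inter>(\<F> \<union> \<G>) = \<Inter>\<F> \<inter> \<Inter>\<G>" by (rule Inf_union_distrib)
      ultimately have "finite (\<F> \<union> \<G>)" "\<F> \<union> \<G> \<subseteq> D" "\<Inter>(\<F> \<union> \<G>) = {}" by auto
      then show False using fipD by blast
    qed
  qed
  then show ?thesis using SD that by blast
qed

text \<open>An element of the ultrapower is represented by a chosen member of its class of functions
  that agree on a set of the ultrafilter.\<close>

definition class_rep :: "'i set set \<Rightarrow> 'b set \<Rightarrow> ('i \<Rightarrow> 'b) \<Rightarrow> 'i \<Rightarrow> 'b" where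
  "class_rep D A f = (SOME g. range g \<subseteq> A \<and> {i. f i = g i} \<in> D)"

text \<open>The ultrapower of \<open>K\<close>: the operations are computed index by index, followed by the choice
  of the representative of the class. Equality in the structure is thus equality of functions.\<close>

definition ultrapower :: "'i set set \<Rightarrow> ('c, 'b) ring_structure \<Rightarrow> ('c, 'i \<Rightarrow> 'b) ring_structure" where
  "ultrapower D K = (let r = class_rep D (carrier K) in
     \<lparr> carrier = r ` {f. range f \<subseteq> carrier K},
       mult = (\<lambda>f g. r (\<lambda>i. f i \<otimes>\<^bsub>K\<^esub> g i)), one = r (\<lambda>_. \<one>\<^bsub>K\<^esub>),
       zero = r (\<lambda>_. \<zero>\<^bsub>K\<^esub>), add = (\<lambda>f g. r (\<lambda>i. f i \<oplus>\<^bsub>K\<^esub> g i)),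
       neg = (\<lambda>f. r (\<lambda>i. neg K (f i))), cst = (\<lambda>c. r (\<lambda>_. cst K c)) \<rparr>)"

context
  fixes D :: "'i set set" and K :: "('c, 'b) ring_structure"
  assumes D: "ultrafilter D" and K: "is_structure UNIV K"
begin

lemma ultrafilter_UNIV: "UNIV \<in> D"
  using D unfolding ultrafilter_def by (metis Compl_UNIV_eq)

lemma ultrafilter_mono2: "A \<in> D \<Longrightarrow> B \<in> D \<Longrightarrow> A \<inter> B \<subseteq> E \<Longrightarrow> E \<in> D"
  using D unfolding ultrafilter_def by meson

lemma class_rep_props:
  assumes "range f \<subseteq> carrier K"
  shows "range (class_rep D (carrier K) f) \<subseteq> carrier K" "{i. f i = class_rep D (carrier K) f i} \<in> D"
  using someI_ex[of "\<lambda>g. range g \<subseteq> carrier K \<and> {i. f i = g i} \<in> D"] ultrafilter_UNIV assms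
  unfolding class_rep_def by (metis (mono_tags, lifting) Collect_cong UNIV_def)+

lemma class_rep_eq_iff:
  assumes "range f \<subseteq> carrier K" "range g \<subseteq> carrier K"
  shows "class_rep D (carrier K) f = class_rep D (carrier K) g \<longleftrightarrow> {i. f i = g i} \<in> D"
proof
  assume "class_rep D (carrier K) f = class_rep D (carrier K) g"
  then show "{i. f i = g i} \<in> D"
    using class_rep_props(2)[OF assms(1)] class_rep_props(2)[OF assms(2)]
    by (intro ultrafilter_mono2[OF class_rep_props(2)[OF assms(1)] class_rep_props(2)[OF assms(2)]]) auto
next
  assume fg: "{i. f i = g i} \<in> D"
  have "{i. f i = h i} \<in> D \<longleftrightarrow> {i. g i = h i} \<in> D" for h
  proof
    assume "{i. f i = h i} \<in> D"
    then show "{i. g i = h i} \<in> D" by (rule ultrafilter_mono2[OF fg]) auto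
  next
    assume "{i. g i = h i} \<in> D"
    then show "{i. f i = h i} \<in> D" by (rule ultrafilter_mono2[OF fg]) auto
  qed
  then show "class_rep D (carrier K) f = class_rep D (carrier K) g" unfolding class_rep_def by simp
qed

lemma ultrapower_range: "f \<in> carrier (ultrapower D K) \<Longrightarrow> range f \<subseteq> carrier K"
  using class_rep_props(1) by (auto simp: ultrapower_def Let_def)

lemma ultrapower_carrierI: "range f \<subseteq> carrier K \<Longrightarrow> class_rep D (carrier K) f \<in> carrier (ultrapower D K)"
  by (auto simp: ultrapower_def Let_def)

lemma class_rep_ultrapower: "f \<in> carrier (ultrapower D K) \<Longrightarrow> class_rep D (carrier K) f = f"
proof -
  assume "f \<in> carrier (ultrapower D K)"
  then obtain g where g: "range g \<subseteq> carrier K" "f = class_rep D (carrier K) g"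
    by (auto simp: ultrapower_def Let_def)
  then show ?thesis
    using class_rep_eq_iff[OF g(1), of f] class_rep_props[OF g(1)] by simp
qed

lemma is_structure_ultrapower: "is_structure UNIV (ultrapower D K)"
proof -
  have "range (\<lambda>i. f i \<oplus>\<^bsub>K\<^esub> g i) \<subseteq> carrier K \<and> range (\<lambda>i. f i \<otimes>\<^bsub>K\<^esub> g i) \<subseteq> carrier K \<and> range (\<lambda>i. neg K (f i)) \<subseteq> carrier K"
    if "f \<in> carrier (ultrapower D K)" "g \<in> carrier (ultrapower D K)" for f g
    using ultrapower_range[OF that(1)] ultrapower_range[OF that(2)] K
    by (auto simp: is_structure_def image_subset_iff)
  moreover have "range (\<lambda>i::'i. \<zero>\<^bsub>K\<^esub>) \<subseteq> carrier K" "range (\<lambda>i::'i. \<one>\<^bsub>K\<^esub>) \<subseteq> carrier K" "range (\<lambda>i::'i. cst K c) \<subseteq> carrier K" for c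
    using K by (auto simp: is_structure_def)
  ultimately show ?thesis
    using ultrapower_carrierI unfolding is_structure_def
    by (auto simp: ultrapower_def Let_def)
qed

lemma val_ultrapower:
  assumes "range e \<subseteq> carrier (ultrapower D K)"
  shows "val (ultrapower D K) e t = class_rep D (carrier K) (\<lambda>i. val K (\<lambda>n. e n i) t)"
proof -
  have e: "range (\<lambda>n. e n i) \<subseteq> carrier K" for i
    using assms ultrapower_range by blast
  have v: "val K (\<lambda>n. e n i) t \<in> carrier K" for i t
    by (rule val_closed[OF K e]) auto
  then have rv: "range (\<lambda>i. val K (\<lambda>n. e n i) t) \<subseteq> carrier K" for t by auto
  note P = class_rep_props[OF rv]
  have st: "is_structure UNIV K" by (rule K)
  show ?thesis
  proof (induction t)
    case (Var n)
    have "e n \<in> carrier (ultrapower D K)" using assms by auto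
    then show ?case using class_rep_ultrapower[of "e n"] by simp
  next
    case (Minus t)
    have "class_rep D (carrier K) (\<lambda>i. neg K (class_rep D (carrier K) (\<lambda>i. val K (\<lambda>n. e n i) t) i))
      = class_rep D (carrier K) (\<lambda>i. neg K (val K (\<lambda>n. e n i) t))"
    proof (subst class_rep_eq_iff)
      show "{i. neg K (class_rep D (carrier K) (\<lambda>i. val K (\<lambda>n. e n i) t) i) = neg K (val K (\<lambda>n. e n i) t)} \<in> D"
        by (rule ultrafilter_mono2[OF P(2)[of t] P(2)[of t]]) auto
    qed (use P(1)[of t] v[of _ t] st in \<open>auto simp: is_structure_def image_subset_iff\<close>)
    then show ?case using Minus by (simp add: ultrapower_def Let_def)
  next
    case (Add s t)
    have "class_rep D (carrier K) (\<lambda>i. class_rep D (carrier K) (\<lambda>i. val K (\<lambda>n. e n i) s) i \<oplus>\<^bsub>K\<^esub> class_rep D (carrier K) (\<lambda>i. val K (\<lambda>n. e n i) t) i)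
      = class_rep D (carrier K) (\<lambda>i. val K (\<lambda>n. e n i) s \<oplus>\<^bsub>K\<^esub> val K (\<lambda>n. e n i) t)" (is "class_rep D _ ?f = class_rep D _ ?g")
    proof (subst class_rep_eq_iff)
      show "{i. ?f i = ?g i} \<in> D"
        by (rule ultrafilter_mono2[OF P(2)[of s] P(2)[of t]]) auto
    qed (use P(1)[of t] v[of _ t] P(1)[of s] v[of _ s] st in \<open>auto simp: is_structure_def image_subset_iff\<close>)
    then show ?case using Add by (simp add: ultrapower_def Let_def)
  next
    case (Mul s t)
    have "class_rep D (carrier K) (\<lambda>i. class_rep D (carrier K) (\<lambda>i. val K (\<lambda>n. e n i) s) i \<otimes>\<^bsub>K\<^esub> class_rep D (carrier K) (\<lambda>i. val K (\<lambda>n. e n i) t) i)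
      = class_rep D (carrier K) (\<lambda>i. val K (\<lambda>n. e n i) s \<otimes>\<^bsub>K\<^esub> val K (\<lambda>n. e n i) t)" (is "class_rep D _ ?f = class_rep D _ ?g")
    proof (subst class_rep_eq_iff)
      show "{i. ?f i = ?g i} \<in> D"
        by (rule ultrafilter_mono2[OF P(2)[of s] P(2)[of t]]) auto
    qed (use P(1)[of t] v[of _ t] P(1)[of s] v[of _ s] st in \<open>auto simp: is_structure_def image_subset_iff\<close>)
    then show ?case using Mul by (simp add: ultrapower_def Let_def)
  qed (simp_all add: ultrapower_def Let_def)
qed

text \<open>Los's theorem. The induction uses that an ultrafilter decides every set at negations, and a choice
  of witnesses, index by index, at quantifiers.\<close>

theorem sat_ultrapower:
  assumes "range e \<subseteq> carrier (ultrapower D K)"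
  shows "sat (ultrapower D K) e \<phi> \<longleftrightarrow> {i. sat K (\<lambda>n. e n i) \<phi>} \<in> D"
  using assms
proof (induction \<phi> arbitrary: e)
  case (Eq s t)
  have e: "range (\<lambda>n. e n i) \<subseteq> carrier K" for i
    using Eq ultrapower_range by blast
  have "range (\<lambda>i. val K (\<lambda>n. e n i) t) \<subseteq> carrier K" for t
    using val_closed[OF K e] by auto
  then show ?case using val_ultrapower[OF Eq] class_rep_eq_iff by simp
next
  case (Neg \<phi>)
  have "{i. sat K (\<lambda>n. e n i) \<phi>} \<notin> D \<longleftrightarrow> - {i. sat K (\<lambda>n. e n i) \<phi>} \<in> D"
    using D unfolding ultrafilter_def by (metis Compl_disjoint)
  then show ?case using Neg by (simp add: Collect_neg_eq)
next
  case (And \<phi> \<psi>)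
  have "A \<in> D \<and> B \<in> D \<longleftrightarrow> A \<inter> B \<in> D" for A B
    using D unfolding ultrafilter_def by (meson inf_le1 inf_le2)
  then show ?case using And by (simp add: Collect_conj_eq)
next
  case (Exists x \<phi>)
  have upd: "(\<lambda>n. (e(x := a)) n i) = (\<lambda>n. e n i)(x := a i)" for a i by auto
  have IH: "sat (ultrapower D K) (e(x := a)) \<phi> \<longleftrightarrow> {i. sat K ((\<lambda>n. e n i)(x := a i)) \<phi>} \<in> D"
    if "a \<in> carrier (ultrapower D K)" for a
  proof -
    have "range (e(x := a)) \<subseteq> carrier (ultrapower D K)" using that Exists.prems by auto
    from Exists.IH[OF this] show ?thesis unfolding upd .
  qed
  show ?case
  proof
    assume "sat (ultrapower D K) e (Exists x \<phi>)"
    then obtain a where a: "a \<in> carrier (ultrapower D K)" "{i. sat K ((\<lambda>n. e n i)(x := a i)) \<phi>} \<in> D"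
      using IH by auto
    show "{i. sat K (\<lambda>n. e n i) (Exists x \<phi>)} \<in> D"
      by (rule ultrafilter_mono2[OF a(2) a(2)]) (use ultrapower_range[OF a(1)] in auto)
  next
    assume E: "{i. sat K (\<lambda>n. e n i) (Exists x \<phi>)} \<in> D"
    define b where "b i = (if \<exists>a \<in> carrier K. sat K ((\<lambda>n. e n i)(x := a)) \<phi>
       then SOME a. a \<in> carrier K \<and> sat K ((\<lambda>n. e n i)(x := a)) \<phi> else \<zero>\<^bsub>K\<^esub>)" for i
    have b: "b i \<in> carrier K \<and> sat K ((\<lambda>n. e n i)(x := b i)) \<phi>" if "\<exists>a \<in> carrier K. sat K ((\<lambda>n. e n i)(x := a)) \<phi>" for i
      using someI_ex[of "\<lambda>a. a \<in> carrier K \<and> sat K ((\<lambda>n. e n i)(x := a)) \<phi>"] that unfolding b_def by auto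
    have rb: "range b \<subseteq> carrier K"
      using b K unfolding b_def is_structure_def by (auto simp: image_subset_iff)
    let ?a = "class_rep D (carrier K) b"
    have "{i. sat K ((\<lambda>n. e n i)(x := ?a i)) \<phi>} \<in> D"
    proof (rule ultrafilter_mono2[OF E class_rep_props(2)[OF rb]], safe)
      fix i assume "sat K (\<lambda>n. e n i) (Exists x \<phi>)" "b i = ?a i"
      then show "sat K ((\<lambda>n. e n i)(x := ?a i)) \<phi>" using b[of i] by simp
    qed
    then show "sat (ultrapower D K) e (Exists x \<phi>)"
      using IH[OF ultrapower_carrierI[OF rb]] ultrapower_carrierI[OF rb] by auto
  qed
qed

corollary true_in_ultrapower:
  assumes "true_in K \<phi>"
  shows "true_in (ultrapower D K) \<phi>"
  unfolding true_in_def
proof (intro allI impI)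
  fix e :: "nat \<Rightarrow> 'i \<Rightarrow> 'b" assume e: "range e \<subseteq> carrier (ultrapower D K)"
  have "range (\<lambda>n. e n i) \<subseteq> carrier K" for i using e ultrapower_range by blast
  then have "{i. sat K (\<lambda>n. e n i) \<phi>} = UNIV" using assms unfolding true_in_def by auto
  then show "sat (ultrapower D K) e \<phi>" using sat_ultrapower[OF e] ultrafilter_UNIV by simp
qed

end

text \<open>For infinite \<open>K\<close>, take as index set the finite subsets of \<open>'x\<close> and for each of them a
  function that is injective on it; evaluation at the elements of \<open>'x\<close> gives distinct members
  of the ultrapower.\<close>

lemma ex_large_elementary_extension:
  fixes K :: "('c, 'b) ring_structure"
  assumes K: "is_structure UNIV K" and inf: "infinite (carrier K)"
  shows "\<exists>(M :: ('c, 'x set \<Rightarrow> 'b) ring_structure) (f :: 'x \<Rightarrow> 'x set \<Rightarrow> 'b). is_structure UNIV M \<and>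
    (\<forall>\<phi>. true_in K \<phi> \<longrightarrow> true_in M \<phi>) \<and> inj f \<and> range f \<subseteq> carrier M"
proof -
  define S where "S = {{i :: 'x set. finite i \<and> x \<in> i} | x. True}"
  have fip: "\<Inter>\<F> \<noteq> {}" if \<F>: "finite \<F>" "\<F> \<subseteq> S" for \<F>
  proof -
    have "\<forall>A \<in> \<F>. \<exists>x. A = {i. finite i \<and> x \<in> i}" using \<F> unfolding S_def by auto
    then obtain g where g: "\<And>A. A \<in> \<F> \<Longrightarrow> A = {i. finite i \<and> g A \<in> i}" by metis
    have "g ` \<F> \<in> A" if "A \<in> \<F>" for A
      using g[OF that] \<F> that by auto
    then show ?thesis by blast
  qed
  then obtain D where D: "ultrafilter D" "S \<subseteq> D" using ex_ultrafilter[of S] by blast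
  have "\<exists>h :: 'x \<Rightarrow> 'b. range h \<subseteq> carrier K \<and> (finite i \<longrightarrow> inj_on h i)" for i
  proof (cases "finite i")
    case True
    obtain B where B: "B \<subseteq> carrier K" "finite B" "card B = card i"
      using infinite_arbitrarily_large[OF inf] by metis
    then obtain h where h: "bij_betw h i B" using True finite_same_card_bij by metis
    obtain k where k: "k \<in> carrier K" using inf by (metis ex_in_conv finite.emptyI)
    show ?thesis
      by (rule exI[of _ "\<lambda>x. if x \<in> i then h x else k"])
        (use h k B in \<open>auto simp: bij_betw_def inj_on_def\<close>)
  next
    case False
    obtain k where k: "k \<in> carrier K" using inf by (metis ex_in_conv finite.emptyI)
    show ?thesis by (rule exI[of _ "\<lambda>_. k"]) (use k False in auto)
  qed
  then obtain h where h: "\<And>i. range (h i :: 'x \<Rightarrow> 'b) \<subseteq> carrier K" "\<And>i. finite i \<Longrightarrow> inj_on (h i) i" by metis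
  define f where "f x = class_rep D (carrier K) (\<lambda>i. h i x)" for x
  have r: "range (\<lambda>i. h i x) \<subseteq> carrier K" for x using h(1) by blast
  have "inj f"
  proof (rule injI, rule ccontr)
    fix x y assume f: "f x = f y" and "x \<noteq> y"
    have 1: "{i. h i x = h i y} \<in> D" using f class_rep_eq_iff[OF D(1) K r r] unfolding f_def by simp
    have 2: "{i. finite i \<and> x \<in> i} \<in> D" "{i. finite i \<and> y \<in> i} \<in> D" using D(2) unfolding S_def by auto
    have 3: "{i. finite i \<and> x \<in> i \<and> y \<in> i} \<in> D"
      by (rule ultrafilter_mono2[OF D(1) K 2]) auto
    have "{} \<in> D"
      by (rule ultrafilter_mono2[OF D(1) K 1 3]) (use h(2) \<open>x \<noteq> y\<close> in \<open>auto dest: inj_onD\<close>)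
    then show False using D(1) unfolding ultrafilter_def by simp
  qed
  moreover have "range f \<subseteq> carrier (ultrapower D K)"
    using ultrapower_carrierI[OF D(1) K r] unfolding f_def by blast
  ultimately show ?thesis
    using is_structure_ultrapower[OF D(1) K] true_in_ultrapower[OF D(1) K] by blast
qed

section \<open>Meaning of the sentences\<close>

lemma val_Pow:
  assumes "underlying_ring G F"
  shows "val G e (Pow t n) = val G e t [^]\<^bsub>F\<^esub> n"
  using assms by (induction n) (auto simp: underlying_ring_def nat_pow_def)

lemma val_poly_trm:
  assumes "underlying_ring G F" "ring F"
  shows "val G e (poly_trm p t) = ring.eval F (map (cst G) p) (val G e t)"
proof -
  interpret F: ring F by fact
  have "zero G = zero F" "add G = add F" "mult G = mult F"
    using assms(1) by (simp_all add: underlying_ring_def)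
  then show ?thesis by (induction p) (simp_all add: val_Pow[OF assms(1)])
qed

lemma sat_power_sentence:
  assumes "underlying_ring G F" "ring F"
  shows "sat G e (power_sentence q r) \<longleftrightarrow>
    (\<forall>x \<in> carrier F. ring.eval F (map (cst G) (snd r)) x = \<zero>\<^bsub>F\<^esub> \<or>
       (\<exists>y \<in> carrier F. y [^]\<^bsub>F\<^esub> q \<otimes>\<^bsub>F\<^esub> ring.eval F (map (cst G) (snd r)) x = ring.eval F (map (cst G) (fst r)) x))"
proof -
  have "zero G = zero F" "mult G = mult F" "carrier G = carrier F"
    using assms(1) by (simp_all add: underlying_ring_def)
  then show ?thesis
    by (cases r) (simp add: power_sentence_def val_poly_trm[OF assms] val_Pow[OF assms(1)])
qed

lemma sat_Exs_imp:
  assumes "sat G e (Exs xs \<phi>)"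
  shows "\<exists>e'. (\<forall>x \<in> set xs. e' x \<in> carrier G) \<and> sat G e' \<phi>"
proof -
  have "\<exists>e'. (\<forall>x. x \<notin> set xs \<longrightarrow> e' x = e x) \<and> (\<forall>x \<in> set xs. e' x \<in> carrier G) \<and> sat G e' \<phi>"
    using assms
  proof (induction xs arbitrary: e)
    case (Cons x xs)
    then obtain a where a: "a \<in> carrier G" "sat G (e(x := a)) (Exs xs \<phi>)" by (auto simp: Exs_def)
    from Cons.IH[OF a(2)] obtain e' where "\<forall>y. y \<notin> set xs \<longrightarrow> e' y = (e(x := a)) y"
      "\<forall>x \<in> set xs. e' x \<in> carrier G" "sat G e' \<phi>" by blast
    then show ?case using a(1) by (intro exI[of _ e']) (metis fun_upd_apply set_ConsD list.set_intros(2) insert_iff list.simps(15))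
  qed (auto simp: Exs_def)
  then show ?thesis by blast
qed

text \<open>The term has the shape of the sum in \<open>product_coeff\<close>, a list comprehension with two filters.\<close>

lemma val_Sum_filter:
  assumes "underlying_ring G F" "ring F" "\<And>i. i < m \<Longrightarrow> P i \<Longrightarrow> Q i \<Longrightarrow> val G e (t i) \<in> carrier F"
  shows "val G e (Sum [t i. i \<leftarrow> [0..<m], P i, Q i]) =
    finsum F (\<lambda>i. if P i \<and> Q i then val G e (t i) else \<zero>\<^bsub>F\<^esub>) {..<m}"
proof -
  interpret F: ring F by fact
  have G: "zero G = zero F" "add G = add F" "carrier G = carrier F"
    using assms(1) by (simp_all add: underlying_ring_def)
  have app: "val G e (Sum (xs @ ys)) = val G e (Sum xs) \<oplus>\<^bsub>F\<^esub> val G e (Sum ys)"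
    "val G e (Sum xs) \<in> carrier F"
    if "\<forall>t \<in> set xs \<union> set ys. val G e t \<in> carrier F" for xs ys
  proof -
    have c: "val G e (Sum zs) \<in> carrier F" if "\<forall>t \<in> set zs. val G e t \<in> carrier F" for zs
      using that by (induction zs) (auto simp: Sum_def G)
    show "val G e (Sum xs) \<in> carrier F" by (rule c) (use that in auto)
    show "val G e (Sum (xs @ ys)) = val G e (Sum xs) \<oplus>\<^bsub>F\<^esub> val G e (Sum ys)"
      using that
    proof (induction xs)
      case Nil
      then show ?case using c[of ys] by (simp add: Sum_def G)
    next
      case (Cons x xs)
      then show ?case using c[of ys] c[of xs] by (simp add: Sum_def G F.a_assoc)
    qed
  qed
  show ?thesis
    using assms(3)
  proof (induction m)
    case 0
    then show ?case by (simp add: Sum_def G)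
  next
    case (Suc m)
    define xs where "xs = [t i. i \<leftarrow> [0..<m], P i, Q i]"
    have IH: "val G e (Sum xs) = finsum F (\<lambda>i. if P i \<and> Q i then val G e (t i) else \<zero>\<^bsub>F\<^esub>) {..<m}"
      unfolding xs_def by (rule Suc.IH) (use Suc.prems in auto)
    have xs: "\<forall>t \<in> set xs. val G e t \<in> carrier F" using Suc.prems unfolding xs_def by auto
    have e: "[t i. i \<leftarrow> [0..<Suc m], P i, Q i] = xs @ (if P m then if Q m then [t m] else [] else [])"
      unfolding xs_def by simp
    have "finsum F (\<lambda>i. if P i \<and> Q i then val G e (t i) else \<zero>\<^bsub>F\<^esub>) {..<Suc m}
      = (if P m \<and> Q m then val G e (t m) else \<zero>\<^bsub>F\<^esub>) \<oplus>\<^bsub>F\<^esub> val G e (Sum xs)"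
      unfolding IH lessThan_Suc by (rule F.finsum_insert) (use Suc.prems in auto)
    moreover have "val G e (Sum (xs @ (if P m then if Q m then [t m] else [] else [])))
      = val G e (Sum xs) \<oplus>\<^bsub>F\<^esub> (if P m \<and> Q m then val G e (t m) else \<zero>\<^bsub>F\<^esub>)"
      using app[of xs "if P m then if Q m then [t m] else [] else []"] xs Suc.prems[of m]
      by (auto simp: Sum_def G)
    moreover have "val G e (Sum xs) \<in> carrier F" using app(2)[of xs "[]"] xs by simp
    ultimately show ?case unfolding e using Suc.prems[of m] by (auto intro: F.a_comm)
  qed
qed

lemma (in ring) coeff_map_upt:
  "coeff (map f (rev [0..<m])) = (\<lambda>i. if i < m then f i else \<zero>)"
  by (induction m) (auto simp: fun_eq_iff)

text \<open>The coefficients of the product of two lists of length \<open>k + 1\<close> and \<open>n - k + 1\<close> are given by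
  \<open>product_coeff\<close>, so values of the variables that refute the sentence yield a proper factorization.\<close>

lemma sat_irreducible_sentence:
  assumes "underlying_ring G F" "field F"
    and p: "map (cst G) p \<in> carrier (poly_ring F)" "pirreducible\<^bsub>F\<^esub> (carrier F) (map (cst G) p)"
  shows "sat G e (irreducible_sentence p)"
proof -
  interpret F: field F by fact
  have G: "zero G = zero F" "add G = add F" "carrier G = carrier F" "mult G = mult F"
    using assms(1) by (simp_all add: underlying_ring_def)
  have F: "subfield (carrier F) F" by (rule F.carrier_is_subfield)
  define n where "n = degree p"
  have "n \<ge> 1" using F.pirreducible_degree[OF F p] by (simp add: n_def)
  then have "n \<noteq> 0" by simp
  have neg: False if k: "k \<in> {1..<n}"
    and ex: "sat G e (Exs [0..<n + 2] (Conj [Eq (product_coeff n k j) (Const (p ! (n - j))). j \<leftarrow> [0..<n + 1]]))" for k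
  proof -
    obtain e' where e': "\<forall>x \<in> set [0..<n + 2]. e' x \<in> carrier F"
      and s: "sat G e' (Conj [Eq (product_coeff n k j) (Const (p ! (n - j))). j \<leftarrow> [0..<n + 1]])"
      using sat_Exs_imp[OF ex] G(3) by auto
    have e'c: "e' x \<in> carrier F" if "x < n + 2" for x using e' that by (metis atLeastLessThan_iff set_upt zero_le)
    \<comment> \<open>The values of the variables are the coefficients of two factors of \<open>p\<close>.\<close>
    define p1 where "p1 = map (\<lambda>i. e' i) (rev [0..<k + 1])"
    define p2 where "p2 = map (\<lambda>i. e' (k + 1 + i)) (rev [0..<n - k + 1])"
    have c1: "F.coeff p1 = (\<lambda>i. if i < k + 1 then e' i else \<zero>\<^bsub>F\<^esub>)"
      and c2: "F.coeff p2 = (\<lambda>i. if i < n - k + 1 then e' (k + 1 + i) else \<zero>\<^bsub>F\<^esub>)"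
      unfolding p1_def p2_def by (rule F.coeff_map_upt)+
    have s1: "set p1 \<subseteq> carrier F" and s2: "set p2 \<subseteq> carrier F"
      using e'c k by (auto simp: p1_def p2_def simp del: upt_Suc)
    have l: "length p1 = k + 1" "length p2 = n - k + 1" by (simp_all add: p1_def p2_def)
    have mc: "F.coeff (F.poly_mult p1 p2) j = finsum F (\<lambda>i. if i \<le> k \<and> j - i \<le> n - k then e' i \<otimes>\<^bsub>F\<^esub> e' (k + 1 + (j - i)) else \<zero>\<^bsub>F\<^esub>) {..<j + 1}" for j
    proof -
      have "F.coeff (F.poly_mult p1 p2) j = (\<Oplus>\<^bsub>F\<^esub> i \<in> {..j}. F.coeff p1 i \<otimes>\<^bsub>F\<^esub> F.coeff p2 (j - i))"
        using F.poly_mult_coeff[OF s1 s2] by simp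
      also have "\<dots> = finsum F (\<lambda>i. if i \<le> k \<and> j - i \<le> n - k then e' i \<otimes>\<^bsub>F\<^esub> e' (k + 1 + (j - i)) else \<zero>\<^bsub>F\<^esub>) {..j}"
        by (rule F.finsum_cong') (use e'c k in \<open>auto simp: c1 c2\<close>)
      finally show ?thesis by (simp add: lessThan_Suc_atMost)
    qed
    have pc: "val G e' (product_coeff n k j) = F.coeff (F.poly_mult p1 p2) j" if "j \<le> n" for j
    proof -
      have "val G e' (product_coeff n k j) = finsum F (\<lambda>i. if i \<le> k \<and> j - i \<le> n - k
          then val G e' (Mul (Var i) (Var (k + 1 + (j - i)))) else \<zero>\<^bsub>F\<^esub>) {..<j + 1}"
        unfolding product_coeff_def
        by (rule val_Sum_filter[OF assms(1) F.ring_axioms]) (use e'c k that in \<open>auto simp: G\<close>)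
      then show ?thesis unfolding mc val.simps G .
    qed
    have cf: "F.coeff (F.poly_mult p1 p2) j = F.coeff (map (cst G) p) j" for j
    proof (cases "j \<le> n")
      case True
      have "sat G e' (Eq (product_coeff n k j) (Const (p ! (n - j))))" using s True by auto
      then have "F.coeff (F.poly_mult p1 p2) j = cst G (p ! (n - j))" using pc[OF True] by simp
      also have "\<dots> = F.coeff (map (cst G) p) j"
        using F.coeff_nth[of j "map (cst G) p"] True \<open>n \<ge> 1\<close> by (simp add: n_def)
      finally show ?thesis .
    next
      case False
      have "F.coeff (F.poly_mult p1 p2) j = finsum F (\<lambda>i. \<zero>\<^bsub>F\<^esub>) {..<j + 1}"
        unfolding mc by (rule F.finsum_cong') (use False k in auto)
      then show ?thesis using False F.coeff_length[of "map (cst G) p" j] by (simp add: n_def)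
    qed
    have poly: "polynomial\<^bsub>F\<^esub> (carrier F) (map (cst G) p)" using p(1) by (simp add: univ_poly_carrier)
    have "polynomial\<^bsub>F\<^esub> (carrier F) (F.poly_mult p1 p2)"
      by (rule F.poly_mult_is_polynomial[OF F.carrier_is_subring s1 s2])
    with cf have eq: "map (cst G) p = F.poly_mult p1 p2"
      using F.coeff_iff_polynomial_cond[OF poly] by (simp add: fun_eq_iff)
    have lp: "length p = n + 1" using \<open>n \<ge> 1\<close> by (simp add: n_def)
    have "F.coeff (F.poly_mult p1 p2) n \<noteq> \<zero>\<^bsub>F\<^esub>"
    proof -
      have "map (cst G) p \<noteq> []" using lp by auto
      then have "F.coeff (map (cst G) p) n = lead_coeff (map (cst G) p)"
        using F.lead_coeff_simp[of "map (cst G) p"] lp by simp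
      moreover have "\<dots> \<noteq> \<zero>\<^bsub>F\<^esub>" using poly \<open>map (cst G) p \<noteq> []\<close> by (simp add: polynomial_def)
      ultimately show ?thesis using eq by simp
    qed
    moreover have "F.coeff (F.poly_mult p1 p2) n = e' k \<otimes>\<^bsub>F\<^esub> e' (n + 1)"
    proof -
      have "F.coeff (F.poly_mult p1 p2) n = finsum F (\<lambda>i. if k = i then e' k \<otimes>\<^bsub>F\<^esub> e' (k + 1 + (n - k)) else \<zero>\<^bsub>F\<^esub>) {..<n + 1}"
        unfolding mc by (rule F.finsum_cong') (use e'c k in auto)
      also have "\<dots> = e' k \<otimes>\<^bsub>F\<^esub> e' (k + 1 + (n - k))"
        by (rule F.finsum_singleton[where f = "\<lambda>_. e' k \<otimes>\<^bsub>F\<^esub> e' (k + 1 + (n - k))"]) (use e'c k in auto)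
      finally show ?thesis using k by simp
    qed
    ultimately have nz: "e' k \<noteq> \<zero>\<^bsub>F\<^esub>" "e' (n + 1) \<noteq> \<zero>\<^bsub>F\<^esub>" using e'c k by auto
    have "hd p1 = e' k" "hd p2 = e' (n + 1)" "p1 \<noteq> []" "p2 \<noteq> []"
      using k by (simp_all add: p1_def p2_def)
    then have pp: "p1 \<in> carrier (poly_ring F)" "p2 \<in> carrier (poly_ring F)"
      using nz s1 s2 by (simp_all add: univ_poly_carrier[symmetric] polynomial_def)
    then have "p1 \<in> Units (poly_ring F) \<or> p2 \<in> Units (poly_ring F)"
      using F.pirreducibleE(3)[OF F.carrier_is_subring p pp] eq by (simp add: univ_poly_mult)
    then have "degree p1 = 0 \<or> degree p2 = 0" unfolding F.univ_poly_units'[OF F] by argo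
    then show False using l k by auto
  qed
  show ?thesis
    unfolding irreducible_sentence_def Let_def n_def[symmetric] if_not_P[OF \<open>n \<noteq> 0\<close>] sat_Conj
  proof (intro ballI)
    fix \<phi> assume "\<phi> \<in> set [Neg (Exs [0..<n + 2] (Conj [Eq (product_coeff n k j) (Const (p ! (n - j))). j \<leftarrow> [0..<n + 1]])). k \<leftarrow> [1..<n]]"
    then obtain k where k: "k \<in> {1..<n}"
      and \<phi>: "\<phi> = Neg (Exs [0..<n + 2] (Conj [Eq (product_coeff n k j) (Const (p ! (n - j))). j \<leftarrow> [0..<n + 1]]))"
      by (auto simp del: upt_Suc)
    show "sat G e \<phi>" unfolding \<phi> sat.simps by (rule notI, rule neg[OF k])
  qed
qed

lemma sat_Exs_embedding:
  assumes "structure_embedding C G M h" "is_structure C G" "quantifier_free \<phi>" "set_fm \<phi> \<subseteq> C"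
  shows "range e \<subseteq> carrier G \<Longrightarrow> sat G e (Exs xs \<phi>) \<Longrightarrow> sat M (h \<circ> e) (Exs xs \<phi>)"
proof (induction xs arbitrary: e)
  case Nil
  then show ?case using sat_embedding[OF assms(1,2) _ assms(3,4), of e] by (simp add: Exs_def del: comp_apply)
next
  case (Cons x xs)
  then obtain a where a: "a \<in> carrier G" "sat G (e(x := a)) (Exs xs \<phi>)" by (auto simp: Exs_def)
  have "range (e(x := a)) \<subseteq> carrier G" using a(1) Cons.prems(1) by auto
  from Cons.IH[OF this a(2)] have "sat M (h \<circ> e(x := a)) (Exs xs \<phi>)" .
  moreover have "h \<circ> e(x := a) = (h \<circ> e)(x := h a)" by (auto simp: fun_eq_iff)
  ultimately have "sat M ((h \<circ> e)(x := h a)) (Exs xs \<phi>)" by (simp only:)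
  moreover have "h a \<in> carrier M" using a(1) assms(1) by (auto simp: structure_embedding_def)
  ultimately have "\<exists>a \<in> carrier M. sat M ((h \<circ> e)(x := a)) (Exs xs \<phi>)" by blast
  moreover have "Exs (x # xs) \<phi> = Exists x (Exs xs \<phi>)" by (simp add: Exs_def)
  ultimately show ?case by (simp only: sat.simps)
qed

text \<open>Being a universal sentence, irreducibility passes to substructures.\<close>

lemma irreducible_sentence_substructure:
  assumes "structure_embedding UNIV G M h" "is_structure UNIV G" "true_in M (irreducible_sentence p)"
  shows "true_in G (irreducible_sentence p)"
  unfolding true_in_def
proof (intro allI impI)
  fix e :: "nat \<Rightarrow> _" assume e: "range e \<subseteq> carrier G"
  then have "range (h \<circ> e) \<subseteq> carrier M" using assms(1) by (auto simp: structure_embedding_def)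
  then have M: "sat M (h \<circ> e) (irreducible_sentence p)" using assms(3) by (simp add: true_in_def)
  have qf: "quantifier_free (Conj (map f xs))" if "\<And>x. quantifier_free (f x)" for f and xs :: "nat list"
    using that by (induction xs) (auto simp: Conj_def Falsity_def)
  have "\<not> sat G e (Exs xs (Conj (map f ys)))"
    if "\<not> sat M (h \<circ> e) (Exs xs (Conj (map f ys)))" "\<And>x. quantifier_free (f x)" for f xs and ys :: "nat list"
    using sat_Exs_embedding[where \<phi> = "Conj (map f ys)" and xs = xs, OF assms(1,2) qf[OF that(2)] subset_UNIV e] that(1) by blast
  then show "sat G e (irreducible_sentence p)"
    using M by (auto simp: irreducible_sentence_def Let_def simp del: upt_Suc split: if_splits)
qed

section \<open>Algebraic independence\<close>

context field
begin

lemma simple_extension_subset_generate_field: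
  assumes "subfield F R" "a \<in> carrier R"
  shows "simple_extension F a \<subseteq> generate_field R (insert a F)"
proof (rule simple_extension_subring_incl)
  have "insert a F \<subseteq> carrier R" using assms subfieldE(3) by blast
  then show "subring (generate_field R (insert a F)) R"
    using generate_field_is_subfield subfieldE(1) by blast
qed (auto intro: generate_field.incl)

text \<open>Every element of \<open>F(a)\<close> is a quotient of elements of \<open>F[a]\<close>.\<close>

lemma generate_field_insert_fraction:
  assumes F: "subfield F R" and a: "a \<in> carrier R" and x: "x \<in> generate_field R (insert a F)"
  obtains u v where "u \<in> simple_extension F a" "v \<in> simple_extension F a" "v \<noteq> \<zero>" "v \<otimes> x = u"
proof -
  let ?S = "simple_extension F a"
  have S: "subring ?S R" by (rule simple_extension_is_subring[OF subfieldE(1)[OF F] a])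
  note SE = subringE[OF S]
  have Sc: "y \<in> carrier R" if "y \<in> ?S" for y using SE(1) that by blast
  have "x \<in> carrier R \<and> (\<exists>u v. u \<in> ?S \<and> v \<in> ?S \<and> v \<noteq> \<zero> \<and> v \<otimes> x = u)"
    using x
  proof (induction rule: generate_field.induct)
    case one
    then show ?case using SE(3) by (auto intro!: exI[of _ \<one>])
  next
    case (incl h)
    then have "h \<in> ?S"
      using simple_extension_incl[OF subfieldE(3)[OF F] a] simple_extension_mem[OF subfieldE(1)[OF F] a] by blast
    then show ?case using SE(3) Sc by (intro conjI exI[of _ h] exI[of _ \<one>]) auto
  next
    case (a_inv h)
    then obtain u v where "u \<in> ?S" "v \<in> ?S" "v \<noteq> \<zero>" "v \<otimes> h = u" "h \<in> carrier R" by blast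
    then show ?case using SE(5) Sc by (intro conjI exI[of _ "\<ominus> u"] exI[of _ v]) (auto simp: r_minus)
  next
    case (m_inv h)
    then obtain u v where uv: "u \<in> ?S" "v \<in> ?S" "v \<noteq> \<zero>" "v \<otimes> h = u" "h \<in> carrier R" by blast
    have hU: "h \<in> Units R" using m_inv(2) uv(5) field_Units by simp
    have "u \<noteq> \<zero>" using uv m_inv(2) Sc integral by metis
    moreover have "u \<otimes> inv h = v" using uv(4) hU uv(2) Sc by (metis Units_r_inv m_assoc r_one Units_inv_closed uv(5))
    ultimately show ?case using uv hU by (intro conjI exI[of _ v] exI[of _ u]) auto
  next
    case (eng_add h k)
    then obtain u v u' v' where uv: "u \<in> ?S" "v \<in> ?S" "v \<noteq> \<zero>" "v \<otimes> h = u" "h \<in> carrier R"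
      "u' \<in> ?S" "v' \<in> ?S" "v' \<noteq> \<zero>" "v' \<otimes> k = u'" "k \<in> carrier R" by blast
    note c = Sc[OF uv(1)] Sc[OF uv(2)] Sc[OF uv(6)] Sc[OF uv(7)]
    have "v \<otimes> v' \<noteq> \<zero>" using uv c integral by blast
    moreover have "(v \<otimes> v') \<otimes> (h \<oplus> k) = v' \<otimes> (v \<otimes> h) \<oplus> v \<otimes> (v' \<otimes> k)"
      using uv(5,10) c by algebra
    ultimately show ?case using uv SE(6,7)
      by (intro conjI exI[of _ "v' \<otimes> u \<oplus> v \<otimes> u'"] exI[of _ "v \<otimes> v'"]) auto
  next
    case (eng_mult h k)
    then obtain u v u' v' where uv: "u \<in> ?S" "v \<in> ?S" "v \<noteq> \<zero>" "v \<otimes> h = u" "h \<in> carrier R"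
      "u' \<in> ?S" "v' \<in> ?S" "v' \<noteq> \<zero>" "v' \<otimes> k = u'" "k \<in> carrier R" by blast
    note c = Sc[OF uv(1)] Sc[OF uv(2)] Sc[OF uv(6)] Sc[OF uv(7)]
    have "v \<otimes> v' \<noteq> \<zero>" using uv c integral by blast
    moreover have "(v \<otimes> v') \<otimes> (h \<otimes> k) = (v \<otimes> h) \<otimes> (v' \<otimes> k)"
      using uv(5,10) c by algebra
    ultimately show ?case using uv SE(6,7)
      by (intro conjI exI[of _ "u \<otimes> u'"] exI[of _ "v \<otimes> v'"]) auto
  qed
  then show ?thesis using that by blast
qed

lemma generate_field_insert_common_denominator:
  assumes F: "subfield F R" and a: "a \<in> carrier R" and p: "set p \<subseteq> generate_field R (insert a F)"
  shows "\<exists>v \<in> simple_extension F a. v \<noteq> \<zero> \<and> (\<forall>c \<in> set p. v \<otimes> c \<in> simple_extension F a)"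
proof -
  let ?S = "simple_extension F a"
  have S: "subring ?S R" by (rule simple_extension_is_subring[OF subfieldE(1)[OF F] a])
  note SE = subringE[OF S]
  have Sc: "y \<in> carrier R" if "y \<in> ?S" for y using SE(1) that by blast
  have gc: "x \<in> carrier R" if "x \<in> generate_field R (insert a F)" for x
    using generate_field_in_carrier[OF _ that] a subfieldE(3)[OF F] by blast
  show ?thesis
    using p
  proof (induction p)
    case Nil
    then show ?case using SE(3) by (auto intro!: bexI[of _ \<one>])
  next
    case (Cons c p)
    then obtain v where v: "v \<in> ?S" "v \<noteq> \<zero>" "\<forall>c \<in> set p. v \<otimes> c \<in> ?S" by auto
    obtain u w where w: "u \<in> ?S" "w \<in> ?S" "w \<noteq> \<zero>" "w \<otimes> c = u"
      using generate_field_insert_fraction[OF F a, of c] Cons.prems by auto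
    have "(v \<otimes> w) \<otimes> c = v \<otimes> (w \<otimes> c)" using Sc v w gc Cons.prems by (simp add: m_assoc)
    then have 1: "(v \<otimes> w) \<otimes> c \<in> ?S" using SE(6) v(1) w(1,4) by simp
    have 2: "(v \<otimes> w) \<otimes> d \<in> ?S" if "d \<in> set p" for d
    proof -
      have "d \<in> carrier R" using gc Cons.prems that by auto
      then have "(v \<otimes> w) \<otimes> d = w \<otimes> (v \<otimes> d)" using Sc v w by (metis m_assoc m_comm)
      then show ?thesis using SE(6) v(3) w(2) that by simp
    qed
    have "v \<otimes> w \<in> ?S" by (rule SE(6)[OF v(1) w(2)])
    moreover have "v \<otimes> w \<noteq> \<zero>" using v(2) w(3) Sc[OF v(1)] Sc[OF w(2)] integral_iff by simp
    ultimately show ?case using 1 2 by (intro bexI[of _ "v \<otimes> w"]) auto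
  qed
qed

lemma eval_scalar:
  assumes "set p \<subseteq> carrier R" "c \<in> carrier R" "x \<in> carrier R"
  shows "eval (map (\<lambda>b. c \<otimes> b) p) x = c \<otimes> eval p x"
  using assms by (induction p) (auto simp: r_distr m_assoc eval_in_carrier)

text \<open>A polynomial in two variables, given as a polynomial in \<open>b\<close> with the polynomials \<open>fs\<close> in
  \<open>a\<close> as coefficients, read as a polynomial in \<open>a\<close>.\<close>

lemma swap_variables:
  assumes F: "subfield F R" and a: "a \<in> carrier R" and b: "b \<in> carrier R"
    and fs: "set fs \<subseteq> carrier (F[X])"
  shows "\<exists>g \<in> carrier ((simple_extension F b)[X]).
    eval g a = eval (map (\<lambda>f. eval f a) fs) b \<and> (\<forall>i. coeff g i = eval (map (\<lambda>f. coeff f i) fs) b)"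
  using fs
proof (induction fs)
  case Nil
  show ?case by (intro bexI[of _ "[]"]) auto
next
  case (Cons f fs)
  let ?T = "simple_extension F b"
  have T: "subring ?T R" by (rule simple_extension_is_subring[OF subfieldE(1)[OF F] b])
  from Cons obtain g where g: "g \<in> carrier (?T[X])" "eval g a = eval (map (\<lambda>f. eval f a) fs) b"
    "\<And>i. coeff g i = eval (map (\<lambda>f. coeff f i) fs) b" by auto
  define c where "c = b [^] length fs"
  have "c \<in> ?T" unfolding c_def
    using simple_extension_mem[OF subfieldE(1)[OF F] b] subringE(3,6)[OF T] by (induction fs) auto
  have c: "c \<in> carrier R" using b by (simp add: c_def)
  have f: "set f \<subseteq> F" using Cons.prems polynomial_incl by (auto simp: univ_poly_carrier[symmetric])
  then have fR: "set f \<subseteq> carrier R" using subfieldE(3)[OF F] by blast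
  have gT: "set g \<subseteq> ?T" using g(1) polynomial_incl by (simp add: univ_poly_carrier[symmetric])
  then have gR: "set g \<subseteq> carrier R" using subringE(1)[OF T] by blast
  have cf: "set (map (\<lambda>x. c \<otimes> x) f) \<subseteq> ?T"
    using f subringE(6)[OF T \<open>c \<in> ?T\<close>] simple_extension_incl[OF subfieldE(3)[OF F] b] by auto
  then have cfR: "set (map (\<lambda>x. c \<otimes> x) f) \<subseteq> carrier R" using subringE(1)[OF T] by blast
  let ?g = "poly_add (map (\<lambda>x. c \<otimes> x) f) g"
  have fa: "eval f a \<in> carrier R" using eval_in_carrier[OF fR a] .
  show ?case
  proof (intro bexI[of _ ?g] conjI allI)
    show "?g \<in> carrier (?T[X])"
      unfolding univ_poly_carrier[symmetric] by (rule poly_add_is_polynomial[OF T cf gT])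
    show "eval ?g a = eval (map (\<lambda>f. eval f a) (f # fs)) b"
      using eval_poly_add[OF cfR gR a] eval_scalar[OF fR c a] g(2) fa c by (simp add: c_def m_comm)
    show "coeff ?g i = eval (map (\<lambda>f. coeff f i) (f # fs)) b" for i
      using poly_add_coeff[OF cfR gR] scalar_coeff[OF c, of f] g(3)[of i] coeff_in_carrier[OF fR, of i] c
      by (simp add: c_def m_comm)
  qed
qed

text \<open>The exchange property. An algebraic equation for \<open>b\<close> over \<open>F(a)\<close> has, after multiplication by a
  common denominator, coefficients in \<open>F[a]\<close>. Read as an equation for \<open>a\<close> over \<open>F[b]\<close> it is not
  trivial, because \<open>b\<close> is transcendental over \<open>F\<close>.\<close>

lemma exchange:
  assumes F: "subfield F R" and a: "a \<in> carrier R" and b: "b \<in> carrier R"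
    and alg: "(algebraic over generate_field R (insert a F)) b" and tr: "(transcendental over F) b"
  shows "(algebraic over generate_field R (insert b F)) a"
proof -
  let ?E = "generate_field R (insert a F)" and ?S = "simple_extension F a"
  have E: "subfield ?E R" using generate_field_is_subfield a subfieldE(3)[OF F] by simp
  obtain p where p: "p \<in> carrier (?E[X])" "p \<noteq> []" "eval p b = \<zero>"
    using algebraicE[OF subfieldE(1)[OF E] b alg] .
  have pE: "set p \<subseteq> ?E" and hp: "hd p \<noteq> \<zero>" using p(1,2) by (simp_all add: univ_poly_carrier[symmetric] polynomial_def)
  then have pR: "set p \<subseteq> carrier R" using subfieldE(3)[OF E] by blast
  obtain v where v: "v \<in> ?S" "v \<noteq> \<zero>" "\<forall>c \<in> set p. v \<otimes> c \<in> ?S"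
    using generate_field_insert_common_denominator[OF F a pE] by blast
  have vR: "v \<in> carrier R" using v(1) simple_extension_in_carrier[OF subfieldE(3)[OF F] a] by blast
  have "\<forall>c \<in> set p. \<exists>f \<in> carrier (F[X]). v \<otimes> c = eval f a"
    using v(3) simple_extension_as_eval_img[OF subfieldE(3)[OF F] a] by blast
  then obtain f where f: "\<And>c. c \<in> set p \<Longrightarrow> f c \<in> carrier (F[X])" "\<And>c. c \<in> set p \<Longrightarrow> eval (f c) a = v \<otimes> c" by metis
  define fs where "fs = map f p"
  have fs: "set fs \<subseteq> carrier (F[X])" using f(1) by (auto simp: fs_def)
  have "map (\<lambda>f. eval f a) fs = map (\<lambda>c. v \<otimes> c) p" using f(2) by (simp add: fs_def)
  then have "eval (map (\<lambda>f. eval f a) fs) b = \<zero>"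
    using eval_scalar[OF pR vR b] p(3) vR by simp
  then obtain g where g: "g \<in> carrier ((simple_extension F b)[X])" "eval g a = \<zero>"
    "\<And>i. coeff g i = eval (map (\<lambda>f. coeff f i) fs) b"
    using swap_variables[OF F a b fs] by auto
  have fF: "set f' \<subseteq> F" if "f' \<in> set fs" for f'
    using fs that polynomial_incl univ_poly_carrier by blast
  have "g \<noteq> []"
  proof
    assume "g = []"
    have coeff0: "coeff f' i = \<zero>" if "f' \<in> set fs" for f' i
    proof -
      let ?q = "map (\<lambda>f. coeff f i) fs"
      have "coeff f' i \<in> F" if "f' \<in> set fs" for f'
      proof -
        have "coeff f' i \<in> set f' \<union> {\<zero>}" unfolding coeff_img(3)[of f', symmetric] by simp
        then show ?thesis using fF[OF that] subringE(2)[OF subfieldE(1)[OF F]] by auto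
      qed
      then have q: "set ?q \<subseteq> F" by auto
      then have "set ?q \<subseteq> carrier R" using subfieldE(3)[OF F] by blast
      then have "eval (normalize ?q) b = \<zero>" using g(3)[of i] \<open>g = []\<close> eval_normalize b by simp
      moreover have "normalize ?q \<in> carrier (F[X])"
        using normalize_gives_polynomial[OF q] by (simp add: univ_poly_carrier)
      ultimately have "normalize ?q = []" using eval_transcendental[OF tr] by blast
      then have "?q = replicate (length ?q) \<zero>" using normalize_trick[of ?q] by simp
      moreover have "coeff f' i \<in> set ?q" using that by simp
      ultimately have "coeff f' i \<in> set (replicate (length ?q) \<zero>)" by (rule subst)
      then show ?thesis by simp
    qed
    have "fs \<noteq> []" using p(2) by (simp add: fs_def)
    then have "hd fs \<in> set fs" by simp
    have "eval (hd fs) a = v \<otimes> hd p" using f(2)[of "hd p"] p(2) by (simp add: fs_def hd_map)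
    moreover have "v \<otimes> hd p \<noteq> \<zero>" using v(2) vR hp pR p(2) integral hd_in_set by blast
    ultimately have "hd fs \<noteq> []" by auto
    have "polynomial F (hd fs)" using fs \<open>hd fs \<in> set fs\<close> univ_poly_carrier by blast
    with \<open>hd fs \<noteq> []\<close> have "coeff (hd fs) (degree (hd fs)) \<noteq> \<zero>"
      unfolding lead_coeff_simp[OF \<open>hd fs \<noteq> []\<close>] by (simp add: polynomial_def)
    then show False using coeff0[OF \<open>hd fs \<in> set fs\<close>] by simp
  qed
  then have "(algebraic over simple_extension F b) a" using algebraicI[OF g(1) _ g(2)] by simp
  then show ?thesis
    using algebraic_mono[OF simple_extension_subset_generate_field[OF F b]] by simp
qed

text \<open>No element of \<open>B\<close> is algebraic over the field generated by \<open>K\<close> and the others. The set \<open>K\<close> need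
  not be a subfield.\<close>

definition algebraically_independent :: "'a set \<Rightarrow> 'a set \<Rightarrow> bool" where
  "algebraically_independent K B \<longleftrightarrow>
     B \<subseteq> carrier R \<and> (\<forall>b \<in> B. (transcendental over generate_field R (K \<union> (B - {b}))) b)"

lemma algebraically_independent_subset:
  assumes "algebraically_independent K B" "K \<subseteq> carrier R" "C \<subseteq> B"
  shows "algebraically_independent K C"
  unfolding algebraically_independent_def
proof (intro conjI ballI)
  show "C \<subseteq> carrier R" using assms unfolding algebraically_independent_def by blast
  fix b assume "b \<in> C"
  have "generate_field R (K \<union> (C - {b})) \<subseteq> generate_field R (K \<union> (B - {b}))"
    by (rule mono_generate_field) (use assms in \<open>auto simp: algebraically_independent_def\<close>)
  then show "(transcendental over generate_field R (K \<union> (C - {b}))) b"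
    using transcendental_mono assms(1,3) \<open>b \<in> C\<close> unfolding algebraically_independent_def by blast
qed

lemma algebraically_independent_insert:
  assumes B: "algebraically_independent K B" and K: "K \<subseteq> carrier R" and a: "a \<in> carrier R"
    and tr: "(transcendental over generate_field R (K \<union> B)) a"
  shows "algebraically_independent K (insert a B)"
proof -
  have Bc: "B \<subseteq> carrier R" using B unfolding algebraically_independent_def by blast
  have gen: "subfield (generate_field R (K \<union> C)) R" if "C \<subseteq> carrier R" for C
    using generate_field_is_subfield K that by simp
  have "a \<notin> B"
    using algebraic_self[OF subfieldE(1)[OF gen[OF Bc]]] tr generate_field.incl[of a "K \<union> B" R] by (auto simp: over_def)
  show ?thesis
    unfolding algebraically_independent_def
  proof (intro conjI ballI)
    show "insert a B \<subseteq> carrier R" using Bc a by simp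
    fix b assume "b \<in> insert a B"
    then consider "b = a" | "b \<in> B" "b \<noteq> a" using \<open>a \<notin> B\<close> by blast
    then show "(transcendental over generate_field R (K \<union> (insert a B - {b}))) b"
    proof cases
      case 1
      then show ?thesis using tr \<open>a \<notin> B\<close> by simp
    next
      case 2
      let ?F = "generate_field R (K \<union> (B - {b}))"
      have Fc: "K \<union> (B - {b}) \<subseteq> carrier R" using K Bc by auto
      have F: "subfield ?F R" using gen[of "B - {b}"] Bc by blast
      have b: "b \<in> carrier R" "(transcendental over ?F) b"
        using B Bc 2 unfolding algebraically_independent_def by auto
      show ?thesis
      proof (rule ccontr)
        assume "\<not> ?thesis"
        then have "(algebraic over generate_field R (K \<union> (insert a B - {b}))) b" by (simp add: over_def)
        moreover have "generate_field R (K \<union> (insert a B - {b})) \<subseteq> generate_field R (insert a ?F)"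
          by (rule generate_field_min_subfield1)
            (use K Bc a subfieldE(3)[OF F] in \<open>auto intro!: generate_field_is_subfield intro: generate_field.incl\<close>)
        ultimately have "(algebraic over generate_field R (insert a ?F)) b" using algebraic_mono by blast
        then have "(algebraic over generate_field R (insert b ?F)) a" by (rule exchange[OF F a b(1) _ b(2)])
        moreover have "generate_field R (insert b ?F) \<subseteq> generate_field R (K \<union> B)"
        proof (rule generate_field_min_subfield1)
          show "insert b ?F \<subseteq> generate_field R (K \<union> B)"
            using mono_generate_field[of "K \<union> (B - {b})" "K \<union> B"] K Bc 2 by (auto intro: generate_field.incl)
        qed (use gen[OF Bc] b subfieldE(3)[OF F] in auto)
        ultimately show False using tr algebraic_mono by (auto simp: over_def)
      qed
    qed
  qed
qed

lemma generate_field_finite_support: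
  assumes "x \<in> generate_field R S" "S \<subseteq> carrier R"
  shows "\<exists>T. finite T \<and> T \<subseteq> S \<and> x \<in> generate_field R T"
  using assms(1)
proof (induction rule: generate_field.induct)
  case one
  then show ?case using generate_field.one by blast
next
  case (incl h)
  then show ?case by (intro exI[of _ "{h}"]) (auto intro: generate_field.incl)
next
  case (a_inv h)
  then show ?case using generate_field.a_inv by metis
next
  case (m_inv h)
  then show ?case using generate_field.m_inv by metis
next
  case (eng_add h k)
  then obtain T T' where T: "finite T" "T \<subseteq> S" "h \<in> generate_field R T" "finite T'" "T' \<subseteq> S" "k \<in> generate_field R T'" by blast
  then have "h \<in> generate_field R (T \<union> T')" "k \<in> generate_field R (T \<union> T')"
    using mono_generate_field[of T "T \<union> T'"] mono_generate_field[of T' "T \<union> T'"] assms(2) by blast+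
  then show ?case using T by (intro exI[of _ "T \<union> T'"]) (auto intro: generate_field.eng_add)
next
  case (eng_mult h k)
  then obtain T T' where T: "finite T" "T \<subseteq> S" "h \<in> generate_field R T" "finite T'" "T' \<subseteq> S" "k \<in> generate_field R T'" by blast
  then have "h \<in> generate_field R (T \<union> T')" "k \<in> generate_field R (T \<union> T')"
    using mono_generate_field[of T "T \<union> T'"] mono_generate_field[of T' "T \<union> T'"] assms(2) by blast+
  then show ?case using T by (intro exI[of _ "T \<union> T'"]) (auto intro: generate_field.eng_mult)
qed

lemma algebraic_finite_support:
  assumes "(algebraic over generate_field R S) x" "S \<subseteq> carrier R" "x \<in> carrier R"
  shows "\<exists>T. finite T \<and> T \<subseteq> S \<and> (algebraic over generate_field R T) x"
proof -
  obtain p where p: "p \<in> carrier ((generate_field R S)[X])" "p \<noteq> []" "eval p x = \<zero>"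
    using algebraicE[OF subfieldE(1)[OF generate_field_is_subfield[OF assms(2)]] assms(3,1)] .
  have "\<forall>c \<in> set p. \<exists>T. finite T \<and> T \<subseteq> S \<and> c \<in> generate_field R T"
    using generate_field_finite_support[OF _ assms(2)] p(1) polynomial_incl by (auto simp: univ_poly_carrier[symmetric])
  then obtain T where T: "\<And>c. c \<in> set p \<Longrightarrow> finite (T c) \<and> T c \<subseteq> S \<and> c \<in> generate_field R (T c)" by metis
  let ?T = "\<Union>(T ` set p)"
  have "set p \<subseteq> generate_field R ?T"
  proof
    fix c assume c: "c \<in> set p"
    then have "generate_field R (T c) \<subseteq> generate_field R ?T"
      using T assms(2) by (intro mono_generate_field) auto
    then show "c \<in> generate_field R ?T" using T[OF c] by blast
  qed
  then have "p \<in> carrier ((generate_field R ?T)[X])"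
    using p(1) by (auto simp: univ_poly_carrier[symmetric] polynomial_def)
  then have "(algebraic over generate_field R ?T) x" using algebraicI p by blast
  moreover have "finite ?T" "?T \<subseteq> S" using T by auto
  ultimately show ?thesis by blast
qed

text \<open>Zorn's lemma applies because algebraic dependence involves only finitely many elements; by the
  exchange property, everything is algebraic over a maximal independent set.\<close>

lemma ex_maximal_algebraically_independent:
  assumes K: "K \<subseteq> carrier R"
  obtains B where "algebraically_independent K B"
    "\<forall>a \<in> carrier R. (algebraic over generate_field R (K \<union> B)) a"
proof -
  have "\<exists>B\<in>Collect (algebraically_independent K). \<forall>C\<in>Collect (algebraically_independent K). B \<subseteq> C \<longrightarrow> C = B"
  proof (rule subset_Zorn_nonempty)
    show "Collect (algebraically_independent K) \<noteq> {}"
      by (auto simp: algebraically_independent_def intro!: exI[of _ "{}"])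
    fix \<C> assume \<C>: "\<C> \<noteq> {}" "subset.chain (Collect (algebraically_independent K)) \<C>"
    have ind: "algebraically_independent K C" if "C \<in> \<C>" for C using \<C>(2) that unfolding subset.chain_def by blast
    then have Cc: "\<Union>\<C> \<subseteq> carrier R" unfolding algebraically_independent_def by blast
    have "(transcendental over generate_field R (K \<union> (\<Union>\<C> - {b}))) b" if b: "b \<in> \<Union>\<C>" for b
    proof (rule ccontr)
      assume "\<not> ?thesis"
      then have "(algebraic over generate_field R (K \<union> (\<Union>\<C> - {b}))) b" by (simp add: over_def)
      moreover have "K \<union> (\<Union>\<C> - {b}) \<subseteq> carrier R" "b \<in> carrier R" using K Cc b by auto
      ultimately have "\<exists>T. finite T \<and> T \<subseteq> K \<union> (\<Union>\<C> - {b}) \<and> (algebraic over generate_field R T) b"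
        by (rule algebraic_finite_support)
      then obtain T where T: "finite T" "T \<subseteq> K \<union> (\<Union>\<C> - {b})" "(algebraic over generate_field R T) b"
        by blast
      have "finite (insert b (T \<inter> \<Union>\<C>))" "insert b (T \<inter> \<Union>\<C>) \<subseteq> \<Union>\<C>" using T(1) b by auto
      then obtain C where C: "C \<in> \<C>" "insert b (T \<inter> \<Union>\<C>) \<subseteq> C"
        using finite_subset_Union_chain \<C> by metis
      have Cc': "C \<subseteq> carrier R" using Cc C(1) by blast
      have "generate_field R T \<subseteq> generate_field R (K \<union> (C - {b}))"
        by (rule mono_generate_field) (use T(2) C(2) K Cc' in auto)
      then have "(algebraic over generate_field R (K \<union> (C - {b}))) b" using algebraic_mono T(3) by blast
      then show False using ind[OF C(1)] C(2) unfolding algebraically_independent_def by (auto simp: over_def)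
    qed
    then show "\<Union>\<C> \<in> Collect (algebraically_independent K)"
      using Cc by (simp add: algebraically_independent_def)
  qed
  then obtain B where B: "algebraically_independent K B" and max: "\<And>C. algebraically_independent K C \<Longrightarrow> B \<subseteq> C \<Longrightarrow> C = B" by blast
  have "(algebraic over generate_field R (K \<union> B)) a" if a: "a \<in> carrier R" for a
  proof (rule ccontr)
    assume "\<not> ?thesis"
    then have tr: "(transcendental over generate_field R (K \<union> B)) a" by (simp add: over_def)
    have "a \<in> B" using max[OF algebraically_independent_insert[OF B K a tr]] by blast
    then have "a \<in> generate_field R (K \<union> B)" by (simp add: generate_field.incl)
    moreover have "subring (generate_field R (K \<union> B)) R"
      by (intro subfieldE(1) generate_field_is_subfield) (use B K in \<open>auto simp: algebraically_independent_def\<close>)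
    ultimately show False using algebraic_self tr by (auto simp: over_def)
  qed
  then show ?thesis using that[OF B] by blast
qed

section \<open>Cardinality of generated fields and of algebraic extensions\<close>

lemma card_of_Un_ordLeq_UNIV:
  assumes "infinite (UNIV :: 'x set)" "(card_of A, card_of (UNIV :: 'x set)) \<in> ordLeq"
    "(card_of B, card_of (UNIV :: 'x set)) \<in> ordLeq"
  shows "(card_of (A \<union> B), card_of (UNIV :: 'x set)) \<in> ordLeq"
  by (rule card_of_Un_ordLeq_infinite_Field[OF _ assms(2,3) card_of_Card_order])
    (use assms(1) in \<open>simp add: Field_card_of\<close>)

lemma card_of_Times_ordLeq_UNIV:
  assumes "infinite (UNIV :: 'x set)" "(card_of A, card_of (UNIV :: 'x set)) \<in> ordLeq"
    "(card_of B, card_of (UNIV :: 'x set)) \<in> ordLeq"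
  shows "(card_of (A \<times> B), card_of (UNIV :: 'x set)) \<in> ordLeq"
  by (rule card_of_Times_ordLeq_infinite_Field[OF _ assms(2,3) card_of_Card_order])
    (use assms(1) in \<open>simp add: Field_card_of\<close>)

lemma card_of_finite_ordLeq_UNIV:
  assumes "infinite (UNIV :: 'x set)" "finite A"
  shows "(card_of A, card_of (UNIV :: 'x set)) \<in> ordLeq"
proof -
  have "\<not> (card_of (UNIV :: 'x set), card_of A) \<in> ordLeq"
    using assms card_of_ordLeq_finite by blast
  then show ?thesis using ordLeq_total[OF card_of_Well_order card_of_Well_order] by blast
qed

text \<open>The elements reached from \<open>S\<close> by at most \<open>n\<close> rounds of field operations. The inverse of zero is
  some unspecified element, which is harmless because the stages serve as an upper bound only.\<close>

primrec generation_stage :: "'a set \<Rightarrow> nat \<Rightarrow> 'a set" where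
  "generation_stage S 0 = insert \<one> S"
| "generation_stage S (Suc n) = generation_stage S n \<union>
     (\<lambda>x. \<ominus> x) ` generation_stage S n \<union> (\<lambda>x. inv x) ` generation_stage S n \<union>
     (\<lambda>(x, y). x \<oplus> y) ` (generation_stage S n \<times> generation_stage S n) \<union>
     (\<lambda>(x, y). x \<otimes> y) ` (generation_stage S n \<times> generation_stage S n)"

lemma generate_field_subset_stages: "generate_field R S \<subseteq> (\<Union>n. generation_stage S n)"
proof
  have mono: "generation_stage S n \<subseteq> generation_stage S (n + m)" for n m
    by (induction m) auto
  have mono': "generation_stage S n \<subseteq> generation_stage S (max n m)" "generation_stage S m \<subseteq> generation_stage S (max n m)" for n m
    using mono[of n "max n m - n"] mono[of m "max n m - m"] by auto
  fix x assume "x \<in> generate_field R S"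
  then show "x \<in> (\<Union>n. generation_stage S n)"
  proof (induction rule: generate_field.induct)
    case (eng_add h k)
    then obtain n m where "h \<in> generation_stage S n" "k \<in> generation_stage S m" by auto
    then have "(h, k) \<in> generation_stage S (max n m) \<times> generation_stage S (max n m)"
      using mono' by blast
    then have "h \<oplus> k \<in> generation_stage S (Suc (max n m))" by force
    then show ?case by blast
  next
    case (eng_mult h k)
    then obtain n m where "h \<in> generation_stage S n" "k \<in> generation_stage S m" by auto
    then have "(h, k) \<in> generation_stage S (max n m) \<times> generation_stage S (max n m)"
      using mono' by blast
    then have "h \<otimes> k \<in> generation_stage S (Suc (max n m))" by force
    then show ?case by blast
  next
    case one
    have "\<one> \<in> generation_stage S 0" by simp
    then show ?case by blast
  next
    case (incl h)
    then have "h \<in> generation_stage S 0" by simp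
    then show ?case by blast
  next
    case (a_inv h)
    then obtain n where "h \<in> generation_stage S n" by blast
    then have "\<ominus> h \<in> generation_stage S (Suc n)" by simp
    then show ?case by blast
  next
    case (m_inv h)
    then obtain n where "h \<in> generation_stage S n" by blast
    then have "inv h \<in> generation_stage S (Suc n)" by simp
    then show ?case by blast
  qed
qed

lemma card_of_generate_field:
  assumes S: "(card_of S, card_of (UNIV :: 'x set)) \<in> ordLeq" and inf: "infinite (UNIV :: 'x set)"
  shows "(card_of (generate_field R S), card_of (UNIV :: 'x set)) \<in> ordLeq"
proof -
  have img: "(card_of (f ` A), card_of (UNIV :: 'x set)) \<in> ordLeq"
    if "(card_of A, card_of (UNIV :: 'x set)) \<in> ordLeq" for f :: "'c \<Rightarrow> 'a" and A
    using card_of_image ordLeq_transitive that by blast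
  have stage: "(card_of (generation_stage S n), card_of (UNIV :: 'x set)) \<in> ordLeq" for n
  proof (induction n)
    case 0
    have "(card_of {\<one>}, card_of (UNIV :: 'x set)) \<in> ordLeq"
      using inf by (simp add: card_of_finite_ordLeq_UNIV)
    then have "(card_of ({\<one>} \<union> S), card_of (UNIV :: 'x set)) \<in> ordLeq"
      using S inf by (intro card_of_Un_ordLeq_UNIV) auto
    then show ?case by simp
  next
    case (Suc n)
    have "(card_of (generation_stage S n \<times> generation_stage S n), card_of (UNIV :: 'x set)) \<in> ordLeq"
      using Suc inf by (intro card_of_Times_ordLeq_UNIV) auto
    then show ?case
      unfolding generation_stage.simps
      using Suc inf by (intro card_of_Un_ordLeq_UNIV img)
  qed
  have "(card_of (\<Union>n. generation_stage S n), card_of (UNIV :: 'x set)) \<in> ordLeq"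
  proof (rule card_of_UNION_ordLeq_infinite[OF inf])
    show "(card_of (UNIV :: nat set), card_of (UNIV :: 'x set)) \<in> ordLeq"
      using inf infinite_iff_card_of_nat by blast
  qed (use stage in blast)
  then show ?thesis
    using card_of_mono1[OF generate_field_subset_stages] ordLeq_transitive by blast
qed

lemma card_of_algebraics:
  assumes F: "subfield F R" and S: "(card_of F, card_of (UNIV :: 'x set)) \<in> ordLeq" and inf: "infinite (UNIV :: 'x set)"
  shows "(card_of {x \<in> carrier R. (algebraic over F) x}, card_of (UNIV :: 'x set)) \<in> ordLeq"
proof -
  have nat: "(card_of (UNIV :: nat set), card_of (UNIV :: 'x set)) \<in> ordLeq"
    using inf infinite_iff_card_of_nat by blast
  define L where "L n = {p. length p = n \<and> set p \<subseteq> F}" for n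
  have "(card_of (L n), card_of (UNIV :: 'x set)) \<in> ordLeq" for n
  proof (induction n)
    case 0
    have "L 0 = {[]}" by (auto simp: L_def)
    then show ?case using inf by (simp add: card_of_finite_ordLeq_UNIV)
  next
    case (Suc n)
    have "L (Suc n) = (\<lambda>(a, p). a # p) ` (F \<times> L n)"
      by (auto simp: L_def length_Suc_conv image_iff)
    moreover have "(card_of (F \<times> L n), card_of (UNIV :: 'x set)) \<in> ordLeq"
      using Suc S inf by (intro card_of_Times_ordLeq_UNIV) auto
    ultimately show ?case using card_of_image ordLeq_transitive by metis
  qed
  then have "(card_of (\<Union>n. L n), card_of (UNIV :: 'x set)) \<in> ordLeq"
    using card_of_UNION_ordLeq_infinite[OF inf nat] by blast
  moreover have "carrier (F[X]) \<subseteq> (\<Union>n. L n)"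
    using polynomial_incl by (auto simp: L_def univ_poly_carrier[symmetric])
  ultimately have FX: "(card_of (carrier (F[X])), card_of (UNIV :: 'x set)) \<in> ordLeq"
    using card_of_mono1 ordLeq_transitive by blast
  have "(card_of (\<Union>p \<in> carrier (F[X]). {x. is_root p x}), card_of (UNIV :: 'x set)) \<in> ordLeq"
  proof (rule card_of_UNION_ordLeq_infinite[OF inf FX], rule ballI)
    fix p assume "p \<in> carrier (F[X])"
    then have "finite {x. is_root p x}"
      using finite_number_of_roots carrier_polynomial_shell[OF subfieldE(1)[OF F]] by blast
    then show "(card_of {x. is_root p x}, card_of (UNIV :: 'x set)) \<in> ordLeq"
      using inf by (rule card_of_finite_ordLeq_UNIV[rotated])
  qed
  moreover have "{x \<in> carrier R. (algebraic over F) x} \<subseteq> (\<Union>p \<in> carrier (F[X]). {x. is_root p x})"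
    using algebraicE[OF subfieldE(1)[OF F]] unfolding is_root_def by blast
  ultimately show ?thesis using card_of_mono1 ordLeq_transitive by blast
qed

text \<open>If the field has more elements than \<open>'k + nat\<close>, then a maximal independent set over the
  countable set \<open>K\<close> cannot be smaller than \<open>'k + nat\<close>, since otherwise the whole field, being
  algebraic over it, would be no larger. A subset of cardinality \<open>\<kappa>\<close> generates a field whose
  relative algebraic closure embeds into \<open>'k + nat\<close>. The injection \<open>f\<close> of the power set of
  \<open>'k + nat\<close> expresses the size of the field.\<close>

lemma ex_algebraically_independent_of_card:
  fixes \<kappa> :: "'k rel" and f :: "('k + nat) set \<Rightarrow> 'a"
  assumes K: "K \<subseteq> carrier R" "countable K" and f: "inj f" "range f \<subseteq> carrier R" and \<kappa>: "Card_order \<kappa>"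
  obtains B where "algebraically_independent K B" "(card_of B, \<kappa>) \<in> ordIso"
    "(card_of {x \<in> carrier R. (algebraic over generate_field R (K \<union> B)) x}, card_of (UNIV :: ('k + nat) set)) \<in> ordLeq"
proof -
  let ?X = "UNIV :: ('k + nat) set"
  have inf: "infinite ?X" by simp
  have "(card_of K, card_of (UNIV :: nat set)) \<in> ordLeq"
    using K(2) card_of_ordLeq[of K "UNIV :: nat set"] unfolding countable_def by auto
  then have Kc: "(card_of K, card_of ?X) \<in> ordLeq"
    using inf infinite_iff_card_of_nat ordLeq_transitive by blast
  have cl: "(card_of {x \<in> carrier R. (algebraic over generate_field R (K \<union> B)) x}, card_of ?X) \<in> ordLeq"
    if "B \<subseteq> carrier R" "(card_of B, card_of ?X) \<in> ordLeq" for B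
  proof (rule card_of_algebraics[OF generate_field_is_subfield])
    show "(card_of (generate_field R (K \<union> B)), card_of ?X) \<in> ordLeq"
      by (rule card_of_generate_field) (use inf Kc that in \<open>auto intro!: card_of_Un_ordLeq_UNIV\<close>)
  qed (use K that inf in auto)
  obtain B where B: "algebraically_independent K B"
    "\<forall>a \<in> carrier R. (algebraic over generate_field R (K \<union> B)) a"
    by (rule ex_maximal_algebraically_independent[OF K(1)])
  have Bc: "B \<subseteq> carrier R" using B(1) unfolding algebraically_independent_def by blast
  have "\<not> (card_of B, card_of ?X) \<in> ordLeq"
  proof
    assume "(card_of B, card_of ?X) \<in> ordLeq"
    moreover have "{x \<in> carrier R. (algebraic over generate_field R (K \<union> B)) x} = carrier R"
      using B(2) by auto
    ultimately have "(card_of (carrier R), card_of ?X) \<in> ordLeq" using cl[OF Bc] by simp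
    moreover have "(card_of (UNIV :: ('k + nat) set set), card_of (carrier R)) \<in> ordLeq"
      using card_of_ordLeq f by blast
    ultimately have "(card_of (Set.Pow ?X), card_of ?X) \<in> ordLeq"
      unfolding Pow_UNIV using ordLeq_transitive by blast
    then show False using card_of_Pow[of ?X] not_ordLess_ordLeq by blast
  qed
  moreover have "(card_of B, card_of ?X) \<in> ordLeq \<or> (card_of ?X, card_of B) \<in> ordLeq"
    by (rule ordLeq_total[OF card_of_Well_order card_of_Well_order])
  ultimately have "(card_of ?X, card_of B) \<in> ordLeq" by blast
  then obtain g :: "'k + nat \<Rightarrow> 'a" where g: "inj g" "range g \<subseteq> B"
    unfolding card_of_ordLeq[symmetric] by blast
  define C where "C = (g \<circ> Inl) ` Field \<kappa>"
  have inj: "inj_on (g \<circ> Inl) (Field \<kappa>)" using g(1) by (auto simp: inj_on_def inj_def)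
  have "(card_of (Field \<kappa>), card_of C) \<in> ordIso"
    by (rule card_of_ordIsoI[of "g \<circ> Inl"]) (use inj in \<open>simp add: C_def bij_betw_def\<close>)
  then have C: "(card_of C, \<kappa>) \<in> ordIso"
    by (rule ordIso_transitive[OF ordIso_symmetric card_of_Field_ordIso[OF \<kappa>]])
  have CB: "C \<subseteq> B" using g(2) by (auto simp: C_def)
  have "(card_of C, card_of ?X) \<in> ordLeq"
  proof -
    have "(card_of (Field \<kappa>), card_of ?X) \<in> ordLeq"
      by (rule card_of_ordLeqI[of Inl]) (auto simp: inj_on_def)
    then show ?thesis unfolding C_def by (rule ordLeq_transitive[OF card_of_image])
  qed
  then show ?thesis
    using that[OF algebraically_independent_subset[OF B(1) K(1) CB] C cl] CB Bc by blast
qed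

end

section \<open>Models of prescribed transcendence degree\<close>

lemma (in field) algebraic_over_algebraics:
  assumes E: "subfield E R" and y: "y \<in> carrier R"
    and alg: "(algebraic over {x \<in> carrier R. (algebraic over E) x}) y"
  shows "(algebraic over E) y"
proof -
  let ?A = "{x \<in> carrier R. (algebraic over E) x}"
  have A: "subfield ?A R" by (rule subfield_of_algebraics[OF E])
  obtain p where p: "p \<in> carrier (?A[X])" "p \<noteq> []" "eval p y = \<zero>"
    using algebraicE[OF subfieldE(1)[OF A] y alg] .
  have pA: "set p \<subseteq> ?A" using p(1) polynomial_incl univ_poly_carrier by blast
  then have pc: "set p \<subseteq> carrier R" and pE: "\<And>x. x \<in> set p \<Longrightarrow> (algebraic over E) x" by auto
  let ?L = "finite_extension E p"
  have L: "subfield ?L R" by (rule finite_extension_is_subfield[OF E pc pE])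
  have "p \<in> carrier (?L[X])"
    using finite_extension_mem[OF subfieldE(1)[OF E] pc] p(1)
    by (auto simp: univ_poly_carrier[symmetric] polynomial_def)
  then have "(algebraic over ?L) y" using algebraicI p(2,3) by blast
  then have "finite_dimension ?L (simple_extension ?L y)"
    using finite_dimension_simple_extension[OF L y] by simp
  then have "finite_dimension E (simple_extension ?L y)"
    using telescopic_base_dim(1)[OF E L finite_extension_finite_dimension(1)[OF E pc pE]] by blast
  then show ?thesis
    using finite_dimension_imp_algebraic[OF E simple_extension_is_subring[OF subfieldE(1)[OF L] y]]
      simple_extension_mem[OF subfieldE(1)[OF L] y] by blast
qed

lemma (in field) root_algebraic:
  assumes A: "subfield A R" and y: "y \<in> carrier R" and q: "q > (0::nat)" and yq: "y [^] q \<in> A"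
  shows "(algebraic over A) y"
proof -
  obtain k where k: "q = Suc k" using q gr0_conv_Suc by blast
  let ?p = "monom \<one> k @ [\<ominus> (y [^] q)]"
  have sub: "subring A R" by (rule subfieldE(1)[OF A])
  show ?thesis
  proof (rule algebraicI)
    show "?p \<in> carrier (A[X])"
    proof -
      have "\<ominus> (y [^] q) \<in> A" by (rule subringE(5)[OF sub yq])
      then have "set ?p \<subseteq> A" using subringE(2,3)[OF sub] by (auto simp: monom_def)
      then show ?thesis unfolding univ_poly_carrier[symmetric] polynomial_def by (simp add: monom_def)
    qed
    show "?p \<noteq> []" by simp
    have "eval ?p y = y [^] k \<otimes> y \<oplus> \<ominus> (y [^] q)"
      using eval_append_aux[OF monom_in_carrier[of \<one> k], of "\<ominus> (y [^] q)" y] eval_monom[of \<one> y k] y by simp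
    also have "y [^] k \<otimes> y = y [^] q" by (simp add: k)
    finally show "eval ?p y = \<zero>" using y by (simp add: r_neg)
  qed
qed

lemma generate_field_hom:
  assumes "field G" "field M" and h: "h \<in> ring_hom G M" and T: "T \<subseteq> carrier G"
  shows "h ` generate_field G T = generate_field M (h ` T)"
proof -
  interpret G: field G by fact
  interpret M: field M by fact
  interpret h: ring_hom_ring G M h using ring_hom_ringI2[OF G.ring_axioms M.ring_axioms h] .
  have gc: "x \<in> carrier G" if "x \<in> generate_field G T" for x
    using G.generate_field_in_carrier[OF T that] .
  have inj: "inj_on h (carrier G)" using h.img_is_subfield(1)[OF G.carrier_is_subfield] by simp
  have nz: "h x \<noteq> \<zero>\<^bsub>M\<^esub>" if "x \<in> carrier G" "x \<noteq> \<zero>\<^bsub>G\<^esub>" for x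
    using inj that h.hom_zero by (metis G.zero_closed inj_onD)
  have hinv: "h (inv\<^bsub>G\<^esub> x) = inv\<^bsub>M\<^esub> (h x)" if "x \<in> carrier G" "x \<noteq> \<zero>\<^bsub>G\<^esub>" for x
  proof -
    have x: "x \<in> Units G" using that G.field_Units by simp
    have "h (inv\<^bsub>G\<^esub> x) \<otimes>\<^bsub>M\<^esub> h x = \<one>\<^bsub>M\<^esub>"
      using x that h.hom_mult[of "inv\<^bsub>G\<^esub> x" x] by simp
    then show ?thesis using that x M.comm_inv_char[of "h x" "h (inv\<^bsub>G\<^esub> x)"] by (simp add: M.m_comm)
  qed
  show ?thesis
  proof (intro equalityI subsetI)
    fix y assume "y \<in> h ` generate_field G T"
    then obtain x where "x \<in> generate_field G T" "y = h x" by blast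
    moreover from this(1) have "h x \<in> generate_field M (h ` T)"
    proof (induction rule: generate_field.induct)
      case (m_inv x)
      then show ?case using hinv[OF gc] nz[OF gc] generate_field.m_inv by metis
    qed (use gc in \<open>auto intro: generate_field.intros\<close>)
    ultimately show "y \<in> generate_field M (h ` T)" by simp
  next
    fix y assume "y \<in> generate_field M (h ` T)"
    then show "y \<in> h ` generate_field G T"
    proof (induction rule: generate_field.induct)
      case one
      then show ?case using h.hom_one generate_field.one by (metis image_eqI)
    next
      case (incl y)
      then show ?case by (auto intro: generate_field.incl)
    next
      case (a_inv y)
      then obtain x where "x \<in> generate_field G T" "y = h x" by blast
      then show ?case using gc by (intro image_eqI[of _ _ "\<ominus>\<^bsub>G\<^esub> x"]) (auto intro: generate_field.a_inv)
    next
      case (m_inv y)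
      then obtain x where "x \<in> generate_field G T" "y = h x" by blast
      moreover have "x \<noteq> \<zero>\<^bsub>G\<^esub>" using m_inv(2) calculation by auto
      ultimately show ?case using gc hinv
        by (intro image_eqI[of _ _ "inv\<^bsub>G\<^esub> x"]) (auto intro: generate_field.m_inv)
    next
      case (eng_add y z)
      then obtain x w where "x \<in> generate_field G T" "y = h x" "w \<in> generate_field G T" "z = h w" by blast
      then show ?case using gc by (intro image_eqI[of _ _ "x \<oplus>\<^bsub>G\<^esub> w"]) (auto intro: generate_field.eng_add)
    next
      case (eng_mult y z)
      then obtain x w where "x \<in> generate_field G T" "y = h x" "w \<in> generate_field G T" "z = h w" by blast
      then show ?case using gc by (intro image_eqI[of _ _ "x \<otimes>\<^bsub>G\<^esub> w"]) (auto intro: generate_field.eng_mult)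
    qed
  qed
qed

text \<open>The substructure of \<open>M\<close> with carrier \<open>A\<close>, transported along a map \<open>\<phi>\<close> that is injective on \<open>A\<close>.\<close>

definition substructure_copy ::
  "('a \<Rightarrow> 'x) \<Rightarrow> 'a set \<Rightarrow> ('c, 'a) ring_structure \<Rightarrow> ('c, 'x) ring_structure" where
  "substructure_copy \<phi> A M = (let \<psi> = inv_into A \<phi> in
     \<lparr> carrier = \<phi> ` A, mult = (\<lambda>x y. \<phi> (\<psi> x \<otimes>\<^bsub>M\<^esub> \<psi> y)), one = \<phi> \<one>\<^bsub>M\<^esub>, zero = \<phi> \<zero>\<^bsub>M\<^esub>,
       add = (\<lambda>x y. \<phi> (\<psi> x \<oplus>\<^bsub>M\<^esub> \<psi> y)), neg = (\<lambda>x. \<phi> (neg M (\<psi> x))), cst = (\<lambda>c. \<phi> (cst M c)) \<rparr>)"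

text \<open>That \<open>Z(x) = 0\<close> for an element \<open>x\<close> of \<open>U\<close> belongs to the atomic diagram.\<close>

lemma true_in_root_sentence:
  assumes U: "field U" and Z: "Z \<in> carrier (poly_ring U)" and x: "x \<in> carrier U" "ring.eval U Z x = \<zero>\<^bsub>U\<^esub>"
    and G: "is_structure UNIV G" "underlying_ring G F" "ring F"
    and diag: "\<forall>\<phi> \<in> atomic_diagram U. true_in G \<phi>"
  shows "true_in G (root_sentence Z)"
proof -
  interpret U: field U by fact
  let ?\<phi> = "Eq (poly_trm Z (Const x)) Zero"
  have s: "underlying_ring (self_structure U) U" by (simp add: underlying_ring_def self_structure_def)
  have ZU: "set Z \<subseteq> carrier U" using Z U.polynomial_incl univ_poly_carrier by blast
  have "trm_vars (Pow t n) = (if n = 0 then {} else trm_vars t)" for t :: "'a trm" and n by (induction n) auto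
  then have 1: "trm_vars (poly_trm p (Const x)) = {}" for p by (induction p) auto
  have "set_trm (Pow t n) \<subseteq> set_trm t" for t :: "'a trm" and n by (induction n) auto
  then have 2: "set_trm (poly_trm p (Const x)) \<subseteq> insert x (set p)" for p by (induction p) (force split: if_splits)+
  have "true_in (self_structure U) ?\<phi>"
    using x(2) unfolding true_in_def by (simp add: val_poly_trm[OF s U.ring_axioms]) (simp add: self_structure_def)
  then have "?\<phi> \<in> atomic_diagram U"
    unfolding atomic_diagram_def using 1 2[of Z] ZU x(1) by auto
  then have t: "true_in G ?\<phi>" using diag by blast
  have "cst G x \<in> carrier G" using G(1) by (auto simp: is_structure_def)
  then show ?thesis
    using t unfolding true_in_def root_sentence_def
    by (auto simp: val_poly_trm[OF G(2,3)])
qed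

text \<open>\<open>G\<close> is a copy of the relative algebraic closure of \<open>U(B)\<close> in a large elementary extension \<open>M\<close> of
  \<open>K\<close>, where \<open>B\<close> is an independent set of cardinality \<open>\<kappa>\<close>. It contains every \<open>q\<close>-th root in \<open>M\<close> of its
  elements, whence the sentences on \<open>q\<close>-th powers pass from \<open>M\<close> to \<open>G\<close>.\<close>

lemma model_of_transcendence_degree:
  fixes U :: "'u ring" and K :: "('u, 'b) ring_structure" and \<kappa> :: "'k rel"
  assumes U: "field U" "countable (carrier U)"
    and K: "is_structure UNIV K" "infinite (carrier K)" "range (cst K) = cst K ` carrier U"
    and ax: "\<forall>\<phi> \<in> field_axioms_fm. true_in K \<phi>" and diag: "\<forall>\<phi> \<in> atomic_diagram U. true_in K \<phi>"
    and power: "\<forall>q \<in> Q. q > 0 \<and> true_in K (power_sentence q (R q))"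
    and irr: "\<forall>i>0. true_in K (irreducible_sentence (P i))"
    and Z: "\<forall>i>(0::nat). Z i \<in> carrier (poly_ring U) \<and> (\<exists>x \<in> carrier U. ring.eval U (Z i) x = \<zero>\<^bsub>U\<^esub>)"
    and \<kappa>: "Card_order \<kappa>"
  shows "\<exists>G :: ('u, 'k + nat) ring_structure.
           is_model (carrier U) G (theory_of U Q R P Z) \<and>
           has_transcendence_degree G (cst G ` carrier U) \<kappa>"
proof -
  obtain M :: "('u, ('k + nat) set set \<Rightarrow> 'b) ring_structure" and f :: "('k + nat) set \<Rightarrow> _"
    where M: "is_structure UNIV M" "\<forall>\<phi>. true_in K \<phi> \<longrightarrow> true_in M \<phi>"
      and f: "inj f" "range f \<subseteq> carrier M"
    using ex_large_elementary_extension[where 'x = "('k + nat) set", OF K(1,2)] by (elim exE conjE) (rule that)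
  have axM: "\<forall>\<phi> \<in> field_axioms_fm. true_in M \<phi>" using ax M(2) by blast
  interpret M: field M by (rule field_of_field_axioms(1)[OF M(1) axM])
  have negM: "neg M a = \<ominus>\<^bsub>M\<^esub> a" if "a \<in> carrier M" for a
    by (rule field_of_field_axioms(2)[OF M(1) axM that])
  have uM: "underlying_ring M M" by (simp add: underlying_ring_def)
  define C where "C = cst M ` carrier U"
  have Cc: "C \<subseteq> carrier M" using M(1) by (auto simp: C_def is_structure_def)
  \<comment> \<open>That two constant symbols denote the same element is a sentence, hence passes from \<open>K\<close> to \<open>M\<close>.\<close>
  have cstC: "cst M c \<in> C" for c
  proof -
    obtain d where d: "d \<in> carrier U" "cst K c = cst K d" using K(3) by blast
    then have "true_in K (Eq (Const c) (Const d))" by (simp add: true_in_def)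
    then have "true_in M (Eq (Const c) (Const d))" using M(2) by blast
    moreover have "range (\<lambda>_::nat. \<zero>\<^bsub>M\<^esub>) \<subseteq> carrier M" by auto
    ultimately have "cst M c = cst M d" unfolding true_in_def by fastforce
    then show ?thesis using d(1) by (auto simp: C_def)
  qed
  have "countable C" using U(2) by (simp add: C_def)
  obtain B where B: "M.algebraically_independent C B" "(card_of B, \<kappa>) \<in> ordIso"
    and card: "(card_of {x \<in> carrier M. (M.algebraic over generate_field M (C \<union> B)) x}, card_of (UNIV :: ('k + nat) set)) \<in> ordLeq"
    by (rule M.ex_algebraically_independent_of_card[OF Cc \<open>countable C\<close> f \<kappa>])
  have Bc: "B \<subseteq> carrier M" using B(1) unfolding M.algebraically_independent_def by blast
  define E where "E = generate_field M (C \<union> B)"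
  have E: "subfield E M" unfolding E_def using M.generate_field_is_subfield Cc Bc by simp
  define A where "A = {x \<in> carrier M. (M.algebraic over E) x}"
  have A: "subfield A M" unfolding A_def by (rule M.subfield_of_algebraics[OF E])
  note Asub = subringE[OF subfieldE(1)[OF A]]
  have EA: "E \<subseteq> A" using M.algebraic_self[OF subfieldE(1)[OF E]] subfieldE(3)[OF E] by (auto simp: A_def)
  have CBA: "C \<subseteq> A" "B \<subseteq> A" using EA unfolding E_def by (auto intro: generate_field.incl)
  obtain \<phi> :: "_ \<Rightarrow> 'k + nat" where \<phi>: "inj_on \<phi> A"
    using card unfolding E_def[symmetric] A_def[symmetric] card_of_ordLeq[symmetric] by blast
  define \<psi> where "\<psi> = inv_into A \<phi>"
  have \<psi>\<phi>: "\<psi> (\<phi> x) = x" if "x \<in> A" for x using that \<phi> by (simp add: \<psi>_def)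
  have \<phi>\<psi>: "\<phi> (\<psi> y) = y" "\<psi> y \<in> A" if "y \<in> \<phi> ` A" for y
    using that \<phi> by (auto simp: \<psi>_def f_inv_into_f inv_into_into)
  define G where "G = substructure_copy \<phi> A M"
  have G: "carrier G = \<phi> ` A" "one G = \<phi> \<one>\<^bsub>M\<^esub>" "zero G = \<phi> \<zero>\<^bsub>M\<^esub>"
    "mult G = (\<lambda>x y. \<phi> (\<psi> x \<otimes>\<^bsub>M\<^esub> \<psi> y))" "add G = (\<lambda>x y. \<phi> (\<psi> x \<oplus>\<^bsub>M\<^esub> \<psi> y))"
    "neg G = (\<lambda>x. \<phi> (neg M (\<psi> x)))" "cst G = (\<lambda>c. \<phi> (cst M c))"
    by (simp_all add: G_def substructure_copy_def \<psi>_def Let_def)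
  let ?MA = "M\<lparr>carrier := A\<rparr>"
  have MA: "field ?MA" by (rule M.subfield_iff(2)[OF A])
  have \<phi>hom: "\<phi> \<in> ring_hom ?MA G"
    by (rule ring_hom_memI) (auto simp: G \<psi>\<phi>)
  then have "\<phi> \<in> ring_iso ?MA G" using \<phi> by (auto simp: ring_iso_def bij_betw_def G)
  from field.ring_iso_imp_img_field[OF MA this] have fG: "field G" by (simp add: G(2,3)[symmetric])
  have neg_closed: "neg M a \<in> A" if "a \<in> A" for a using negM[of a] that Asub(1,5) by auto
  have cstA: "cst M c \<in> A" for c using CBA(1) cstC by blast
  have emb: "structure_embedding UNIV G M \<psi>"
    unfolding structure_embedding_def
  proof (intro conjI ballI)
    show "inj_on \<psi> (carrier G)" by (metis G(1) \<phi>\<psi>(1) inj_onI)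
    show "\<psi> ` carrier G \<subseteq> carrier M" using \<phi>\<psi>(2) Asub(1) by (auto simp: G(1))
  qed (use Asub(2,3,6,7) cstA neg_closed \<phi>\<psi>(2) in \<open>auto simp: G \<psi>\<phi>\<close>)
  then have \<psi>hom: "\<psi> \<in> ring_hom G M"
    by (intro ring_hom_memI) (auto simp: structure_embedding_def)
  interpret G: field G by (rule fG)
  interpret \<psi>: ring_hom_ring G M \<psi> using ring_hom_ringI2[OF G.ring_axioms M.ring_axioms \<psi>hom] .
  have uG: "underlying_ring G G" by (simp add: underlying_ring_def)
  have sG: "is_structure UNIV G"
    using Asub(2,3,6,7) cstA neg_closed \<phi>\<psi>(2) unfolding is_structure_def by (auto simp: G)
  have negG: "neg G a = \<ominus>\<^bsub>G\<^esub> a" if "a \<in> carrier G" for a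
  proof -
    have "\<psi> (\<ominus>\<^bsub>G\<^esub> a) = neg M (\<psi> a)" using that negM by simp
    then show ?thesis using \<phi>\<psi>(1)[of "\<ominus>\<^bsub>G\<^esub> a"] that by (metis G(1,6) G.a_inv_closed)
  qed

  have "true_in G \<theta>" if "\<theta> \<in> theory_of U Q R P Z" for \<theta>
  proof -
    have diagG: "true_in G \<theta>" if "\<theta> \<in> atomic_diagram U" for \<theta>
    proof -
      have "quantifier_free \<theta>" "free_vars \<theta> = {}" using that by (auto simp: atomic_diagram_def)
      then show ?thesis using true_in_embedding_closed[OF emb sG] diag M(2) that by blast
    qed
    from that consider "\<theta> \<in> field_axioms_fm" | "\<theta> \<in> atomic_diagram U"
      | q where "q \<in> Q" "\<theta> = power_sentence q (R q)"
      | i where "i > 0" "\<theta> = irreducible_sentence (P i)" | i where "i > 0" "\<theta> = root_sentence (Z i)"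
      unfolding theory_of_def by blast
    then show ?thesis
    proof cases
      case 1
      then show ?thesis using field_axioms_of_field[OF fG uG negG] by blast
    next
      case 2
      then show ?thesis by (rule diagG)
    next
      case 3
      have q: "q > 0" and MP: "true_in M (power_sentence q (R q))" using power 3(1) M(2) by auto
      have "range (\<lambda>_::nat. \<zero>\<^bsub>M\<^esub>) \<subseteq> carrier M" by auto
      then have PM: "\<forall>x \<in> carrier M. M.eval (map (cst M) (snd (R q))) x = \<zero>\<^bsub>M\<^esub> \<or>
       (\<exists>y \<in> carrier M. y [^]\<^bsub>M\<^esub> q \<otimes>\<^bsub>M\<^esub> M.eval (map (cst M) (snd (R q))) x = M.eval (map (cst M) (fst (R q))) x)"
        using MP sat_power_sentence[OF uM M.ring_axioms] unfolding true_in_def by blast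
      have ev: "\<psi> (G.eval (map (cst G) p) x) = M.eval (map (cst M) p) (\<psi> x)"
        "G.eval (map (cst G) p) x \<in> carrier G" if "x \<in> carrier G" for p x
      proof -
        have s: "set (map (cst G) p) \<subseteq> carrier G" using sG by (auto simp: is_structure_def)
        have m: "map \<psi> (map (cst G) p) = map (cst M) p" using emb by (auto simp: structure_embedding_def)
        show "\<psi> (G.eval (map (cst G) p) x) = M.eval (map (cst M) p) (\<psi> x)"
          using \<psi>.eval_hom'[OF that s] unfolding m .
        show "G.eval (map (cst G) p) x \<in> carrier G" by (rule G.eval_in_carrier[OF s that])
      qed
      have "\<exists>y \<in> carrier G. y [^]\<^bsub>G\<^esub> q \<otimes>\<^bsub>G\<^esub> G.eval (map (cst G) (snd (R q))) x = G.eval (map (cst G) (fst (R q))) x"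
        if x: "x \<in> carrier G" and nz: "G.eval (map (cst G) (snd (R q))) x \<noteq> \<zero>\<^bsub>G\<^esub>" for x
      proof -
        define g where "g = G.eval (map (cst G) (snd (R q))) x"
        define f where "f = G.eval (map (cst G) (fst (R q))) x"
        have gf: "g \<in> carrier G" "f \<in> carrier G" using ev(2)[OF x] by (auto simp: g_def f_def)
        have inj: "inj_on \<psi> (carrier G)" using emb by (simp add: structure_embedding_def)
        have g0: "\<psi> g \<noteq> \<zero>\<^bsub>M\<^esub>" using nz inj_onD[OF inj, of g "\<zero>\<^bsub>G\<^esub>"] gf(1) by (auto simp: g_def)
        have "\<psi> x \<in> carrier M" using x by simp
        then obtain y where y: "y \<in> carrier M" "y [^]\<^bsub>M\<^esub> q \<otimes>\<^bsub>M\<^esub> \<psi> g = \<psi> f"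
          using PM g0 ev(1)[OF x] unfolding g_def f_def by metis
        have gA: "\<psi> g \<in> A" "\<psi> f \<in> A" using gf \<phi>\<psi>(2) by (auto simp: G(1))
        have "\<psi> g \<in> A - {\<zero>\<^bsub>M\<^esub>}" using gA(1) g0 by simp
        moreover have "\<psi> g \<otimes>\<^bsub>M\<^esub> y [^]\<^bsub>M\<^esub> q \<in> A"
          using y(2) gA M.m_comm[of "\<psi> g" "y [^]\<^bsub>M\<^esub> q"] y(1) gf(1) by simp
        ultimately have "y [^]\<^bsub>M\<^esub> q \<in> A" using M.subfield_m_inv_simprule[OF A] y(1) by blast
        then have "(M.algebraic over A) y" by (rule M.root_algebraic[OF A y(1) q])
        then have yA: "y \<in> A" using M.algebraic_over_algebraics[OF E y(1)] y(1) unfolding A_def by blast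
        have "\<phi> y \<in> carrier G" using yA by (simp add: G(1))
        moreover have "\<phi> y [^]\<^bsub>G\<^esub> q \<otimes>\<^bsub>G\<^esub> g = f"
        proof (rule inj_onD[OF inj])
          show "\<psi> (\<phi> y [^]\<^bsub>G\<^esub> q \<otimes>\<^bsub>G\<^esub> g) = \<psi> f"
            using \<open>\<phi> y \<in> carrier G\<close> gf y(2) \<psi>\<phi>[OF yA] \<psi>.hom_nat_pow by simp
        qed (use \<open>\<phi> y \<in> carrier G\<close> gf in auto)
        ultimately show ?thesis unfolding g_def f_def by blast
      qed
      then show ?thesis
        unfolding 3(2) true_in_def sat_power_sentence[OF uG G.ring_axioms] by blast
    next
      case 4
      then show ?thesis using irreducible_sentence_substructure[OF emb sG] irr M(2) by blast
    next
      case 5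
      then obtain x where "x \<in> carrier U" "ring.eval U (Z i) x = \<zero>\<^bsub>U\<^esub>" using Z by blast
      then show ?thesis
        using true_in_root_sentence[OF U(1) _ _ _ sG uG G.ring_axioms] Z 5 diagG by blast
    qed
  qed
  then have "is_model (carrier U) G (theory_of U Q R P Z)"
    using sG by (auto simp: is_model_def is_structure_def)
  moreover have "has_transcendence_degree G (cst G ` carrier U) \<kappa>"
    unfolding has_transcendence_degree_def
  proof (intro exI[of _ "\<phi> ` B"] conjI)
    have cG: "cst G ` carrier U = \<phi> ` C" by (auto simp: G C_def)
    have gen: "\<psi> ` generate_field G (\<phi> ` S) = generate_field M S" if "S \<subseteq> A" for S
    proof -
      have "\<psi> ` \<phi> ` S = S" using that \<psi>\<phi> by (force simp: image_image)
      then show ?thesis using generate_field_hom[OF fG M.field_axioms \<psi>hom, of "\<phi> ` S"] that by (simp add: G(1) image_mono)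
    qed
    have genc: "generate_field G (\<phi> ` S) \<subseteq> carrier G" if "S \<subseteq> A" for S
      using G.generate_field_incl[of "\<phi> ` S"] that by (auto simp: G(1))
    show "transcendence_basis G (cst G ` carrier U) (\<phi> ` B)"
      unfolding transcendence_basis_def cG
    proof (intro conjI ballI)
      show "\<phi> ` B \<subseteq> carrier G" using CBA(2) by (auto simp: G(1))
    next
      fix b assume "b \<in> \<phi> ` B"
      then obtain b' where b': "b' \<in> B" "b = \<phi> b'" by blast
      have S: "\<phi> ` C \<union> (\<phi> ` B - {b}) = \<phi> ` (C \<union> (B - {b'}))"
        using b' CBA(2) \<phi> by (auto dest: inj_onD)
      have SA: "C \<union> (B - {b'}) \<subseteq> A" using CBA by auto
      have sub: "subfield (generate_field G (\<phi> ` (C \<union> (B - {b'})))) G"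
        by (rule G.generate_field_is_subfield) (use SA in \<open>auto simp: G(1)\<close>)
      have bA: "b' \<in> A" "b \<in> carrier G" using b' CBA(2) by (auto simp: G(1))
      show "G.transcendental (generate_field G (\<phi> ` C \<union> (\<phi> ` B - {b}))) b"
      proof (rule ccontr)
        assume "\<not> ?thesis"
        then have "(G.algebraic over (generate_field G (\<phi> ` (C \<union> (B - {b'}))))) b"
          unfolding S by (simp add: over_def)
        then have "(M.algebraic over (\<psi> ` generate_field G (\<phi> ` (C \<union> (B - {b'}))))) (\<psi> b)"
          by (rule algebraic_hom[OF \<psi>hom fG M.field_axioms sub bA(2)])
        then have "(M.algebraic over generate_field M (C \<union> (B - {b'}))) b'"
          using gen[OF SA] \<psi>\<phi>[OF bA(1)] b'(2) by simp
        then show False using B(1) b'(1) unfolding M.algebraically_independent_def by (auto simp: over_def)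
      qed
    next
      fix a assume a: "a \<in> carrier G"
      then have "\<psi> a \<in> A" using \<phi>\<psi>(2) by (simp add: G(1))
      then have "(M.algebraic over E) (\<psi> a)" by (simp add: A_def)
      then have "(ring.algebraic ?MA over E) (\<psi> a)"
        unfolding M.algebraic_consistent[OF subfieldE(1)[OF A]] .
      moreover have "subfield E ?MA"
      proof (rule ring.subfield_iff(1)[OF M.subring_is_ring[OF subfieldE(1)[OF A]]])
        show "field (?MA\<lparr>carrier := E\<rparr>)" using M.subfield_iff(2)[OF E] by simp
      qed (use EA in simp)
      ultimately have "(G.algebraic over (\<phi> ` E)) (\<phi> (\<psi> a))"
        using algebraic_hom[OF \<phi>hom MA fG, of E "\<psi> a"] \<open>\<psi> a \<in> A\<close> by simp
      moreover have "\<phi> ` E = generate_field G (\<phi> ` (C \<union> B))"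
      proof -
        have "C \<union> B \<subseteq> A" using CBA by simp
        have "\<phi> ` E = \<phi> ` \<psi> ` generate_field G (\<phi> ` (C \<union> B))" unfolding gen[OF \<open>C \<union> B \<subseteq> A\<close>] E_def ..
        also have "\<dots> = generate_field G (\<phi> ` (C \<union> B))"
          using genc[OF \<open>C \<union> B \<subseteq> A\<close>] \<phi>\<psi>(1) unfolding G(1) by (force simp: image_image)
        finally show ?thesis .
      qed
      ultimately show "G.algebraic (generate_field G (\<phi> ` C \<union> \<phi> ` B)) a"
        using a \<phi>\<psi>(1) by (simp add: over_def image_Un G(1))
    qed
    have "(card_of (\<phi> ` B), card_of B) \<in> ordIso"
      by (rule ordIso_symmetric, rule card_of_ordIsoI[of \<phi>])
        (use \<phi> CBA(2) in \<open>auto simp: bij_betw_def intro: inj_on_subset\<close>)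
    then show "(card_of (\<phi> ` B), \<kappa>) \<in> ordIso" using B(2) by (rule ordIso_transitive)
  qed
  ultimately show ?thesis by blast
qed

section \<open>Finite fields\<close>

text \<open>Simplification would unfold the recursive definitions of these operations at every occurrence.\<close>

context ring
begin

declare poly_add.simps [simp del] poly_mult.simps [simp del]

end

lemma (in ring) eval_poly_add_const:
  assumes "set p \<subseteq> carrier R" "c \<in> carrier R" "t \<in> carrier R"
  shows "eval (poly_add p [c]) t = eval p t \<oplus> c"
  using eval_poly_add[of p "[c]" t] assms by simp

lemma (in ring) card_of_dimension:
  assumes K: "subfield K R" "finite K" and "dimension n K E"
  shows "finite E \<and> card E = card K ^ n"
  using assms(3,1,2)
proof (induction rule: dimension.induct)
  case zero_dim
  show ?case by simp
next
  case (Suc_dim v E n K)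
  then have EK: "finite E" "card E = card K ^ n" by auto
  note K = Suc_dim.prems(1)
  note E = space_subgroup_props[OF K Suc_dim.hyps(3)]
  have Kc: "k \<in> carrier R" if "k \<in> K" for k using subfieldE(3)[OF K] that by blast
  have Ec: "e \<in> carrier R" if "e \<in> E" for e using E(1) that by blast
  let ?f = "\<lambda>(k, e). k \<otimes> v \<oplus> e"
  have "inj_on ?f (K \<times> E)"
  proof (rule inj_onI, clarify)
    fix k e k' e' assume A: "k \<in> K" "e \<in> E" "k' \<in> K" "e' \<in> E" "k \<otimes> v \<oplus> e = k' \<otimes> v \<oplus> e'"
    note c = Kc[OF A(1)] Kc[OF A(3)] Ec[OF A(2)] Ec[OF A(4)] Suc_dim.hyps(1)
    have "(k \<ominus> k') \<otimes> v = (k \<otimes> v \<oplus> e) \<ominus> (k' \<otimes> v \<oplus> e')  \<oplus> (e' \<ominus> e)" using c by algebra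
    then have d: "(k \<ominus> k') \<otimes> v = e' \<ominus> e" using A(5) c by (simp add: a_minus_def r_neg)
    have eE: "e' \<ominus> e \<in> E" using E(3,4) A(2,4) by (simp add: a_minus_def)
    have "k = k'"
    proof (rule ccontr)
      assume "k \<noteq> k'"
      then have nz: "k \<ominus> k' \<in> K - {\<zero>}"
        using A(1,3) c subringE(5,7)[OF subfieldE(1)[OF K]] by (simp add: a_minus_def) (metis a_minus_def r_right_minus_eq)
      then have i: "inv (k \<ominus> k') \<in> K" "inv (k \<ominus> k') \<otimes> (k \<ominus> k') = \<one>" using subfield_m_inv[OF K] by auto
      have "inv (k \<ominus> k') \<otimes> ((k \<ominus> k') \<otimes> v) = v"
        using i Kc[OF i(1)] c by (simp add: m_assoc[symmetric])
      then have "v \<in> E" using E(5)[OF i(1) eE] d by simp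
      then show False using Suc_dim.hyps(2) by simp
    qed
    moreover have "e = e'"
      using A(5) \<open>k = k'\<close> add.l_cancel[of "k' \<otimes> v" e e'] m_closed[OF c(2,5)] c(3,4) by simp
    ultimately show "k = k' \<and> e = e'" by simp
  qed
  then have "card (?f ` (K \<times> E)) = card (K \<times> E)" by (rule card_image)
  moreover have "finite (?f ` (K \<times> E))" using EK(1) Suc_dim.prems(2) by simp
  moreover have "?f ` (K \<times> E) = line_extension K v E"
    unfolding set_eq_iff line_extension_mem_iff image_iff by auto
  ultimately have "card (line_extension K v E) = card (K \<times> E)" "finite (line_extension K v E)" by simp_all
  then show ?case using EK by (simp add: card_cartesian_product)
qed

context field
begin

text \<open>A polynomial list of length at most \<open>n\<close> that vanishes on \<open>n\<close> points vanishes everywhere.\<close>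

lemma eval_zero_of_many_roots:
  assumes p: "set p \<subseteq> carrier R" "length p \<le> n" and S: "S \<subseteq> carrier R" "finite S" "n \<le> card S"
    and z: "\<And>s. s \<in> S \<Longrightarrow> eval p s = \<zero>" and t: "t \<in> carrier R" and n: "n > 0"
  shows "eval p t = \<zero>"
proof (cases "normalize p = []")
  case True
  then show ?thesis using eval_normalize[OF p(1) t] by simp
next
  case False
  let ?q = "normalize p"
  have q: "?q \<in> carrier (poly_ring R)"
    using normalize_gives_polynomial[OF p(1)] univ_poly_carrier by blast
  have "S \<subseteq> {x. is_root ?q x}"
    using S(1) z eval_normalize[OF p(1)] False by (auto simp: is_root_def)
  also have "\<dots> = set_mset (roots ?q)" using roots_mem_iff_is_root[OF q] by auto
  finally have "card S \<le> card (set_mset (roots ?q))" by (intro card_mono) auto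
  also have "\<dots> \<le> size (roots ?q)"
    unfolding size_multiset_overloaded_eq card_eq_sum by (intro sum_mono) (simp add: Suc_le_eq)
  also have "\<dots> \<le> degree ?q" by (rule size_roots_le_degree[OF q])
  also have "\<dots> < n" using normalize_length_le[of p] p(2) n False by (cases "normalize p") auto
  finally show ?thesis using S(3) by simp
qed

text \<open>\<open>(t + c)\<^sup>n - t\<^sup>n\<close> is a polynomial of degree less than \<open>n\<close> in \<open>t\<close>.\<close>

lemma pow_shift:
  assumes c: "c \<in> carrier R"
  shows "\<exists>p. set p \<subseteq> carrier R \<and> length p \<le> n \<and>
    (\<forall>t \<in> carrier R. (t \<oplus> c) [^] n = t [^] n \<oplus> eval p t)"
proof (induction n)
  case 0
  show ?case by (intro exI[of _ "[]"]) auto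
next
  case (Suc n)
  then obtain p where p: "set p \<subseteq> carrier R" "length p \<le> n"
    "\<And>t. t \<in> carrier R \<Longrightarrow> (t \<oplus> c) [^] n = t [^] n \<oplus> eval p t" by blast
  let ?q1 = "p @ [\<zero>]" and ?q2 = "map (\<lambda>b. c \<otimes> b) p" and ?q3 = "monom c n"
  let ?q = "poly_add (poly_add ?q1 ?q2) ?q3"
  have s: "set ?q1 \<subseteq> carrier R" "set ?q2 \<subseteq> carrier R" "set ?q3 \<subseteq> carrier R"
    using p(1) c monom_in_carrier[of c n] by auto
  have s12: "set (poly_add ?q1 ?q2) \<subseteq> carrier R" by (rule poly_add_in_carrier[OF s(1,2)])
  show ?case
  proof (intro exI[of _ ?q] conjI ballI)
    show "set ?q \<subseteq> carrier R" by (rule poly_add_in_carrier[OF s12 s(3)])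
    have "length (poly_add ?q1 ?q2) \<le> Suc n"
      using poly_add_length_le[of ?q1 ?q2] p(2) by simp
    then show "length ?q \<le> Suc n"
      using poly_add_length_le[of "poly_add ?q1 ?q2" ?q3] by (simp add: monom_def)
    fix t assume t: "t \<in> carrier R"
    have e: "eval p t \<in> carrier R" by (rule eval_in_carrier[OF p(1) t])
    have "eval ?q t = eval p t \<otimes> t \<oplus> c \<otimes> eval p t \<oplus> c \<otimes> t [^] n"
      using eval_poly_add[OF s12 s(3) t] eval_poly_add[OF s(1,2) t] eval_append_aux[OF p(1) zero_closed t]
        eval_scalar[OF p(1) c t] eval_monom[OF c t] e t by simp
    then have "t [^] Suc n \<oplus> eval ?q t = t [^] n \<otimes> t \<oplus> (eval p t \<otimes> t \<oplus> c \<otimes> eval p t \<oplus> c \<otimes> t [^] n)" by simp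
    also have "\<dots> = (t [^] n \<oplus> eval p t) \<otimes> (t \<oplus> c)"
    proof -
      have "x \<otimes> t \<oplus> (y \<otimes> t \<oplus> c \<otimes> y \<oplus> c \<otimes> x) = (x \<oplus> y) \<otimes> (t \<oplus> c)"
        if "x \<in> carrier R" "y \<in> carrier R" for x y using that c t by algebra
      then show ?thesis using e t by simp
    qed
    finally show "(t \<oplus> c) [^] Suc n = t [^] Suc n \<oplus> eval ?q t" using p(3)[OF t] by simp
  qed
qed

lemma finite_subfield_pow_card:
  assumes F: "subfield F R" "finite F" and x: "x \<in> F"
  shows "x [^] card F = x"
proof -
  interpret F: field "R\<lparr>carrier := F\<rparr>" by (rule subfield_iff(2)[OF F(1)])
  interpret G: group "Multiplicative_Group.mult_of (R\<lparr>carrier := F\<rparr>)" by (rule F.field_mult_group)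
  have pow: "y [^]\<^bsub>R\<lparr>carrier := F\<rparr>\<^esub> n = y [^] n" for y and n :: nat by (simp add: nat_pow_def)
  have "card F > 0" using F x card_gt_0_iff by blast
  show ?thesis
  proof (cases "x = \<zero>")
    case True
    then show ?thesis using \<open>card F > 0\<close> nat_pow_zero[of "card F"] by simp
  next
    case False
    then have "x [^]\<^bsub>Multiplicative_Group.mult_of (R\<lparr>carrier := F\<rparr>)\<^esub> order (Multiplicative_Group.mult_of (R\<lparr>carrier := F\<rparr>)) = \<one>"
      using G.pow_order_eq_1[of x] x by simp
    then have "x [^] (card F - 1) = \<one>"
      using F(2) subringE(2)[OF subfieldE(1)[OF F(1)]] by (simp add: card_Diff_singleton Multiplicative_Group.nat_pow_mult_of pow F.order_mult_of order_def)
    moreover have "x \<in> carrier R" using x subfieldE(3)[OF F(1)] by blast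
    ultimately have "x [^] (Suc (card F - 1)) = x" by simp
    then show ?thesis using \<open>card F > 0\<close> by simp
  qed
qed

lemma finite_subfield_card_ge_2:
  assumes F: "subfield F R" "finite F"
  shows "card F \<ge> 2"
proof -
  have "{\<zero>, \<one>} \<subseteq> F" using subringE(2,3)[OF subfieldE(1)[OF F(1)]] by auto
  then have "card {\<zero>, \<one>} \<le> card F" by (rule card_mono[OF F(2)])
  then show ?thesis by simp
qed

text \<open>The Frobenius map of a finite subfield with \<open>u\<close> elements is additive on every extension:
  the difference of both sides is a polynomial of degree less than \<open>u\<close> in one of the summands, and it
  vanishes on the subfield.\<close>

lemma frobenius_add:
  assumes F: "subfield F R" "finite F" and x: "x \<in> carrier R" and y: "y \<in> carrier R"
  shows "(x \<oplus> y) [^] card F = x [^] card F \<oplus> y [^] card F"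
proof -
  let ?u = "card F"
  have u: "?u \<ge> 2" by (rule finite_subfield_card_ge_2[OF F])
  have Fc: "F \<subseteq> carrier R" by (rule subfieldE(3)[OF F(1)])
  note pw = finite_subfield_pow_card[OF F]
  have add: "a \<oplus> b \<in> F" if "a \<in> F" "b \<in> F" for a b
    using subringE(7)[OF subfieldE(1)[OF F(1)]] that by blast
  have cancel: "e = d" if "a \<in> carrier R" "d \<in> carrier R" "e \<in> carrier R" "a \<oplus> d = a \<oplus> e" for a d e
    using that by (metis add.l_cancel)
  have ext: "eval p t = d"
    if p: "set p \<subseteq> carrier R" "length p \<le> ?u" and d: "d \<in> carrier R"
      and z: "\<And>s. s \<in> F \<Longrightarrow> eval p s = d" and t: "t \<in> carrier R" for p d t
  proof -
    let ?q = "poly_add p [\<ominus> d]"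
    have s: "set ?q \<subseteq> carrier R" using poly_add_in_carrier[OF p(1), of "[\<ominus> d]"] d by simp
    have l: "length ?q \<le> ?u" using poly_add_length_le[of p "[\<ominus> d]"] p(2) u by simp
    have e: "eval ?q s = eval p s \<oplus> \<ominus> d" if "s \<in> carrier R" for s
      using eval_poly_add_const[OF p(1) _ that, of "\<ominus> d"] d by simp
    have "eval ?q t = \<zero>"
    proof (rule eval_zero_of_many_roots[OF s l Fc F(2) order_refl _ t])
      show "eval ?q s = \<zero>" if "s \<in> F" for s using e[of s] z[OF that] that Fc d by (auto simp: r_neg)
    qed (use u in simp)
    then have "eval p t \<oplus> \<ominus> d = \<zero>" using e[OF t] by simp
    then show ?thesis using d eval_in_carrier[OF p(1) t] by (metis a_minus_def r_right_minus_eq)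
  qed
  have 1: "(z \<oplus> b) [^] ?u = z [^] ?u \<oplus> b" if b: "b \<in> F" and z: "z \<in> carrier R" for b z
  proof -
    obtain p where p: "set p \<subseteq> carrier R" "length p \<le> ?u"
      "\<And>t. t \<in> carrier R \<Longrightarrow> (t \<oplus> b) [^] ?u = t [^] ?u \<oplus> eval p t"
      using pow_shift[of b ?u] b Fc by blast
    have "eval p s = b" if "s \<in> F" for s
    proof (rule cancel)
      show "s \<oplus> b = s \<oplus> eval p s" using p(3)[of s] pw[OF that] pw[OF add[OF that b]] that Fc by auto
    qed (use that b Fc eval_in_carrier[OF p(1)] in auto)
    then have "eval p z = b" using ext[OF p(1,2) _ _ z] b Fc by blast
    then show ?thesis using p(3)[OF z] by simp
  qed
  obtain p where p: "set p \<subseteq> carrier R" "length p \<le> ?u"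
    "\<And>t. t \<in> carrier R \<Longrightarrow> (t \<oplus> y) [^] ?u = t [^] ?u \<oplus> eval p t"
    using pow_shift[OF y, of ?u] by blast
  have "eval p s = y [^] ?u" if "s \<in> F" for s
  proof (rule cancel)
    have sc: "s \<in> carrier R" using that Fc by blast
    have "s \<oplus> eval p s = (y \<oplus> s) [^] ?u" using p(3)[OF sc] pw[OF that] a_comm[OF sc y] by simp
    also have "\<dots> = s \<oplus> y [^] ?u" using 1[OF that y] a_comm[OF sc, of "y [^] ?u"] y by simp
    finally show "s \<oplus> y [^] ?u = s \<oplus> eval p s" by simp
  qed (use that Fc y eval_in_carrier[OF p(1)] in auto)
  then have "eval p x = y [^] ?u" using ext[OF p(1,2) _ _ x] y by simp
  then show ?thesis using p(3)[OF x] by simp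
qed

lemma frobenius_pow_add:
  assumes F: "subfield F R" "finite F" and "x \<in> carrier R" "y \<in> carrier R"
  shows "(x \<oplus> y) [^] (card F ^ n) = x [^] (card F ^ n) \<oplus> y [^] (card F ^ n)"
proof (induction n)
  case (Suc n)
  have p: "z [^] (card F ^ Suc n) = (z [^] (card F ^ n)) [^] card F" if "z \<in> carrier R" for z
    using that by (simp add: nat_pow_pow mult.commute)
  show ?case
    unfolding p[OF assms(3)] p[OF assms(4)] p[OF a_closed[OF assms(3,4)]] Suc
    by (rule frobenius_add[OF F]) (use assms(3,4) in auto)
qed (use assms in simp)

text \<open>The fixed points of \<open>x \<mapsto> x\<^sup>m\<close>. If \<open>m = u\<^sup>n\<close>, where \<open>u\<close> is the order of a finite subfield, this is the
  extension of degree \<open>n\<close> of that subfield, provided that the ambient field is large enough.\<close>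

definition frobenius_fixed :: "nat \<Rightarrow> 'a set" where
  "frobenius_fixed m = {x \<in> carrier R. x [^] m = x}"

lemma subfield_frobenius_fixed:
  assumes F: "subfield F R" "finite F"
  shows "subfield (frobenius_fixed (card F ^ n)) R"
proof -
  let ?m = "card F ^ n"
  have m: "?m > 0" using finite_subfield_card_ge_2[OF F] by simp
  have add: "(x \<oplus> y) [^] ?m = x [^] ?m \<oplus> y [^] ?m" if "x \<in> carrier R" "y \<in> carrier R" for x y
    by (rule frobenius_pow_add[OF F that])
  show ?thesis
  proof (rule subfieldI'[OF subringI])
    show "frobenius_fixed ?m \<subseteq> carrier R" "\<one> \<in> frobenius_fixed ?m"
      by (auto simp: frobenius_fixed_def)
    show "\<ominus> x \<in> frobenius_fixed ?m" if "x \<in> frobenius_fixed ?m" for x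
    proof -
      have x: "x \<in> carrier R" "x [^] ?m = x" using that by (auto simp: frobenius_fixed_def)
      have "\<zero> = (x \<oplus> \<ominus> x) [^] ?m" using x(1) m by (simp add: r_neg nat_pow_zero)
      also have "\<dots> = x \<oplus> (\<ominus> x) [^] ?m" using add[of x "\<ominus> x"] x by simp
      finally have "(\<ominus> x) [^] ?m \<oplus> x = \<zero>" using x(1) a_comm[of "(\<ominus> x) [^] ?m" x] by simp
      then have "\<ominus> x = (\<ominus> x) [^] ?m" using x(1) by (intro minus_equality) auto
      then show ?thesis using x(1) by (simp add: frobenius_fixed_def)
    qed
    show "x \<oplus> y \<in> frobenius_fixed ?m" "x \<otimes> y \<in> frobenius_fixed ?m"
      if "x \<in> frobenius_fixed ?m" "y \<in> frobenius_fixed ?m" for x y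
      using that add[of x y] by (auto simp: frobenius_fixed_def nat_pow_distrib)
    show "inv x \<in> frobenius_fixed ?m" if "x \<in> frobenius_fixed ?m - {\<zero>}" for x
    proof -
      have x: "x \<in> carrier R" "x [^] ?m = x" "x \<in> Units R" using that field_Units by (auto simp: frobenius_fixed_def)
      have "x \<otimes> (inv x) [^] ?m = x [^] ?m \<otimes> (inv x) [^] ?m" by (simp only: x(2))
      also have "\<dots> = (x \<otimes> inv x) [^] ?m" using x(1,3) by (simp only: nat_pow_distrib Units_inv_closed)
      also have "\<dots> = \<one>" using x(3) by simp
      finally have "x \<otimes> (inv x) [^] ?m = \<one>" .
      then have "(inv x) [^] ?m = inv x" using x comm_inv_char[of x "(inv x) [^] ?m"] by simp
      then show ?thesis using x by (simp add: frobenius_fixed_def)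
    qed
  qed
qed

lemma frobenius_fixed_mono:
  assumes "x \<in> frobenius_fixed (u ^ n)"
  shows "x \<in> frobenius_fixed (u ^ (n * k))"
proof (induction k)
  case (Suc k)
  have "x \<in> carrier R" using assms by (simp add: frobenius_fixed_def)
  then have "(x [^] (u ^ n)) [^] (u ^ (n * k)) = x [^] (u ^ n * u ^ (n * k))" by (rule nat_pow_pow)
  also have "u ^ n * u ^ (n * k) = u ^ (n * Suc k)" by (simp add: power_add)
  finally show ?case using Suc assms by (simp add: frobenius_fixed_def)
qed (use assms in \<open>auto simp: frobenius_fixed_def\<close>)

lemma pow_minus_var:
  assumes m: "m \<ge> 2"
  defines "p \<equiv> poly_add (monom \<one> m) [\<ominus> \<one>, \<zero>]"
  shows "p \<in> carrier (poly_ring R)" "degree p = m" "\<And>x. x \<in> carrier R \<Longrightarrow> eval p x = x [^] m \<ominus> x"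
    "\<And>x. is_root p x \<longleftrightarrow> x \<in> frobenius_fixed m"
proof -
  have m1: "monom \<one> m \<in> carrier (poly_ring R)" "[\<ominus> \<one>, \<zero>] \<in> carrier (poly_ring R)"
    by (auto simp: univ_poly_carrier[symmetric] polynomial_def monom_def)
  have s: "set (monom \<one> m) \<subseteq> carrier R" "set [\<ominus> \<one>, \<zero>] \<subseteq> carrier R" using monom_in_carrier[of \<one> m] by auto
  show p: "p \<in> carrier (poly_ring R)"
    unfolding p_def univ_poly_carrier[symmetric] by (rule poly_add_is_polynomial[OF carrier_is_subring s])
  have "degree (monom \<one> m) = m" by (simp add: monom_def)
  then show d: "degree p = m"
    unfolding p_def using poly_add_degree_eq[OF carrier_is_subring, of "monom \<one> m" "[\<ominus> \<one>, \<zero>]"] m1 m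
    by (simp add: univ_poly_carrier)
  show e: "eval p x = x [^] m \<ominus> x" if "x \<in> carrier R" for x
    unfolding p_def using eval_poly_add[OF s that] eval_monom[of \<one> x m] that by (simp add: a_minus_def l_minus)
  have "p \<noteq> []" using d m by auto
  then show "is_root p x \<longleftrightarrow> x \<in> frobenius_fixed m" for x
    unfolding is_root_def frobenius_fixed_def using e by auto
qed

lemma card_frobenius_fixed_le:
  assumes m: "m \<ge> 2"
  shows "finite (frobenius_fixed m)" "card (frobenius_fixed m) \<le> m"
proof -
  let ?p = "poly_add (monom \<one> m) [\<ominus> \<one>, \<zero>]"
  note p = pow_minus_var[OF m]
  have eq: "frobenius_fixed m = set_mset (roots ?p)"
    using p(4) roots_mem_iff_is_root[OF p(1)] by blast
  show "finite (frobenius_fixed m)" unfolding eq by simp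
  have "card (set_mset (roots ?p)) \<le> size (roots ?p)"
    unfolding size_multiset_overloaded_eq card_eq_sum by (intro sum_mono) (simp add: Suc_le_eq)
  also have "\<dots> \<le> m" using size_roots_le_degree[OF p(1)] p(2) by simp
  finally show "card (frobenius_fixed m) \<le> m" unfolding eq .
qed

end

text \<open>The polynomial \<open>X\<^sup>k - X + 1\<close> has no root in a field with \<open>k\<close> elements.\<close>

lemma (in algebraically_closed) infinite_carrier: "infinite (carrier L)"
proof
  assume fin: "finite (carrier L)"
  let ?k = "card (carrier L)"
  have F: "subfield (carrier L) L" by (rule carrier_is_subfield)
  have k: "?k \<ge> 2" by (rule finite_subfield_card_ge_2[OF F fin])
  let ?r = "poly_add (monom \<one> ?k) [\<ominus> \<one>, \<zero>]"
  note p0 = pow_minus_var[OF k]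
  let ?p = "poly_add ?r [\<one>]"
  have P0: "polynomial (carrier L) ?r" using p0(1) by (simp add: univ_poly_carrier)
  have P1: "polynomial (carrier L) [\<one>]" by (simp add: polynomial_def)
  have p: "?p \<in> carrier (poly_ring L)"
    unfolding univ_poly_carrier[symmetric] by (rule poly_add_closed[OF carrier_is_subring P0 P1])
  have "degree ?p = ?k" using poly_add_degree_eq[OF carrier_is_subring P0 P1] p0(2) k by simp
  then have "size (roots ?p) = ?k" using roots_over_carrier[OF p] by (simp add: splitted_def)
  then obtain x where "x \<in># roots ?p" using k by (metis multiset_nonemptyE not_numeral_le_zero size_empty)
  then have x: "x \<in> carrier L" "eval ?p x = \<zero>" using roots_mem_iff_is_root[OF p] by (auto simp: is_root_def)
  have "set ?r \<subseteq> carrier L" using P0 polynomial_incl by blast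
  then have "eval ?p x = (x [^] ?k \<ominus> x) \<oplus> \<one>" using eval_poly_add_const[OF _ _ x(1)] p0(3)[OF x(1)] by simp
  also have "x [^] ?k \<ominus> x = \<zero>" using finite_subfield_pow_card[OF F fin x(1)] x(1) by simp
  finally show False using x(2) by simp
qed

lemma (in algebraically_closed) ex_nth_root:
  assumes c: "c \<in> carrier L" and n: "n > (0::nat)"
  obtains y where "y \<in> carrier L" "y [^] n = c"
proof -
  let ?p = "poly_add (monom \<one> n) [\<ominus> c]"
  have s: "set (monom \<one> n) \<subseteq> carrier L" "set [\<ominus> c] \<subseteq> carrier L" using c monom_in_carrier[of \<one> n] by auto
  have p: "?p \<in> carrier (poly_ring L)"
    unfolding univ_poly_carrier[symmetric] by (rule poly_add_is_polynomial[OF carrier_is_subring s])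
  have "degree ?p = n"
  proof (cases "c = \<zero>")
    case True
    have "polynomial (carrier L) (monom \<one> n)" by (rule monom_is_polynomial[OF carrier_is_subring]) simp
    then have "normalize (monom \<one> n) = monom \<one> n" by (rule normalize_polynomial)
    moreover have "?p = normalize (monom \<one> n)"
      using True poly_add_replicate_zero'(1)[OF s(1), of 1] by simp
    ultimately show ?thesis by (simp add: monom_def)
  next
    case False
    have "polynomial (carrier L) (monom \<one> n)" by (rule monom_is_polynomial[OF carrier_is_subring]) simp
    moreover have "polynomial (carrier L) [\<ominus> c]" using c False by (auto simp: polynomial_def)
    ultimately show ?thesis using poly_add_degree_eq[OF carrier_is_subring, of "monom \<one> n" "[\<ominus> c]"] n by (simp add: monom_def)
  qed
  then have "size (roots ?p) = n" using roots_over_carrier[OF p] by (simp add: splitted_def)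
  then obtain y where "y \<in># roots ?p" using n by (metis multiset_nonemptyE not_gr_zero size_empty)
  then have y: "y \<in> carrier L" "eval ?p y = \<zero>" using roots_mem_iff_is_root[OF p] by (auto simp: is_root_def)
  have "eval ?p y = y [^] n \<oplus> \<ominus> c" using eval_poly_add_const[OF s(1) _ y(1)] eval_monom[of \<one> y n] c y by simp
  then have "y [^] n = c" using y c by (metis a_minus_def nat_pow_closed r_right_minus_eq)
  then show ?thesis using y(1) that by blast
qed

text \<open>All roots \<open>a\<close> of \<open>X\<^sup>m - X\<close> are simple when \<open>m\<close> is a power of the order of a finite
  subfield: the cofactor of \<open>X - a\<close> agrees with \<open>(X - a)\<^sup>m\<^sup>-\<^sup>1 - 1\<close>.\<close>

lemma (in algebraically_closed) card_frobenius_fixed: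
  assumes F: "subfield F L" "finite F" and n: "n > 0"
  shows "card (frobenius_fixed (card F ^ n)) = card F ^ n"
proof -
  define m where "m = card F ^ n"
  have m: "m \<ge> 2" using finite_subfield_card_ge_2[OF F] n unfolding m_def
    by (metis le_trans self_le_power Suc_leI gr_implies_not0 neq0_conv numeral_2_eq_2 le_SucI Suc_le_mono zero_less_numeral le_numeral_extra(4) one_le_numeral)
  let ?p = "poly_add (monom \<one> m) [\<ominus> \<one>, \<zero>]"
  note p = pow_minus_var[OF m]
  interpret UP: domain "poly_ring L" by (rule univ_poly_is_domain[OF carrier_is_subring])
  have simple: "alg_mult ?p a \<le> 1" for a
  proof (rule ccontr)
    assume 1: "\<not> alg_mult ?p a \<le> 1"
    then have a: "is_root ?p a" using alg_mult_gt_zero_iff_is_root[OF p(1), of a] by simp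
    then have ac: "a \<in> carrier L" "a [^] m = a" using p(4)[of a] by (auto simp: frobenius_fixed_def)
    let ?d = "[\<one>, \<ominus> a]"
    have d: "?d \<in> carrier (poly_ring L)" using ac by (auto simp: univ_poly_carrier[symmetric] polynomial_def)
    have "?d [^]\<^bsub>poly_ring L\<^esub> (2::nat) pdivides ?p"
      using le_alg_mult_imp_pdivides[OF ac(1) p(1), of 2] 1 by simp
    then obtain g where g: "g \<in> carrier (poly_ring L)" "?p = ?d [^]\<^bsub>poly_ring L\<^esub> (2::nat) \<otimes>\<^bsub>poly_ring L\<^esub> g"
      unfolding pdivides_def factor_def by blast
    define h where "h = ?d \<otimes>\<^bsub>poly_ring L\<^esub> g"
    have h: "h \<in> carrier (poly_ring L)" using d g by (simp add: h_def)
    have ph: "?p = ?d \<otimes>\<^bsub>poly_ring L\<^esub> h" using g d by (simp add: h_def numeral_2_eq_2 UP.m_assoc)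
    have dR: "set ?d \<subseteq> carrier L" and gR: "set g \<subseteq> carrier L" and hR: "set h \<subseteq> carrier L"
      using d g(1) h polynomial_incl univ_poly_carrier by blast+
    have ev_d: "eval ?d t = t \<ominus> a" if "t \<in> carrier L" for t using that ac by (simp add: a_minus_def)
    have "eval h a = \<zero>"
    proof -
      have "eval ?d a = \<zero>" using ev_d[OF ac(1)] r_right_minus_eq[OF ac(1,1)] by simp
      then show ?thesis
        using eval_poly_mult[OF dR gR ac(1)] eval_in_carrier[OF gR ac(1)] by (simp only: h_def univ_poly_mult l_null)
    qed
    obtain r where r: "set r \<subseteq> carrier L" "length r \<le> m - 1"
      "\<And>t. t \<in> carrier L \<Longrightarrow> (t \<oplus> \<ominus> a) [^] (m - 1) = t [^] (m - 1) \<oplus> eval r t"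
      using pow_shift[of "\<ominus> a" "m - 1"] ac(1) by auto
    let ?q = "poly_add (poly_add (monom \<one> (m - 1)) r) [\<ominus> \<one>]"
    \<comment> \<open>\<open>?q\<close> is \<open>(X - a)\<^sup>m\<^sup>-\<^sup>1 - 1\<close>, and its difference \<open>?z\<close> to the cofactor \<open>h\<close> vanishes away from \<open>a\<close>.\<close>
    let ?z = "poly_add ?q (map (\<lambda>b. \<ominus> \<one> \<otimes> b) h)"
    have s: "set (monom \<one> (m - 1)) \<subseteq> carrier L" by (rule monom_in_carrier) simp
    have s1: "set (poly_add (monom \<one> (m - 1)) r) \<subseteq> carrier L" by (rule poly_add_in_carrier[OF s r(1)])
    have sq: "set ?q \<subseteq> carrier L" by (rule poly_add_in_carrier[OF s1]) simp
    have sh: "set (map (\<lambda>b. \<ominus> \<one> \<otimes> b) h) \<subseteq> carrier L" using hR by auto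
    have sz: "set ?z \<subseteq> carrier L" by (rule poly_add_in_carrier[OF sq sh])
    have evq: "eval ?q t = (t \<ominus> a) [^] (m - 1) \<oplus> \<ominus> \<one>" if "t \<in> carrier L" for t
      using eval_poly_add_const[OF s1 _ that, of "\<ominus> \<one>"] eval_poly_add[OF s r(1) that] eval_monom[of \<one> t "m - 1"] r(3)[OF that] that
      by (simp add: a_minus_def)
    have evz: "eval ?z t = eval ?q t \<ominus> eval h t" if "t \<in> carrier L" for t
      using eval_poly_add[OF sq sh that] eval_scalar[OF hR _ that, of "\<ominus> \<one>"] eval_in_carrier[OF hR that]
      by (simp add: a_minus_def l_minus)
    have z0: "eval ?z t = \<zero>" if t: "t \<in> carrier L - {a}" for t
    proof -
      have tc: "t \<in> carrier L" "t \<ominus> a \<in> carrier L" "t \<ominus> a \<noteq> \<zero>" using t ac(1) by auto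
      have na: "(\<ominus> a) [^] m = \<ominus> a"
        using subringE(5)[OF subfieldE(1)[OF subfield_frobenius_fixed[OF F, of n]], of a] ac
        by (simp add: m_def frobenius_fixed_def)
      have "(t \<ominus> a) \<otimes> eval h t = eval ?p t"
        unfolding ph using eval_poly_mult[OF dR hR tc(1)] ev_d[OF tc(1)] by (simp add: univ_poly_mult)
      also have "\<dots> = t [^] m \<ominus> t" by (rule p(3)[OF tc(1)])
      also have "\<dots> = (t [^] m \<oplus> \<ominus> a) \<oplus> \<ominus> (t \<oplus> \<ominus> a)"
      proof -
        have "x \<ominus> t = (x \<oplus> \<ominus> a) \<oplus> \<ominus> (t \<oplus> \<ominus> a)" if "x \<in> carrier L" for x
          using that tc(1) ac(1) by algebra
        then show ?thesis using tc(1) by simp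
      qed
      also have "t [^] m \<oplus> \<ominus> a = (t \<ominus> a) [^] m"
        using frobenius_pow_add[OF F tc(1), of "\<ominus> a" n] ac(1) na by (simp add: a_minus_def m_def)
      also have "(t \<ominus> a) [^] m = (t \<ominus> a) \<otimes> (t \<ominus> a) [^] (m - 1)"
        using nat_pow_Suc2[OF tc(2), of "m - 1"] m by simp
      also have "\<dots> \<oplus> \<ominus> (t \<oplus> \<ominus> a) = (t \<ominus> a) \<otimes> ((t \<ominus> a) [^] (m - 1) \<oplus> \<ominus> \<one>)"
        using tc(2) by (simp add: r_distr r_minus a_minus_def)
      finally have "eval h t = (t \<ominus> a) [^] (m - 1) \<oplus> \<ominus> \<one>"
        using m_lcancel[OF tc(3,2)] eval_in_carrier[OF hR tc(1)] tc(2) by simp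
      then show ?thesis using evz[OF tc(1)] evq[OF tc(1)] tc(2) by simp
    qed
    obtain S where S: "S \<subseteq> carrier L - {a}" "finite S" "card S = Suc (length ?z)"
      using infinite_arbitrarily_large[of "carrier L - {a}" "Suc (length ?z)"] infinite_carrier by auto
    have "eval ?z a = \<zero>"
      by (rule eval_zero_of_many_roots[OF sz _ _ S(2) _ _ ac(1), of "Suc (length ?z)"]) (use S z0 in auto)
    moreover have "eval ?q a = \<ominus> \<one>"
    proof -
      have "a \<ominus> a = \<zero>" using r_right_minus_eq[OF ac(1,1)] by simp
      then show ?thesis using evq[OF ac(1)] m by (simp add: nat_pow_zero)
    qed
    ultimately have "\<ominus> \<one> = \<zero>" using evz[OF ac(1)] \<open>eval h a = \<zero>\<close> by (simp add: a_minus_def)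
    then show False by (metis a_inv_closed one_closed minus_minus minus_zero zero_not_one)
  qed
  have "m = size (roots ?p)" using roots_over_carrier[OF p(1)] p(2) by (simp add: splitted_def)
  also have "\<dots> = (\<Sum>x \<in> set_mset (roots ?p). count (roots ?p) x)" by (rule size_multiset_overloaded_eq)
  also have "\<dots> = (\<Sum>x \<in> set_mset (roots ?p). 1)"
  proof (rule sum.cong[OF refl])
    fix x assume "x \<in># roots ?p"
    then have "count (roots ?p) x > 0" by simp
    moreover have "count (roots ?p) x \<le> 1" using simple[of x] alg_mult_eq_count_roots[OF p(1)] by simp
    ultimately show "count (roots ?p) x = 1" by linarith
  qed
  also have "\<dots> = card (frobenius_fixed m)"
  proof -
    have "set_mset (roots ?p) = frobenius_fixed m" using p(4) roots_mem_iff_is_root[OF p(1)] by blast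
    then show ?thesis by simp
  qed
  finally show ?thesis by (simp add: m_def)
qed

section \<open>Irreducibility over extensions of finite fields\<close>

context field
begin

lemma card_of_finite_extension:
  assumes W: "subfield W R" and V: "subfield V R" and "W \<subseteq> V" "finite V"
  shows "\<exists>d. dimension d W V \<and> card V = card W ^ d"
proof -
  obtain Us where Us: "set Us = V" using finite_list[OF \<open>finite V\<close>] by blast
  have Vc: "set Us \<subseteq> carrier R" using subfieldE(3)[OF V] Us by simp
  have "subalgebra W V R"
    by (intro subalgebra.intro subalgebra_axioms.intro)
      (use subring.axioms(1)[OF subfieldE(1)[OF V]] subringE(6)[OF subfieldE(1)[OF V]] \<open>W \<subseteq> V\<close> in auto)
  then have "Span W Us \<subseteq> V" using subalgebra_Span_incl[OF W, of V Us] Us by simp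
  moreover have "V \<subseteq> Span W Us" using Span_base_incl[OF W Vc] Us by simp
  ultimately have "Span W Us = V" by blast
  then have "finite_dimension W V" using Span_finite_dimension[OF W Vc] by simp
  then obtain d where "dimension d W V" by (rule finite_dimensionE')
  then show ?thesis using card_of_dimension[OF W finite_subset[OF assms(3,4)]] by blast
qed

text \<open>Adjoining a root of an irreducible polynomial of degree \<open>n\<close> to a field with \<open>u\<close> elements gives a
  field with \<open>u\<^sup>n\<close> elements. All degrees of extensions of finite fields are computed by counting.\<close>

lemma simple_extension_root_irreducible:
  assumes F: "subfield F R" "finite F" and p: "p \<in> carrier (F[X])" "pirreducible F p"
    and a: "a \<in> carrier R" "eval p a = \<zero>"
  shows "subfield (simple_extension F a) R" "finite (simple_extension F a)"
    "card (simple_extension F a) = card F ^ degree p"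
proof -
  have "p \<noteq> []" using pirreducibleE(1)[OF subfieldE(1)[OF F(1)] p] .
  then have alg: "(algebraic over F) a" using algebraicI p(1) a(2) by blast
  show "subfield (simple_extension F a) R" using simple_extension_is_subfield[OF F(1) a(1)] alg by blast
  note I = IrrE[OF F(1) a(1) alg]
  have "Irr F a divides\<^bsub>F[X]\<^esub> p"
    using Irr_minimal[OF F(1) a(1) alg p(1) a(2)] pdivides_iff_shell[OF F(1) I(1) p(1)] by simp
  then have "Irr F a \<in> Units (F[X]) \<or> Irr F a \<sim>\<^bsub>F[X]\<^esub> p"
    by (rule divides_pirreducible_condition[OF p(2) I(1)])
  moreover have "Irr F a \<notin> Units (F[X])" by (rule pirreducibleE(2)[OF subfieldE(1)[OF F(1)] I(1,2)])
  ultimately have "length (Irr F a) = length p"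
    using associated_polynomials_imp_same_length[OF subfieldE(1)[OF F(1)] I(1) p(1)] by blast
  then show "finite (simple_extension F a)" "card (simple_extension F a) = card F ^ degree p"
    using card_of_dimension[OF F dimension_simple_extension[OF F(1) a(1) alg]] by auto
qed

end

lemma pirreducible_hom_image:
  assumes U: "field U" and M: "field M" and h: "h \<in> ring_hom U M"
    and p: "p \<in> carrier (poly_ring U)" "pirreducible\<^bsub>U\<^esub> (carrier U) p"
  shows "map h p \<in> carrier ((h ` carrier U)[X]\<^bsub>M\<^esub>)" "pirreducible\<^bsub>M\<^esub> (h ` carrier U) (map h p)"
proof -
  interpret U: field U by fact
  interpret M: field M by fact
  interpret h: ring_hom_ring U M h using ring_hom_ringI2[OF U.ring_axioms M.ring_axioms h] .
  have inj: "inj_on h (carrier U)" using h.img_is_subfield(1)[OF U.carrier_is_subfield] by simp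
  have hU: "subfield (h ` carrier U) M" using h.img_is_subfield(2)[OF U.carrier_is_subfield] by simp
  note sub = subfieldE(1)[OF hU]
  show hp: "map h p \<in> carrier ((h ` carrier U)[X]\<^bsub>M\<^esub>)"
    using h.subfield_polynomial_hom[OF U.carrier_is_subfield _ p(1)] by simp
  have deg: "degree p \<ge> 1" by (rule U.pirreducible_degree[OF U.carrier_is_subfield p])
  have lift: "\<exists>a \<in> carrier (poly_ring U). map h a = q" if "q \<in> carrier ((h ` carrier U)[X]\<^bsub>M\<^esub>)" for q
  proof (intro bexI)
    let ?a = "map (inv_into (carrier U) h) q"
    have q: "set q \<subseteq> h ` carrier U" "q = [] \<or> hd q \<noteq> \<zero>\<^bsub>M\<^esub>"
      using that by (auto simp: univ_poly_carrier[symmetric] polynomial_def)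
    then show 1: "map h ?a = q" by (auto simp: f_inv_into_f intro!: map_idI)
    have s: "set ?a \<subseteq> carrier U" using q(1) by (auto simp: inv_into_into)
    have "hd ?a \<noteq> \<zero>\<^bsub>U\<^esub>" if "q \<noteq> []"
    proof
      assume "hd ?a = \<zero>\<^bsub>U\<^esub>"
      then have "hd (map h ?a) = \<zero>\<^bsub>M\<^esub>" using that by (simp add: hd_map)
      then show False using q(2) that 1 by simp
    qed
    then show "?a \<in> carrier (poly_ring U)" using s by (auto simp: univ_poly_carrier[symmetric] polynomial_def)
  qed
  show "pirreducible\<^bsub>M\<^esub> (h ` carrier U) (map h p)"
  proof (rule M.pirreducibleI[OF sub hp])
    show "map h p \<noteq> []" using deg by auto
    show "map h p \<notin> Units ((h ` carrier U)[X]\<^bsub>M\<^esub>)" using deg M.univ_poly_units'[OF hU, of "map h p"] by auto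
    fix q r assume qr: "q \<in> carrier ((h ` carrier U)[X]\<^bsub>M\<^esub>)" "r \<in> carrier ((h ` carrier U)[X]\<^bsub>M\<^esub>)"
      and eq: "map h p = q \<otimes>\<^bsub>(h ` carrier U)[X]\<^bsub>M\<^esub>\<^esub> r"
    obtain a b where a: "a \<in> carrier (poly_ring U)" "map h a = q" and b: "b \<in> carrier (poly_ring U)" "map h b = r"
      using lift[OF qr(1)] lift[OF qr(2)] by blast
    have s: "set a \<subseteq> carrier U" "set b \<subseteq> carrier U" "set p \<subseteq> carrier U"
      using a(1) b(1) p(1) U.polynomial_incl univ_poly_carrier by blast+
    interpret UP: domain "poly_ring U" by (rule U.univ_poly_is_domain[OF U.carrier_is_subring])
    have ab: "a \<otimes>\<^bsub>poly_ring U\<^esub> b \<in> carrier (poly_ring U)" using a(1) b(1) by simp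
    then have sab: "set (a \<otimes>\<^bsub>poly_ring U\<^esub> b) \<subseteq> carrier U" using U.polynomial_incl univ_poly_carrier by blast
    have "map h (a \<otimes>\<^bsub>poly_ring U\<^esub> b) \<in> carrier ((h ` carrier U)[X]\<^bsub>M\<^esub>)"
      using h.subfield_polynomial_hom[OF U.carrier_is_subfield _ ab] by simp
    then have "polynomial\<^bsub>M\<^esub> (h ` carrier U) (map h (a \<otimes>\<^bsub>poly_ring U\<^esub> b))" unfolding univ_poly_carrier .
    then have "map h (a \<otimes>\<^bsub>poly_ring U\<^esub> b) = M.normalize (map h (a \<otimes>\<^bsub>poly_ring U\<^esub> b))"
      using M.normalize_polynomial by metis
    also have "\<dots> = M.poly_mult q r" using h.poly_mult_hom'[OF s(1,2)] a(2) b(2) by (simp add: univ_poly_mult)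
    also have "\<dots> = map h p" using eq by (simp add: univ_poly_mult)
    finally have "p = a \<otimes>\<^bsub>poly_ring U\<^esub> b"
      using inj_on_mapI[of h "{a \<otimes>\<^bsub>poly_ring U\<^esub> b, p}"] sab s(3) inj_on_subset[OF inj]
      by (metis inj_on_map_eq_map le_sup_iff)
    then have "a \<in> Units (poly_ring U) \<or> b \<in> Units (poly_ring U)"
      using U.pirreducibleE(3)[OF U.carrier_is_subring p a(1) b(1)] by simp
    then have "(a \<noteq> [] \<and> degree a = 0) \<or> (b \<noteq> [] \<and> degree b = 0)"
      unfolding U.univ_poly_units'[OF U.carrier_is_subfield] by blast
    then show "q \<in> Units ((h ` carrier U)[X]\<^bsub>M\<^esub>) \<or> r \<in> Units ((h ` carrier U)[X]\<^bsub>M\<^esub>)"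
      unfolding M.univ_poly_units'[OF hU] using qr a(2) b(2) by auto
  qed
qed

text \<open>The positive integers all of whose prime factors are in \<open>Q\<close>.\<close>

definition smooth_numbers :: "nat set \<Rightarrow> nat set" where
  "smooth_numbers Q = {n. n > 0 \<and> (\<forall>q. Factorial_Ring.prime q \<longrightarrow> q dvd n \<longrightarrow> q \<in> Q)}"

lemma smooth_numbers_mult: "m \<in> smooth_numbers Q \<Longrightarrow> n \<in> smooth_numbers Q \<Longrightarrow> m * n \<in> smooth_numbers Q"
  by (auto simp: smooth_numbers_def prime_dvd_mult_iff)

lemma one_smooth: "1 \<in> smooth_numbers Q"
  by (auto simp: smooth_numbers_def)

lemma prime_smooth:
  assumes "q \<in> Q" "Factorial_Ring.prime q"
  shows "q \<in> smooth_numbers Q"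
  using assms primes_dvd_imp_eq[of _ q] by (auto simp: smooth_numbers_def prime_gt_0_nat)

text \<open>The union of the extensions, inside the ambient field, of a subfield with \<open>u\<close> elements whose degree
  has all its prime factors in \<open>Q\<close>.\<close>

definition (in field) smooth_closure :: "nat set \<Rightarrow> nat \<Rightarrow> 'a set" where
  "smooth_closure Q u = (\<Union>n \<in> smooth_numbers Q. frobenius_fixed (u ^ n))"

lemma (in field) finite_subset_smooth_closure:
  assumes "finite A" "A \<subseteq> smooth_closure Q u"
  shows "\<exists>n \<in> smooth_numbers Q. A \<subseteq> frobenius_fixed (u ^ n)"
  using assms
proof (induction A rule: finite_induct)
  case empty
  show ?case using one_smooth by blast
next
  case (insert x A)
  then obtain n m where nm: "n \<in> smooth_numbers Q" "A \<subseteq> frobenius_fixed (u ^ n)"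
    "m \<in> smooth_numbers Q" "x \<in> frobenius_fixed (u ^ m)" by (auto simp: smooth_closure_def)
  have "insert x A \<subseteq> frobenius_fixed (u ^ (n * m))"
    using nm frobenius_fixed_mono[of _ u n m] frobenius_fixed_mono[of x u m n] by (auto simp: mult.commute)
  then show ?case using smooth_numbers_mult[OF nm(1,3)] by blast
qed

lemma (in field) subfield_smooth_closure:
  assumes F: "subfield F R" "finite F"
  shows "subfield (smooth_closure Q (card F)) R"
proof -
  let ?K = "smooth_closure Q (card F)"
  have L: "subfield (frobenius_fixed (card F ^ n)) R" for n by (rule subfield_frobenius_fixed[OF F])
  note LE = subringE[OF subfieldE(1)[OF L]]
  have incl: "frobenius_fixed (card F ^ n) \<subseteq> ?K" if "n \<in> smooth_numbers Q" for n
    using that by (auto simp: smooth_closure_def)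
  have two: "\<exists>n \<in> smooth_numbers Q. x \<in> frobenius_fixed (card F ^ n) \<and> y \<in> frobenius_fixed (card F ^ n)"
    if "x \<in> ?K" "y \<in> ?K" for x y
    using finite_subset_smooth_closure[of "{x, y}" Q "card F"] that by auto
  show ?thesis
  proof (rule subfieldI'[OF subringI])
    show "?K \<subseteq> carrier R" by (auto simp: smooth_closure_def frobenius_fixed_def)
    show "\<one> \<in> ?K" using LE(3) incl one_smooth by blast
    show "\<ominus> x \<in> ?K" if "x \<in> ?K" for x using two[OF that that] LE(5) incl by blast
    show "x \<oplus> y \<in> ?K" if "x \<in> ?K" "y \<in> ?K" for x y using two[OF that] LE(7) incl by blast
    show "x \<otimes> y \<in> ?K" if "x \<in> ?K" "y \<in> ?K" for x y using two[OF that] LE(6) incl by blast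
    show "inv x \<in> ?K" if x: "x \<in> ?K - {\<zero>}" for x
    proof -
      obtain n where "n \<in> smooth_numbers Q" "x \<in> frobenius_fixed (card F ^ n)" using two[of x x] x by blast
      then show ?thesis using subfield_m_inv(1)[OF L, of x n] x incl by blast
    qed
  qed
qed

context algebraically_closed
begin

lemma infinite_smooth_closure:
  assumes F: "subfield F L" "finite F" and q: "q \<in> Q" "Factorial_Ring.prime q"
  shows "infinite (smooth_closure Q (card F))"
proof
  assume fin: "finite (smooth_closure Q (card F))"
  let ?k = "card (smooth_closure Q (card F))"
  have "q ^ j \<in> smooth_numbers Q" for j
    by (induction j) (use one_smooth smooth_numbers_mult[OF prime_smooth[OF q]] in auto)
  then have "frobenius_fixed (card F ^ q ^ ?k) \<subseteq> smooth_closure Q (card F)" by (auto simp: smooth_closure_def)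
  then have "card (frobenius_fixed (card F ^ q ^ ?k)) \<le> ?k" by (rule card_mono[OF fin])
  moreover have "card (frobenius_fixed (card F ^ q ^ ?k)) = card F ^ q ^ ?k"
    by (rule card_frobenius_fixed[OF F]) (use q(2) prime_gt_0_nat in simp)
  moreover have "?k < q ^ ?k" using prime_gt_1_nat[OF q(2)] power_gt_expt[of q ?k] by simp
  moreover have "q ^ ?k < card F ^ q ^ ?k" using finite_subfield_card_ge_2[OF F] by (intro power_gt_expt) simp
  ultimately show False by simp
qed

text \<open>Let \<open>s\<close> be the order of the multiplicative group of a finite field that contains \<open>x\<close>. If
  \<open>q\<close> does not divide \<open>s\<close>, then \<open>x\<close> is a \<open>q\<close>-th power there; otherwise that field contains the
  \<open>q\<close>-th roots of unity, and the extension of degree \<open>q\<close> contains the \<open>q\<close>-th roots of \<open>x\<close>.\<close>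

lemma smooth_closure_ex_root:
  assumes F: "subfield F L" "finite F" and q: "q \<in> Q" "Factorial_Ring.prime q"
    and x: "x \<in> smooth_closure Q (card F)"
  shows "\<exists>y \<in> smooth_closure Q (card F). y [^] q = x"
proof (cases "x = \<zero>")
  case True
  then show ?thesis using x prime_gt_0_nat[OF q(2)] by (intro bexI[of _ x]) (auto simp: nat_pow_zero)
next
  case False
  obtain n where n: "n \<in> smooth_numbers Q" "x \<in> frobenius_fixed (card F ^ n)" using x by (auto simp: smooth_closure_def)
  define l where "l = card F ^ n"
  have "n > 0" using n(1) by (simp add: smooth_numbers_def)
  have xc: "x \<in> carrier L" "x [^] l = x" using n(2) by (auto simp: frobenius_fixed_def l_def)
  have u: "card F \<ge> 2" by (rule finite_subfield_card_ge_2[OF F])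
  have "l \<noteq> 1" using u \<open>n > 0\<close> by (simp add: l_def)
  moreover have "l > 0" using u by (simp add: l_def)
  ultimately obtain s where s: "l = Suc s" "s > 0" by (cases l) auto
  have xs: "x [^] s = \<one>"
  proof -
    have "x [^] s \<otimes> x = \<one> \<otimes> x" using xc s(1) by simp
    then show ?thesis by (rule iffD1[OF m_rcancel[OF False xc(1) nat_pow_closed[OF xc(1)] one_closed]])
  qed
  show ?thesis
  proof (cases "q dvd s")
    case False
    then have "coprime q s" by (rule prime_imp_coprime[OF q(2)])
    then have "gcd q s = 1" by simp
    moreover obtain b c where "q * b = s * c + gcd q s"
      using bezout_nat[of q s] prime_gt_0_nat[OF q(2)] by auto
    ultimately have bc: "q * b = s * c + 1" by simp
    have "(x [^] b) [^] q = x [^] (b * q)" by (rule nat_pow_pow[OF xc(1)])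
    also have "b * q = s * c + 1" using bc by (simp add: mult.commute)
    also have "x [^] (s * c + 1) = x [^] (s * c) \<otimes> x" using xc(1) by simp
    also have "x [^] (s * c) = (x [^] s) [^] c" by (rule nat_pow_pow[OF xc(1), symmetric])
    also have "\<dots> \<otimes> x = x" using xs xc(1) by simp
    finally have "(x [^] b) [^] q = x" .
    moreover have "x [^] b \<in> smooth_closure Q (card F)"
    proof -
      have K: "subring (smooth_closure Q (card F)) L" by (rule subfieldE(1)[OF subfield_smooth_closure[OF F]])
      show ?thesis by (induction b) (use subringE(3,6)[OF K] x in auto)
    qed
    ultimately show ?thesis by blast
  next
    case True
    then obtain t where t: "s = q * t" by blast
    obtain y where y: "y \<in> carrier L" "y [^] q = x" using ex_nth_root[OF xc(1) prime_gt_0_nat[OF q(2)]] .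
    define w where "w = y [^] s"
    have wc: "w \<in> carrier L" using y(1) by (simp add: w_def)
    have "w [^] q = (y [^] q) [^] s"
      unfolding w_def nat_pow_pow[OF y(1)] by (simp add: mult.commute)
    then have wq: "w [^] q = \<one>" using y(2) xs by simp
    then have "w [^] s = \<one>" unfolding t nat_pow_pow[OF wc, symmetric] by simp
    then have wl: "w [^] l = w" using s(1) wc by simp
    have yl: "y [^] l = y \<otimes> w" using s(1) y(1) wc by (simp add: w_def m_comm)
    have "y [^] (l ^ i) = y \<otimes> w [^] i" for i
    proof (induction i)
      case (Suc i)
      have "y [^] (l ^ Suc i) = (y [^] (l ^ i)) [^] l"
        unfolding nat_pow_pow[OF y(1)] by (simp add: mult.commute)
      also have "\<dots> = y [^] l \<otimes> (w [^] i) [^] l"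
        using Suc y(1) wc by (simp add: nat_pow_distrib)
      also have "(w [^] i) [^] l = (w [^] l) [^] i"
        unfolding nat_pow_pow[OF wc] by (simp add: mult.commute)
      also have "y [^] l \<otimes> (w [^] l) [^] i = y \<otimes> w [^] Suc i" using yl wl y(1) wc nat_pow_Suc2[OF wc, of i] by (simp add: m_assoc)
      finally show ?case .
    qed (use y in simp)
    from this[of q] have "y [^] (card F ^ (n * q)) = y" using wq y(1) by (simp add: l_def power_mult)
    then have "y \<in> frobenius_fixed (card F ^ (n * q))" using y(1) by (simp add: frobenius_fixed_def)
    then have "y \<in> smooth_closure Q (card F)"
      using smooth_numbers_mult[OF n(1) prime_smooth[OF q]] by (auto simp: smooth_closure_def)
    then show ?thesis using y(2) by blast
  qed
qed

text \<open>Suppose that \<open>p\<close> has a proper factor \<open>a\<close> with coefficients in the extension \<open>E\<close> of degree \<open>n\<close>, and let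
  \<open>z\<close> be a root of \<open>a\<close>. If \<open>z\<close> has degree \<open>m\<close> over \<open>E\<close>, then \<open>E(z)\<close> has degree \<open>n m\<close> over \<open>F\<close>, and this is a
  multiple of the degree of \<open>F(z)\<close>, which is that of \<open>p\<close>. As \<open>n\<close> is coprime to the latter, the degree of
  \<open>p\<close> divides \<open>m\<close>, which is at most the degree of \<open>a\<close>.\<close>

lemma pirreducible_smooth_closure:
  assumes F: "subfield F L" "finite F" and p: "p \<in> carrier (F[X])" "pirreducible F p"
    and Q: "\<And>q. q \<in> Q \<Longrightarrow> \<not> q dvd degree p"
  shows "p \<in> carrier ((smooth_closure Q (card F))[X])" "pirreducible (smooth_closure Q (card F)) p"
proof -
  let ?u = "card F" let ?K = "smooth_closure Q ?u"
  have u: "?u \<ge> 2" by (rule finite_subfield_card_ge_2[OF F])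
  have K: "subfield ?K L" by (rule subfield_smooth_closure[OF F])
  have Ffix: "F \<subseteq> frobenius_fixed (?u ^ n)" for n
  proof
    fix x assume x: "x \<in> F"
    then have "x \<in> frobenius_fixed (?u ^ 1)"
      using finite_subfield_pow_card[OF F x] subfieldE(3)[OF F(1)] by (auto simp: frobenius_fixed_def)
    from frobenius_fixed_mono[OF this, of n] show "x \<in> frobenius_fixed (?u ^ n)" by simp
  qed
  then have FK: "F \<subseteq> ?K" using one_smooth by (force simp: smooth_closure_def)
  then show pK: "p \<in> carrier (?K[X])" using p(1) by (auto simp: univ_poly_carrier[symmetric] polynomial_def)
  have deg: "degree p \<ge> 1" by (rule pirreducible_degree[OF F(1) p])
  show "pirreducible ?K p"
  proof (rule pirreducibleI[OF subfieldE(1)[OF K] pK])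
    show "p \<noteq> []" using deg by auto
    show "p \<notin> Units (?K[X])" using deg univ_poly_units'[OF K, of p] by auto
    fix a b assume ab: "a \<in> carrier (?K[X])" "b \<in> carrier (?K[X])" "p = a \<otimes>\<^bsub>?K[X]\<^esub> b"
    show "a \<in> Units (?K[X]) \<or> b \<in> Units (?K[X])"
    proof (rule ccontr)
      assume neg: "\<not> ?thesis"
      have nz: "a \<noteq> []" "b \<noteq> []"
        using ab deg poly_mult_degree_eq[OF subfieldE(1)[OF K], of a b] by (auto simp: univ_poly_mult univ_poly_carrier)
      then have da: "degree a \<ge> 1" "degree b \<ge> 1"
        using neg ab(1,2) univ_poly_units'[OF K] by (simp_all add: Suc_le_eq)
      moreover have "degree p = degree a + degree b"
        using ab nz poly_mult_degree_eq[OF subfieldE(1)[OF K], of a b] by (simp add: univ_poly_mult univ_poly_carrier)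
      ultimately have lt: "degree a < degree p" by simp
      have "set a \<subseteq> ?K" using ab(1) polynomial_incl univ_poly_carrier by blast
      then obtain n where n: "n \<in> smooth_numbers Q" "set a \<subseteq> frobenius_fixed (?u ^ n)"
        using finite_subset_smooth_closure[of "set a"] by blast
      define E where "E = frobenius_fixed (?u ^ n)"
      have "n > 0" using n(1) by (simp add: smooth_numbers_def)
      have E: "subfield E L" unfolding E_def by (rule subfield_frobenius_fixed[OF F])
      have cE: "card E = ?u ^ n" unfolding E_def by (rule card_frobenius_fixed[OF F \<open>n > 0\<close>])
      have fE: "finite E" using cE u card.infinite by fastforce
      have aE: "a \<in> carrier (E[X])" using ab(1) n(2) unfolding E_def by (auto simp: univ_poly_carrier[symmetric] polynomial_def)
      have aL: "a \<in> carrier (poly_ring L)" "b \<in> carrier (poly_ring L)"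
        using carrier_polynomial_shell[OF subfieldE(1)[OF K]] ab(1,2) by auto
      have "size (roots a) \<ge> 1" using roots_over_carrier[OF aL(1)] da(1) by (simp add: splitted_def)
      then obtain z where "z \<in># roots a" by (metis multiset_nonemptyE not_one_le_zero size_empty)
      then have z: "z \<in> carrier L" "eval a z = \<zero>" using roots_mem_iff_is_root[OF aL(1)] by (auto simp: is_root_def)
      have alg: "(algebraic over E) z" using algebraicI[OF aE nz(1) z(2)] .
      note I = IrrE[OF E z(1) alg]
      define m where "m = degree (Irr E z)"
      have "m \<le> degree a"
        unfolding m_def using pdivides_imp_degree_le[OF subfieldE(1)[OF E] I(1) aE nz(1)] Irr_minimal[OF E z(1) alg aE z(2)] by blast
      have "m \<ge> 1" unfolding m_def by (rule pirreducible_degree[OF E I(1,2)])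
      have sa: "set a \<subseteq> carrier L" "set b \<subseteq> carrier L" using aL polynomial_incl univ_poly_carrier by blast+
      have "eval p z = \<zero>"
        using eval_poly_mult[OF sa z(1)] z(2) eval_in_carrier[OF sa(2) z(1)] by (simp add: ab(3) univ_poly_mult)
      note W = simple_extension_root_irreducible[OF F p z(1) this]
      have V: "subfield (simple_extension E z) L" using simple_extension_is_subfield[OF E z(1)] alg by blast
      have cV: "finite (simple_extension E z)" "card (simple_extension E z) = (?u ^ n) ^ m"
        using card_of_dimension[OF E fE dimension_simple_extension[OF E z(1) alg]] cE by (auto simp: m_def)
      have "simple_extension F z \<subseteq> simple_extension E z" using mono_simple_extension Ffix by (simp add: E_def)
      then obtain d where "card (simple_extension E z) = card (simple_extension F z) ^ d"
        using card_of_finite_extension[OF W(1) V _ cV(1)] by blast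
      then have "?u ^ (n * m) = ?u ^ (degree p * d)" using cV(2) W(3) by (simp add: power_mult)
      then have "n * m = degree p * d" using u power_inject_exp[of ?u] by simp
      then have "degree p dvd n * m" by simp
      moreover have "coprime (degree p) n"
      proof (rule ccontr)
        assume "\<not> coprime (degree p) n"
        then obtain q where "Factorial_Ring.prime q" "q dvd degree p" "q dvd n"
          using prime_factor_nat[of "gcd (degree p) n"] by (metis coprime_iff_gcd_eq_1 gcd_greatest_iff)
        then show False using Q n(1) by (auto simp: smooth_numbers_def)
      qed
      ultimately have "degree p dvd m" by (simp add: coprime_dvd_mult_right_iff)
      then have "degree p \<le> m" using \<open>m \<ge> 1\<close> by (intro dvd_imp_le) auto
      then show False using \<open>m \<le> degree a\<close> lt by simp
    qed
  qed
qed

text \<open>An irreducible polynomial of degree divisible by \<open>q\<close> becomes reducible over the extension \<open>E\<close> of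
  degree \<open>q\<close>: for a root \<open>z\<close>, the field \<open>E(z)\<close> is contained in \<open>F(z)\<close>.\<close>

lemma not_pirreducible_frobenius_fixed:
  assumes F: "subfield F L" "finite F" and p: "p \<in> carrier (F[X])" "pirreducible F p"
    and q: "q > 1" "q dvd degree p"
    and E: "E = frobenius_fixed (card F ^ q)" "p \<in> carrier (E[X])"
  shows "\<not> pirreducible E p"
proof
  assume irr: "pirreducible E p"
  have u: "card F \<ge> 2" by (rule finite_subfield_card_ge_2[OF F])
  have Es: "subfield E L" unfolding E(1) by (rule subfield_frobenius_fixed[OF F])
  have cE: "card E = card F ^ q" unfolding E(1) by (rule card_frobenius_fixed[OF F]) (use q in simp)
  have fE: "finite E" using cE u card.infinite by fastforce
  have deg: "degree p \<ge> 1" by (rule pirreducible_degree[OF F(1) p])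
  have pL: "p \<in> carrier (poly_ring L)" using carrier_polynomial_shell[OF subfieldE(1)[OF F(1)] p(1)] .
  have "size (roots p) \<ge> 1" using roots_over_carrier[OF pL] deg by (simp add: splitted_def)
  then obtain z where "z \<in># roots p" by (metis multiset_nonemptyE not_one_le_zero size_empty)
  then have z: "z \<in> carrier L" "eval p z = \<zero>" using roots_mem_iff_is_root[OF pL] by (auto simp: is_root_def)
  note W = simple_extension_root_irreducible[OF F p z]
  note V = simple_extension_root_irreducible[OF Es fE E(2) irr z]
  let ?D = "frobenius_fixed (card F ^ degree p)"
  have D: "subfield ?D L" by (rule subfield_frobenius_fixed[OF F])
  have "z \<in> simple_extension F z" by (rule simple_extension_mem[OF subfieldE(1)[OF F(1)] z(1)])
  then have "z \<in> ?D" using finite_subfield_pow_card[OF W(1,2)] W(3) z(1) by (simp add: frobenius_fixed_def)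
  moreover have "E \<subseteq> ?D"
  proof
    fix x assume "x \<in> E"
    moreover obtain k where "degree p = q * k" using q(2) by blast
    ultimately show "x \<in> ?D" using frobenius_fixed_mono[of x "card F" q k] E(1) by simp
  qed
  ultimately have "simple_extension E z \<subseteq> ?D" by (intro simple_extension_subring_incl[OF subfieldE(1)[OF D]])
  moreover have "2 \<le> card F ^ degree p" using u deg by (metis le_trans power_increasing power_one_right one_le_numeral order_trans)
  then have "finite ?D" "card ?D \<le> card F ^ degree p" using card_frobenius_fixed_le by auto
  ultimately have "card (simple_extension E z) \<le> card F ^ degree p" by (meson card_mono order_trans)
  then have "card F ^ (q * degree p) \<le> card F ^ degree p" using V(3) cE by (simp add: power_mult)
  then have "q * degree p \<le> degree p" by (rule power_le_imp_le_exp[rotated]) (use u in simp)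
  then show False using q(1) deg by simp
qed

end

text \<open>For finite \<open>U\<close>, the hypothesis on the extensions of degree \<open>q\<close> implies that \<open>q\<close> does not divide the
  degree. The extension of degree \<open>q\<close> in the algebraic closure \<open>L\<close> is finite and so has a copy \<open>N\<close> whose
  elements are lists over \<open>U\<close>.\<close>

lemma not_dvd_degree_of_irreducible_in_extensions:
  fixes U :: "'u ring"
  assumes U: "field U" "finite (carrier U)" and q: "Factorial_Ring.prime q"
    and p: "p \<in> carrier (poly_ring U)" "pirreducible\<^bsub>U\<^esub> (carrier U) p" "irreducible_in_extensions q U p"
  shows "\<not> q dvd degree p"
proof
  assume dvd: "q dvd degree p"
  interpret U: field U by fact
  obtain L :: "((('u list \<times> nat) multiset) \<Rightarrow> 'u) ring"
    where L: "algebraic_closure L (U.indexed_const ` carrier U)" and h: "U.indexed_const \<in> ring_hom U L"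
    by (rule U.exists_closure)
  let ?h = "U.indexed_const :: 'u \<Rightarrow> ('u list \<times> nat) multiset \<Rightarrow> 'u"
  interpret L: algebraic_closure L "?h ` carrier U" by (rule L)
  let ?F = "?h ` carrier U"
  have F: "subfield ?F L" "finite ?F" using L.subfield_axioms U(2) by auto
  have inj: "inj_on ?h (carrier U)" by (rule U.indexed_const_inj_on)
  have cF: "card ?F = card (carrier U)" by (rule card_image[OF inj])
  have u: "card (carrier U) \<ge> 2" using L.finite_subfield_card_ge_2[OF F] unfolding cF .
  have q1: "q > 1" by (rule prime_gt_1_nat[OF q])
  define E where "E = L.frobenius_fixed (card ?F ^ q)"
  have E: "subfield E L" unfolding E_def by (rule L.subfield_frobenius_fixed[OF F])
  have cE: "card E = card (carrier U) ^ q" unfolding E_def using L.card_frobenius_fixed[OF F] q1 cF by simp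
  have fE: "finite E" using cE u card.infinite by fastforce
  have FE: "?F \<subseteq> E"
  proof
    fix x assume x: "x \<in> ?F"
    then have "x \<in> L.frobenius_fixed (card ?F ^ 1)"
      using L.finite_subfield_pow_card[OF F x] subfieldE(3)[OF F(1)] by (auto simp: L.frobenius_fixed_def)
    from L.frobenius_fixed_mono[OF this, of q] show "x \<in> E" by (simp add: E_def)
  qed
  note P = pirreducible_hom_image[OF U(1) L.field_axioms h p(1,2)]
  obtain \<phi> :: "_ \<Rightarrow> 'u list" where \<phi>: "inj_on \<phi> E"
  proof -
    have "infinite (UNIV :: 'u list set)" by (rule infinite_UNIV_listI)
    then obtain B :: "'u list set" where "finite B" "card B = card E" using infinite_arbitrarily_large by metis
    then show ?thesis using that finite_same_card_bij[OF fE] by (metis bij_betw_def)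
  qed
  define N where "N = image_ring \<phi> (L\<lparr>carrier := E\<rparr>)"
  have LE: "field (L\<lparr>carrier := E\<rparr>)" by (rule L.subfield_iff(2)[OF E])
  then interpret LE: field "L\<lparr>carrier := E\<rparr>" .
  have \<phi>iso: "\<phi> \<in> ring_iso (L\<lparr>carrier := E\<rparr>) N" unfolding N_def by (rule inj_imp_image_ring_iso) (use \<phi> in simp)
  have N: "field N" unfolding N_def by (rule LE.inj_imp_image_ring_is_field) (use \<phi> in simp)
  then interpret N: field N .
  have cN: "carrier N = \<phi> ` E" by (simp add: N_def image_ring_carrier)
  have hE: "?h \<in> ring_hom U (L\<lparr>carrier := E\<rparr>)"
    using h FE by (auto simp: ring_hom_def)
  have g: "\<phi> \<circ> ?h \<in> ring_hom U N"
    by (rule ring_hom_trans[OF hE]) (use \<phi>iso in \<open>simp add: ring_iso_def\<close>)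
  have deg: "extension_of_degree q U N (\<phi> \<circ> ?h)"
    unfolding extension_of_degree_def
  proof (intro conjI N g)
    interpret g: ring_hom_ring U N "\<phi> \<circ> ?h" using ring_hom_ringI2[OF U.ring_axioms N.ring_axioms g] .
    have gU: "subfield ((\<phi> \<circ> ?h) ` carrier U) N" "inj_on (\<phi> \<circ> ?h) (carrier U)"
      using g.img_is_subfield[OF U.carrier_is_subfield] by auto
    have "finite (carrier N)" using fE by (simp add: cN)
    then obtain d where d: "N.dimension d ((\<phi> \<circ> ?h) ` carrier U) (carrier N)"
      "card (carrier N) = card ((\<phi> \<circ> ?h) ` carrier U) ^ d"
      using N.card_of_finite_extension[OF gU(1) N.carrier_is_subfield subfieldE(3)[OF gU(1)]] by blast
    have "card (carrier U) ^ q = card (carrier U) ^ d"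
      using d(2) card_image[OF gU(2)] card_image[OF \<phi>] cE by (simp add: cN)
    then have "q = d" using u power_inject_exp[of "card (carrier U)"] by simp
    then show "N.dimension q ((\<phi> \<circ> ?h) ` carrier U) (carrier N)" using d(1) by simp
  qed
  then have irrN: "pirreducible\<^bsub>N\<^esub> (carrier N) (map (\<phi> \<circ> ?h) p)"
    using p(3) unfolding irreducible_in_extensions_def by blast
  have gp: "map (\<phi> \<circ> ?h) p \<in> carrier (poly_ring N)" by (rule polynomial_hom[OF g U(1) N p(1)])
  define \<psi> where "\<psi> = inv_into E \<phi>"
  have \<psi>: "\<psi> \<in> ring_iso N (L\<lparr>carrier := E\<rparr>)"
    using ring_iso_set_sym[OF LE.ring_axioms \<phi>iso] by (simp add: \<psi>_def)
  then have \<psi>L: "\<psi> \<in> ring_hom N L" "\<psi> ` carrier N = E"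
    using subfieldE(3)[OF E] by (auto simp: ring_iso_def ring_hom_def bij_betw_def)
  have m: "map \<psi> (map (\<phi> \<circ> ?h) p) = map ?h p"
  proof -
    have "set p \<subseteq> carrier U" using p(1) U.polynomial_incl univ_poly_carrier by blast
    then show ?thesis using FE \<phi> by (auto simp: \<psi>_def intro!: inv_into_f_f)
  qed
  have "map ?h p \<in> carrier (E[X]\<^bsub>L\<^esub>)" "pirreducible\<^bsub>L\<^esub> E (map ?h p)"
    using pirreducible_hom_image[OF N L.field_axioms \<psi>L(1) gp irrN] unfolding m \<psi>L(2) .
  then show False
    using L.not_pirreducible_frobenius_fixed[OF F P q1 _ E_def] dvd by simp
qed

section \<open>Existence of the model\<close>

text \<open>An extension field of \<open>U\<close> as a structure. A constant symbol that is not an element of \<open>U\<close>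
  is interpreted as zero, so that every symbol denotes an element of the image of \<open>U\<close>.\<close>

definition extension_structure ::
  "'u ring \<Rightarrow> 'b ring \<Rightarrow> ('u \<Rightarrow> 'b) \<Rightarrow> ('u, 'b) ring_structure" where
  "extension_structure U F h =
     \<lparr> carrier = carrier F, mult = mult F, one = one F, zero = zero F, add = add F,
       neg = a_inv F, cst = (\<lambda>c. h (if c \<in> carrier U then c else \<zero>\<^bsub>U\<^esub>)) \<rparr>"

lemma model_of_extension:
  fixes U :: "'u ring" and F :: "'b ring" and \<kappa> :: "'k rel"
  assumes U: "field U" "countable (carrier U)" and F: "field F" "infinite (carrier F)" and h: "h \<in> ring_hom U F"
    and R: "\<forall>q \<in> Q. fst (R q) \<in> carrier (poly_ring U) \<and> snd (R q) \<in> carrier (poly_ring U)"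
    and power: "\<forall>q \<in> Q. q > 0 \<and> (\<forall>x \<in> carrier F. ring.eval F (map h (snd (R q))) x \<noteq> \<zero>\<^bsub>F\<^esub> \<longrightarrow>
       (\<exists>y \<in> carrier F. y [^]\<^bsub>F\<^esub> q = ring.eval F (map h (fst (R q))) x \<otimes>\<^bsub>F\<^esub> inv\<^bsub>F\<^esub> (ring.eval F (map h (snd (R q))) x)))"
    and P: "\<forall>i>(0::nat). P i \<in> carrier (poly_ring U) \<and> pirreducible\<^bsub>F\<^esub> (carrier F) (map h (P i))"
    and Z: "\<forall>i>(0::nat). Z i \<in> carrier (poly_ring U) \<and> (\<exists>x \<in> carrier U. ring.eval U (Z i) x = \<zero>\<^bsub>U\<^esub>)"
    and \<kappa>: "Card_order \<kappa>"
  shows "\<exists>G :: ('u, 'k + nat) ring_structure.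
           is_model (carrier U) G (theory_of U Q R P Z) \<and>
           has_transcendence_degree G (cst G ` carrier U) \<kappa>"
proof (rule model_of_transcendence_degree[OF U _ _ _ _ _ _ _ Z \<kappa>])
  interpret U: field U by fact
  interpret F: field F by fact
  interpret h: ring_hom_ring U F h using ring_hom_ringI2[OF U.ring_axioms F.ring_axioms h] .
  let ?K = "extension_structure U F h"
  have sel: "carrier ?K = carrier F" "mult ?K = mult F" "one ?K = one F" "zero ?K = zero F" "add ?K = add F"
    "neg ?K = a_inv F" "cst ?K = (\<lambda>c. h (if c \<in> carrier U then c else \<zero>\<^bsub>U\<^esub>))"
    by (simp_all add: extension_structure_def)
  have uK: "underlying_ring ?K F" by (simp add: underlying_ring_def sel)
  show "is_structure UNIV ?K" by (auto simp: is_structure_def sel)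
  show "infinite (carrier ?K)" using F(2) by (simp add: sel)
  show "range (cst ?K) = cst ?K ` carrier U" by (auto simp: sel)
  show "\<forall>\<phi> \<in> field_axioms_fm. true_in ?K \<phi>"
    using field_axioms_of_field[OF F(1) uK] by (simp add: sel)
  have inj: "inj_on h (carrier U)" using h.img_is_subfield(1)[OF U.carrier_is_subfield] by simp
  have emb: "structure_embedding (carrier U) (self_structure U) ?K h"
    using inj by (auto simp: structure_embedding_def self_structure_def sel)
  have sU: "is_structure (carrier U) (self_structure U)" by (simp add: is_structure_def self_structure_def)
  show "\<forall>\<phi> \<in> atomic_diagram U. true_in ?K \<phi>"
  proof
    fix \<phi> assume \<phi>: "\<phi> \<in> atomic_diagram U"
    then have "quantifier_free \<phi>" "set_fm \<phi> \<subseteq> carrier U" "free_vars \<phi> = {}" "true_in (self_structure U) \<phi>"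
      by (auto simp: atomic_diagram_def)
    then show "true_in ?K \<phi>" using true_in_embedding_closed[OF emb sU] by blast
  qed
  have mp: "map (cst ?K) p = map h p" if "p \<in> carrier (poly_ring U)" for p
  proof -
    have "set p \<subseteq> carrier U" using that U.polynomial_incl univ_poly_carrier by blast
    then show ?thesis by (auto simp: sel)
  qed
  have hp: "map h p \<in> carrier (poly_ring F)" if "p \<in> carrier (poly_ring U)" for p
    by (rule polynomial_hom[OF h U(1) F(1) that])
  show "\<forall>q \<in> Q. q > 0 \<and> true_in ?K (power_sentence q (R q))"
  proof
    fix q assume q: "q \<in> Q"
    have fg: "fst (R q) \<in> carrier (poly_ring U)" "snd (R q) \<in> carrier (poly_ring U)" using R q by auto
    have "\<exists>y \<in> carrier F. y [^]\<^bsub>F\<^esub> q \<otimes>\<^bsub>F\<^esub> F.eval (map h (snd (R q))) x = F.eval (map h (fst (R q))) x"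
      if x: "x \<in> carrier F" and nz: "F.eval (map h (snd (R q))) x \<noteq> \<zero>\<^bsub>F\<^esub>" for x
    proof -
      have c: "F.eval (map h (snd (R q))) x \<in> carrier F" "F.eval (map h (fst (R q))) x \<in> carrier F"
        using hp[OF fg(1)] hp[OF fg(2)] F.eval_poly_in_carrier[OF F.carrier_is_subring _ x] by (auto simp: univ_poly_carrier)
      obtain y where "y \<in> carrier F" "y [^]\<^bsub>F\<^esub> q = F.eval (map h (fst (R q))) x \<otimes>\<^bsub>F\<^esub> inv\<^bsub>F\<^esub> (F.eval (map h (snd (R q))) x)"
        using power q x nz by blast
      then show ?thesis using c nz F.field_Units by (intro bexI[of _ y]) (auto simp: F.m_assoc)
    qed
    then have "true_in ?K (power_sentence q (R q))"
      unfolding true_in_def sat_power_sentence[OF uK F.ring_axioms] mp[OF fg(1)] mp[OF fg(2)] by blast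
    then show "q > 0 \<and> true_in ?K (power_sentence q (R q))" using power q by blast
  qed
  show "\<forall>i>0. true_in ?K (irreducible_sentence (P i))"
  proof (intro allI impI)
    fix i :: nat assume "i > 0"
    then have Pi: "P i \<in> carrier (poly_ring U)" "pirreducible\<^bsub>F\<^esub> (carrier F) (map h (P i))" using P by auto
    show "true_in ?K (irreducible_sentence (P i))"
      unfolding true_in_def
      by (intro allI impI sat_irreducible_sentence[OF uK F(1)])
        (simp_all only: mp[OF Pi(1)] hp[OF Pi(1)] Pi(2))
  qed
qed

theorem proposition3:
  fixes U :: "'u ring"
    and Q :: "nat set"
    and R :: "nat \<Rightarrow> 'u list \<times> 'u list"
    and P Z :: "nat \<Rightarrow> 'u list"
    and \<kappa> :: "'k rel"
  assumes "field U" and "countable (carrier U)"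
    and "infinite Q" and "\<forall>q \<in> Q. Factorial_Ring.prime q" and "ring_char U \<notin> Q"
    and "\<forall>q \<in> Q. rational_function U (R q)"
    and "\<forall>q \<in> Q. zeros_poles_in U (R q)"
    and "\<forall>q \<in> Q. \<exists>a. is_zero_of U (R q) a \<and> \<not> q dvd ring.alg_mult U (fst (R q)) a
                  \<or> is_pole_of U (R q) a \<and> \<not> q dvd ring.alg_mult U (snd (R q)) a"
    and "\<forall>q \<in> Q. \<forall>x \<in> carrier U. \<not> is_pole_of U (R q) x
           \<longrightarrow> (\<exists>y \<in> carrier U. y [^]\<^bsub>U\<^esub> q = rat_eval U (R q) x)"
    and "\<forall>i>0. P i \<in> carrier (poly_ring U) \<and> pirreducible\<^bsub>U\<^esub> (carrier U) (P i)"
    and "\<forall>i>0. \<forall>q \<in> Q. irreducible_in_extensions q U (P i)"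
    and "\<forall>i>0. Z i \<in> carrier (poly_ring U) \<and> (\<exists>x \<in> carrier U. ring.eval U (Z i) x = \<zero>\<^bsub>U\<^esub>)"
    and "Card_order \<kappa>"
  shows "\<exists>G :: ('u, 'k + nat) ring_structure.
           is_model (carrier U) G (theory_of U Q R P Z) \<and>
           has_transcendence_degree G (cst G ` carrier U) \<kappa>"
proof -
  interpret U: field U by fact
  have R: "\<forall>q \<in> Q. fst (R q) \<in> carrier (poly_ring U) \<and> snd (R q) \<in> carrier (poly_ring U)"
    using assms(6) by (simp add: rational_function_def case_prod_unfold)
  show ?thesis
  proof (cases "finite (carrier U)")
    case False
    have id: "id \<in> ring_hom U U" by (auto simp: ring_hom_def)
    show ?thesis
    proof (rule model_of_extension[OF assms(1,2,1) False id R _ _ assms(12,13)])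
      show "\<forall>q \<in> Q. q > 0 \<and> (\<forall>x \<in> carrier U. U.eval (map id (snd (R q))) x \<noteq> \<zero>\<^bsub>U\<^esub> \<longrightarrow>
       (\<exists>y \<in> carrier U. y [^]\<^bsub>U\<^esub> q = U.eval (map id (fst (R q))) x \<otimes>\<^bsub>U\<^esub> inv\<^bsub>U\<^esub> (U.eval (map id (snd (R q))) x)))"
        using assms(9) assms(4) prime_gt_0_nat by (auto simp: is_pole_of_def U.is_root_def rat_eval_def)
      show "\<forall>i>0. P i \<in> carrier (poly_ring U) \<and> pirreducible\<^bsub>U\<^esub> (carrier U) (map id (P i))"
        using assms(10) by simp
    qed
  next
    case True
    \<comment> \<open>Any single member of \<open>Q\<close> makes the field \<open>K\<close> below infinite.\<close>
    obtain q0 where q0: "q0 \<in> Q" using assms(3) by (metis finite.emptyI ex_in_conv)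
    obtain L :: "((('u list \<times> nat) multiset) \<Rightarrow> 'u) ring"
      where L: "algebraic_closure L (U.indexed_const ` carrier U)" and h: "U.indexed_const \<in> ring_hom U L"
      by (rule U.exists_closure)
    let ?h = "U.indexed_const :: 'u \<Rightarrow> ('u list \<times> nat) multiset \<Rightarrow> 'u"
    interpret L: algebraic_closure L "?h ` carrier U" by (rule L)
    let ?F = "?h ` carrier U"
    have F: "subfield ?F L" "finite ?F" using L.subfield_axioms True by auto
    define K where "K = L.smooth_closure Q (card ?F)"
    have K: "subfield K L" unfolding K_def by (rule L.subfield_smooth_closure[OF F])
    note Ksub = subfieldE(1)[OF K]
    have fK: "field (L\<lparr>carrier := K\<rparr>)" by (rule L.subfield_iff(2)[OF K])
    have irr: "map ?h (P i) \<in> carrier (K[X]\<^bsub>L\<^esub>) \<and> pirreducible\<^bsub>L\<^esub> K (map ?h (P i))" if i: "i > 0" for i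
    proof -
      have Pi: "P i \<in> carrier (poly_ring U)" "pirreducible\<^bsub>U\<^esub> (carrier U) (P i)" using assms(10) i by auto
      have "\<not> q dvd degree (P i)" if "q \<in> Q" for q
        by (rule not_dvd_degree_of_irreducible_in_extensions[OF assms(1) True _ Pi]) (use that i assms(4,11) in auto)
      then show ?thesis
        using L.pirreducible_smooth_closure[OF F pirreducible_hom_image[OF assms(1) L.field_axioms h Pi], of Q]
        by (simp add: K_def)
    qed
    have "?F \<subseteq> K"
    proof
      fix x assume x: "x \<in> ?F"
      then have "x \<in> carrier L" "x [^]\<^bsub>L\<^esub> (card ?F ^ 1) = x"
        using L.finite_subfield_pow_card[OF F x] subfieldE(3)[OF F(1)] by auto
      then show "x \<in> K" using one_smooth[of Q] unfolding K_def L.smooth_closure_def L.frobenius_fixed_def by blast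
    qed
    then have hK: "?h \<in> ring_hom U (L\<lparr>carrier := K\<rparr>)" using h by (auto simp: ring_hom_def)
    interpret LK: field "L\<lparr>carrier := K\<rparr>" by (rule fK)
    show ?thesis
    proof (rule model_of_extension[OF assms(1,2) fK _ hK R _ _ assms(12,13)])
      show "infinite (carrier (L\<lparr>carrier := K\<rparr>))"
        using L.infinite_smooth_closure[OF F q0] assms(4) q0 by (simp add: K_def)
      have "\<exists>y \<in> K. y [^]\<^bsub>L\<^esub> q = x" if "q \<in> Q" "x \<in> K" for q x
        using L.smooth_closure_ex_root[OF F that(1) _ that(2)[unfolded K_def]] assms(4) that(1) by (auto simp: K_def)
      then have root: "\<exists>y \<in> carrier (L\<lparr>carrier := K\<rparr>). y [^]\<^bsub>L\<lparr>carrier := K\<rparr>\<^esub> q = x"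
        if "q \<in> Q" "x \<in> carrier (L\<lparr>carrier := K\<rparr>)" for q x
        using that by (simp add: nat_pow_def)
      show "\<forall>q \<in> Q. q > 0 \<and> (\<forall>x \<in> carrier (L\<lparr>carrier := K\<rparr>). LK.eval (map ?h (snd (R q))) x \<noteq> \<zero>\<^bsub>L\<lparr>carrier := K\<rparr>\<^esub> \<longrightarrow>
       (\<exists>y \<in> carrier (L\<lparr>carrier := K\<rparr>). y [^]\<^bsub>L\<lparr>carrier := K\<rparr>\<^esub> q = LK.eval (map ?h (fst (R q))) x \<otimes>\<^bsub>L\<lparr>carrier := K\<rparr>\<^esub> inv\<^bsub>L\<lparr>carrier := K\<rparr>\<^esub> (LK.eval (map ?h (snd (R q))) x)))"
      proof (intro ballI conjI impI)
        fix q assume q: "q \<in> Q"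
        then show "q > 0" using assms(4) prime_gt_0_nat by blast
        fix x assume x: "x \<in> carrier (L\<lparr>carrier := K\<rparr>)" and nz: "LK.eval (map ?h (snd (R q))) x \<noteq> \<zero>\<^bsub>L\<lparr>carrier := K\<rparr>\<^esub>"
        have c: "LK.eval (map ?h p) x \<in> carrier (L\<lparr>carrier := K\<rparr>)" if "p \<in> carrier (poly_ring U)" for p
          using polynomial_hom[OF hK assms(1) fK that] LK.eval_poly_in_carrier[OF LK.carrier_is_subring _ x] univ_poly_carrier by blast
        have "inv\<^bsub>L\<lparr>carrier := K\<rparr>\<^esub> (LK.eval (map ?h (snd (R q))) x) \<in> carrier (L\<lparr>carrier := K\<rparr>)"
          using c[of "snd (R q)"] R q nz LK.field_Units by (intro LK.Units_inv_closed) blast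
        then show "\<exists>y \<in> carrier (L\<lparr>carrier := K\<rparr>). y [^]\<^bsub>L\<lparr>carrier := K\<rparr>\<^esub> q = LK.eval (map ?h (fst (R q))) x \<otimes>\<^bsub>L\<lparr>carrier := K\<rparr>\<^esub> inv\<^bsub>L\<lparr>carrier := K\<rparr>\<^esub> (LK.eval (map ?h (snd (R q))) x)"
          using root[OF q] c[of "fst (R q)"] R q LK.m_closed by blast
      qed
      show "\<forall>i>0. P i \<in> carrier (poly_ring U) \<and> pirreducible\<^bsub>L\<lparr>carrier := K\<rparr>\<^esub> (carrier (L\<lparr>carrier := K\<rparr>)) (map ?h (P i))"
        using irr assms(10) by (simp add: L.univ_poly_consistent[OF Ksub])
    qed
  qed
qed

end
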